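(* Let $m, n$ be positive integers, let $W^1, \ldots, W^m$ be standard one-dimensional Brownian motions started at $0$ and $B^1, \ldots, B^n$ standard one-dimensional Brownian bridges on $[0,1]$, all $m+n$ processes being independent. Let $\mathsf{T}_{m,n}$ be the time in $[0,1]$ at which the combined maximum $$\max\left\{\max_{1\le i\le m}\max_{0\le s\le 1} W^i(s),\ \max_{1\le j\le n}\max_{0\le s\le 1} B^j(s)\right\}$$ is attained. Then the probability density function of $\mathsf{T}_{m,n}$ is $\rho_{m,n}(t) = \rho^1_{m,n}(t) + \rho^2_{m,n}(t)$, $t \in (0,1)$, where $$\rho^1_{m,n}(t) = \frac{m}{\pi t^{3/2}\sqrt{1-t}}\int_0^\infty x e^{-\frac{x^2}{2t}} \operatorname{erf}\left(\frac{x}{\sqrt2}\right)^{m-1}\left(1 - e^{-2x^2}\right)^n dx,$$ $$\rho^2_{m,n}(t) = \sqrt{\frac{2}{\pi}}\,\frac{n}{[t(1-t)]^{3/2}}\int_0^\infty x^2 e^{-\frac{x^2}{2t(1-t)}}\operatorname{erf}\left(\frac{x}{\sqrt2}\right)^{m}\left(1 - e^{-2x^2}\right)^{n-1} dx.$$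
   Context: A standard one-dimensional Brownian bridge on $[0,1]$ is the process corresponding to standard one-dimensional Brownian motion started at $0$ and conditioned to return to $0$ at time $1$. The error function is $\operatorname{erf}(z) = \frac{2}{\sqrt\pi}\int_0^z e^{-u^2}\,du$. The time $\mathsf{T}_{m,n}$ is understood as the (almost surely uniquely determined) time at which one of the $m+n$ processes attains the combined maximum. *)

theory Defs
  imports "HOL-Probability.Probability"
begin

definition erf :: "real \<Rightarrow> real" where
  "erf z = 2 / sqrt pi * (LBINT u=0..z. exp (- (u\<^sup>2)))"

definition std_brownian_motion_on :: "real set \<Rightarrow> 'a measure \<Rightarrow> (real \<Rightarrow> 'a \<Rightarrow> real) \<Rightarrow> bool" where
  "std_brownian_motion_on I M W \<longleftrightarrow>
     (\<forall>t\<in>I. W t \<in> borel_measurable M) \<and>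
     (AE \<omega> in M. W 0 \<omega> = 0) \<and>
     (\<forall>s\<in>I. \<forall>t\<in>I. s < t \<longrightarrow>
        distributed M lborel (\<lambda>\<omega>. W t \<omega> - W s \<omega>) (normal_density 0 (sqrt (t - s)))) \<and>
     (\<forall>(k::nat) (t :: nat \<Rightarrow> real). (\<forall>i\<le>k. t i \<in> I) \<and> (\<forall>i<k. t i \<le> t (Suc i)) \<longrightarrow>
        prob_space.indep_vars M (\<lambda>_. borel) (\<lambda>i \<omega>. W (t (Suc i)) \<omega> - W (t i) \<omega>) {..<k}) \<and>
     (AE \<omega> in M. continuous_on I (\<lambda>t. W t \<omega>))"

text \<open>
  If \<open>t 0 = 0 < t 1 < \<dots> < t k\<close> and \<open>x 0 = 0\<close>, then \<open>bm_density k t x\<close> is the joint density of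
  \<open>(W (t 1), \<dots>, W (t k))\<close> at \<open>(x 1, \<dots>, x k)\<close> for a standard Brownian motion \<open>W\<close>.
\<close>

definition bm_density :: "nat \<Rightarrow> (nat \<Rightarrow> real) \<Rightarrow> (nat \<Rightarrow> real) \<Rightarrow> real" where
  "bm_density k t x = (\<Prod>i<k. normal_density (x i) (sqrt (t (Suc i) - t i)) (x (Suc i)))"

text \<open>
  The Brownian bridge is Brownian motion conditioned on the null event \<open>W 1 = 0\<close>.  Conditioning is
  by means of densities: given \<open>W 1 = 0\<close>, the vector \<open>(W (t 1), \<dots>, W (t k))\<close> has the conditional
  density \<open>f(x 1, \<dots>, x k, 0) / g(0)\<close>, where \<open>f\<close> is the joint density of
  \<open>(W (t 1), \<dots>, W (t k), W 1)\<close> and \<open>g\<close>, the standard normal density, is that of \<open>W 1\<close>.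
  Below, \<open>t 0 = 0\<close> is the starting time and \<open>t (Suc k) = 1\<close> the conditioning time.
\<close>

definition std_brownian_bridge :: "'a measure \<Rightarrow> (real \<Rightarrow> 'a \<Rightarrow> real) \<Rightarrow> bool" where
  "std_brownian_bridge M B \<longleftrightarrow>
     (\<forall>t\<in>{0..1}. B t \<in> borel_measurable M) \<and>
     (AE \<omega> in M. B 0 \<omega> = 0) \<and>
     (AE \<omega> in M. B 1 \<omega> = 0) \<and>
     (\<forall>(k::nat) (t :: nat \<Rightarrow> real). t 0 = 0 \<and> t (Suc k) = 1 \<and> (\<forall>i\<le>k. t i < t (Suc i)) \<longrightarrow>
        distributed M (\<Pi>\<^sub>M i\<in>{1..k}. lborel) (\<lambda>\<omega>. \<lambda>i\<in>{1..k}. B (t i) \<omega>)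
          (\<lambda>x. ennreal (bm_density (Suc k) t (x(0 := 0, Suc k := 0)) / std_normal_density 0))) \<and>
     (AE \<omega> in M. continuous_on {0..1} (\<lambda>t. B t \<omega>))"

text \<open>
  All processes \<open>W 1, \<dots>, W m, B 1, \<dots>, B n\<close> are mutually independent as random elements of the
  path space \<open>\<real>\<^bsup>[0,1]\<^esup>\<close> with its product sigma-algebra.
\<close>

definition indep_processes ::
  "'a measure \<Rightarrow> nat \<Rightarrow> nat \<Rightarrow> (nat \<Rightarrow> real \<Rightarrow> 'a \<Rightarrow> real) \<Rightarrow> (nat \<Rightarrow> real \<Rightarrow> 'a \<Rightarrow> real) \<Rightarrow> bool" where
  "indep_processes M m n W B \<longleftrightarrow>
     prob_space.indep_vars M (\<lambda>_. \<Pi>\<^sub>M s\<in>{0..1::real}. borel)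
       (\<lambda>k \<omega>. \<lambda>s\<in>{0..1}. case_sum W B k s \<omega>) ({1..m} <+> {1..n})"

definition combined_max ::
  "nat \<Rightarrow> nat \<Rightarrow> (nat \<Rightarrow> real \<Rightarrow> 'a \<Rightarrow> real) \<Rightarrow> (nat \<Rightarrow> real \<Rightarrow> 'a \<Rightarrow> real) \<Rightarrow> 'a \<Rightarrow> real" where
  "combined_max m n W B \<omega> =
     max (MAX i\<in>{1..m}. SUP s\<in>{0..1}. W i s \<omega>) (MAX j\<in>{1..n}. SUP s\<in>{0..1}. B j s \<omega>)"

definition attains_combined_max ::
  "nat \<Rightarrow> nat \<Rightarrow> (nat \<Rightarrow> real \<Rightarrow> 'a \<Rightarrow> real) \<Rightarrow> (nat \<Rightarrow> real \<Rightarrow> 'a \<Rightarrow> real) \<Rightarrow> 'a \<Rightarrow> real \<Rightarrow> bool" where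
  "attains_combined_max m n W B \<omega> t \<longleftrightarrow> t \<in> {0..1} \<and>
     ((\<exists>i\<in>{1..m}. W i t \<omega> = combined_max m n W B \<omega>) \<or>
      (\<exists>j\<in>{1..n}. B j t \<omega> = combined_max m n W B \<omega>))"

definition rho1 :: "nat \<Rightarrow> nat \<Rightarrow> real \<Rightarrow> real" where
  "rho1 m n t = real m / (pi * t powr (3/2) * sqrt (1 - t)) *
     (LBINT x:{0..}. x * exp (- x\<^sup>2 / (2 * t)) * erf (x / sqrt 2) ^ (m - 1)
        * (1 - exp (- 2 * x\<^sup>2)) ^ n)"

definition rho2 :: "nat \<Rightarrow> nat \<Rightarrow> real \<Rightarrow> real" where
  "rho2 m n t = sqrt (2 / pi) * (real n / (t * (1 - t)) powr (3/2)) *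
     (LBINT x:{0..}. x\<^sup>2 * exp (- x\<^sup>2 / (2 * t * (1 - t))) * erf (x / sqrt 2) ^ m
        * (1 - exp (- 2 * x\<^sup>2)) ^ (n - 1))"

end

(*
  Fix t in (0,1) and let A and C be the maxima of one of the processes over [0,t] and [t,1].
  Discretising time, the reflection principle becomes a two-sided estimate between the transition
  kernel of the walk killed above a and the reflected kernel p_s(x-y) - p_s(2a-x-y); in the limit it
  gives P(A <= a, C <= b) both for Brownian motion and for the bridge, whose finite-dimensional
  densities are those of Brownian motion divided by a constant.  Hence (A, C) has an explicit joint
  density, so that ties between the maxima have probability zero, and by independence
    P(T <= t) = sum_k int g_k(t,x) prod_{j /= k} G_j(x) dx,
  where G_j is the distribution function of the maximum of process j and g_k(t,.) is the density of
  the maximum of process k restricted to the event that it is attained before t.  The derivative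
  of g_k in t is elementary, which gives the density of T; uniqueness of the argmax follows by
  letting t run through the rationals.
*)

theory Submission
  imports Defs "HOL-Real_Asymp.Real_Asymp"
begin

section \<open>The reflected heat kernel and the killed random walk\<close>

text \<open>The processes are given by finite-dimensional laws and almost surely continuous paths,
  so reflection is carried out on kernels and not on paths at a hitting time. The reflected kernel
  has an exact semigroup property, which yields the lower estimate at once. A walk can jump across
  the barrier, so the upper estimate raises the barrier by \<open>e\<close> and pays at most
  \<open>gauss d (2 * e)\<close> per step. The bridge differs from the motion only in the terminal
  function of the iteration, hence one limit argument serves both. Two levels \<open>a\<close> and
  \<open>b\<close> are carried along because "the maximum is attained before \<open>t\<close>"
  compares the maxima on either side of \<open>t\<close>. All computations stay in nonnegative
  integrals: the claimed density is integrated in time, and Tonelli turns it into the distribution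
  function already found, so nothing is differentiated under an integral sign. This comparison
  covers 0 < t < 1; the ends follow from right continuity and from the total mass 1 of the claimed
  density, which after Tonelli is the integral of the derivative of the distribution function of the
  combined maximum.\<close>

definition gauss :: "real \<Rightarrow> real \<Rightarrow> real" where
  "gauss s z = normal_density 0 (sqrt s) z"

text \<open>Method of images: a negative source at the mirror image \<open>2 * a - x\<close> makes
  the kernel vanish at \<open>y = a\<close>. This is the heat kernel of the half-line below
  \<open>a\<close> with absorption at \<open>a\<close>.\<close>

definition refl_kernel :: "real \<Rightarrow> real \<Rightarrow> real \<Rightarrow> real \<Rightarrow> real" where
  "refl_kernel a s x y = gauss s (x - y) - gauss s (2 * a - x - y)"

definition killed_step :: "real \<Rightarrow> real \<Rightarrow> (real \<Rightarrow> ennreal) \<Rightarrow> real \<Rightarrow> ennreal" where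
  "killed_step d a f x = (\<integral>\<^sup>+ z. ennreal (gauss d (x - z)) * indicator {..a} z * f z \<partial>lborel)"

text \<open>\<open>n\<close> counts the intermediate positions kept at or below \<open>a\<close>, so
  there are \<open>n + 1\<close> steps and the elapsed time is \<open>(n + 1) * d\<close>. The
  endpoints \<open>x\<close> and \<open>y\<close> are not constrained.\<close>

definition killed_kernel :: "real \<Rightarrow> real \<Rightarrow> nat \<Rightarrow> real \<Rightarrow> real \<Rightarrow> ennreal" where
  "killed_kernel d a n x y = (killed_step d a ^^ n) (\<lambda>z. ennreal (gauss d (z - y))) x"

lemma gauss_measurable [measurable]: "gauss s \<in> borel_measurable borel"
  unfolding gauss_def by measurable

lemma gauss_nonneg [simp]: "0 \<le> gauss s z"
  unfolding gauss_def by simp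

lemma gauss_minus [simp]: "gauss s (- z) = gauss s z"
  unfolding gauss_def normal_density_def by simp

lemma gauss_swap: "gauss s (x - y) = gauss s (y - x)"
  using gauss_minus[of s "x - y"] by simp

lemma gauss_eq: "s > 0 \<Longrightarrow> gauss s z = exp (- z\<^sup>2 / (2 * s)) / sqrt (2 * pi * s)"
  unfolding gauss_def normal_density_def by simp

lemma normal_density_eq_gauss: "normal_density x (sqrt s) y = gauss s (x - y)"
  unfolding gauss_def normal_density_def by (simp add: power2_commute)

lemma gauss_mono: "s > 0 \<Longrightarrow> \<bar>w\<bar> \<le> \<bar>z\<bar> \<Longrightarrow> gauss s z \<le> gauss s w"
  by (auto simp: gauss_eq divide_simps abs_le_square_iff)

lemma gauss_le: "s > 0 \<Longrightarrow> gauss s z \<le> 1 / sqrt (2 * pi * s)"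
  by (auto simp: gauss_eq divide_simps)

lemma nn_integral_lborel_shift:
  fixes f :: "real \<Rightarrow> ennreal"
  assumes [measurable]: "f \<in> borel_measurable borel"
  shows "(\<integral>\<^sup>+ x. f (c + x) \<partial>lborel) = (\<integral>\<^sup>+ x. f x \<partial>lborel)"
  using nn_integral_real_affine[of f 1 c] by simp

lemma nn_integral_lborel_reflect:
  fixes f :: "real \<Rightarrow> ennreal"
  assumes [measurable]: "f \<in> borel_measurable borel"
  shows "(\<integral>\<^sup>+ x. f (c - x) \<partial>lborel) = (\<integral>\<^sup>+ x. f x \<partial>lborel)"
  using nn_integral_real_affine[of f "-1" c] by simp

lemma nn_integral_gauss:
  assumes "s > 0"
  shows "(\<integral>\<^sup>+ z. ennreal (gauss s (x - z)) \<partial>lborel) = 1"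
proof -
  have "(\<integral>\<^sup>+ z. ennreal (gauss s (x - z)) \<partial>lborel) = (\<integral>\<^sup>+ z. ennreal (gauss s z) \<partial>lborel)"
    by (rule nn_integral_lborel_reflect[of "\<lambda>z. ennreal (gauss s z)"]) measurable
  also have "\<dots> = 1"
    using assms unfolding gauss_def
    by (subst nn_integral_eq_integral) auto
  finally show ?thesis .
qed

lemma nn_integral_gauss': "s > 0 \<Longrightarrow> (\<integral>\<^sup>+ z. ennreal (gauss s (z - x)) \<partial>lborel) = 1"
  using nn_integral_gauss[of s x] by (simp add: gauss_swap)

text \<open>The index of \<open>gauss\<close> is a variance, that is, an elapsed time; this is why
  convolution simply adds the indices.\<close>

lemma gauss_conv:
  assumes "s > 0" "u > 0"
  shows "(\<integral>\<^sup>+ z. ennreal (gauss s (x - z) * gauss u (z - y)) \<partial>lborel) = ennreal (gauss (s + u) (x - y))"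
proof -
  have "(\<integral>\<^sup>+ z. ennreal (gauss s (x - z) * gauss u (z - y)) \<partial>lborel)
      = (\<integral>\<^sup>+ z. ennreal (gauss s (x - (y + z)) * gauss u ((y + z) - y)) \<partial>lborel)"
    by (rule nn_integral_lborel_shift[symmetric, of "\<lambda>z. ennreal (gauss s (x - z) * gauss u (z - y))"]) measurable
  also have "\<dots> = ennreal (gauss (s + u) (x - y))"
    using fun_cong[OF conv_normal_density_zero_mean[of "sqrt s" "sqrt u"], of "x - y"] assms
    by (simp add: gauss_def diff_diff_eq)
  finally show ?thesis .
qed

lemma gauss_conv_has_integral:
  assumes "s > 0" "u > 0"
  shows "has_bochner_integral lborel (\<lambda>z. gauss s (x - z) * gauss u (z - y)) (gauss (s + u) (x - y))"
  using gauss_conv[OF assms] by (intro has_bochner_integral_nn_integral) auto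

lemma refl_kernel_measurable [measurable]:
  "(\<lambda>x. refl_kernel a s x y) \<in> borel_measurable borel"
  "(\<lambda>y. refl_kernel a s x y) \<in> borel_measurable borel"
  "(\<lambda>(x, y). refl_kernel a s x y) \<in> borel_measurable (borel \<Otimes>\<^sub>M borel)"
  unfolding refl_kernel_def by measurable

lemma refl_kernel_nonneg: "s > 0 \<Longrightarrow> x \<le> a \<Longrightarrow> y \<le> a \<Longrightarrow> 0 \<le> refl_kernel a s x y"
  unfolding refl_kernel_def using gauss_mono[of s "x - y" "2 * a - x - y"] by auto

lemma refl_kernel_le: "refl_kernel a s x y \<le> gauss s (x - y)"
  unfolding refl_kernel_def by simp

lemma refl_kernel_sym: "refl_kernel a s x y = refl_kernel a s y x"
  unfolding refl_kernel_def using gauss_swap[of s x y] by (simp add: algebra_simps)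

lemma refl_kernel_reflect_left: "refl_kernel a s (2 * a - x) y = - refl_kernel a s x y"
  unfolding refl_kernel_def using gauss_minus[of s "x - y"] by (simp add: algebra_simps)

lemma refl_kernel_reflect_right: "refl_kernel a s x (2 * a - y) = - refl_kernel a s x y"
  using refl_kernel_reflect_left[of a s y x] by (simp add: refl_kernel_sym)

text \<open>Both factors change sign when \<open>z\<close> is reflected at \<open>a\<close>, so the
  integrand is symmetric about \<open>a\<close>. The half-line integral is therefore half of the
  integral over the whole line, where Gaussian convolution applies to each of the four
  products.\<close>

lemma refl_kernel_conv:
  assumes "s > 0" "u > 0" "x \<le> a" "y \<le> a"
  shows "(\<integral>\<^sup>+ z. ennreal (refl_kernel a s x z) * indicator {..a} z * ennreal (refl_kernel a u z y) \<partial>lborel)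
    = ennreal (refl_kernel a (s + u) x y)"
proof -
  define h where "h z = refl_kernel a s x z * refl_kernel a u z y" for z
  have h_refl: "h (2 * a - z) = h z" for z
    unfolding h_def by (simp add: refl_kernel_reflect_left refl_kernel_reflect_right)
  have h0: "0 \<le> h z" if "z \<le> a" for z
    unfolding h_def using that assms by (simp add: refl_kernel_nonneg)
  have h_nonneg: "0 \<le> h z" for z
    using h0[of z] h0[of "2 * a - z"] h_refl[of z] by (cases "z \<le> a") auto
  have [measurable]: "h \<in> borel_measurable borel"
    unfolding h_def by measurable
  have "has_bochner_integral lborel
     (\<lambda>z. gauss s (x - z) * gauss u (z - y) - gauss s (x - z) * gauss u (z - (2 * a - y))
        - gauss s ((2 * a - x) - z) * gauss u (z - y) + gauss s ((2 * a - x) - z) * gauss u (z - (2 * a - y)))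
     (gauss (s + u) (x - y) - gauss (s + u) (x - (2 * a - y)) - gauss (s + u) ((2 * a - x) - y)
       + gauss (s + u) ((2 * a - x) - (2 * a - y)))"
    using assms by (intro has_bochner_integral_add has_bochner_integral_diff gauss_conv_has_integral)
  also have "(\<lambda>z. gauss s (x - z) * gauss u (z - y) - gauss s (x - z) * gauss u (z - (2 * a - y))
        - gauss s ((2 * a - x) - z) * gauss u (z - y) + gauss s ((2 * a - x) - z) * gauss u (z - (2 * a - y))) = h"
  proof
    fix z
    have "gauss u (z - (2 * a - y)) = gauss u (2 * a - z - y)"
      using gauss_minus[of u "z - (2 * a - y)"] by (simp add: algebra_simps)
    then show "gauss s (x - z) * gauss u (z - y) - gauss s (x - z) * gauss u (z - (2 * a - y))
        - gauss s ((2 * a - x) - z) * gauss u (z - y) + gauss s ((2 * a - x) - z) * gauss u (z - (2 * a - y)) = h z"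
      unfolding h_def refl_kernel_def by (simp only:) (simp add: algebra_simps)
  qed
  \<comment> \<open>Reflecting both points restores the first term and the two mixed terms agree,
    hence the factor 2.\<close>
  also have "gauss (s + u) (x - y) - gauss (s + u) (x - (2 * a - y)) - gauss (s + u) ((2 * a - x) - y)
       + gauss (s + u) ((2 * a - x) - (2 * a - y)) = 2 * refl_kernel a (s + u) x y"
    unfolding refl_kernel_def using gauss_minus[of "s+u" "x - (2 * a - y)"] gauss_minus[of "s+u" "x - y"]
    by (simp add: algebra_simps)
  finally have "(\<integral>\<^sup>+ z. ennreal (h z) \<partial>lborel) = ennreal (2 * refl_kernel a (s + u) x y)"
    using h_nonneg by (subst nn_integral_eq_integral)
      (auto simp: has_bochner_integral_iff)
  moreover have "(\<integral>\<^sup>+ z. ennreal (h z) \<partial>lborel)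
      = 2 * (\<integral>\<^sup>+ z. ennreal (h z) * indicator {..a} z \<partial>lborel)"
  proof -
    have "(\<integral>\<^sup>+ z. ennreal (h z) \<partial>lborel)
      = (\<integral>\<^sup>+ z. ennreal (h z) * indicator {..a} z + ennreal (h z) * indicator {a<..} z \<partial>lborel)"
      by (rule nn_integral_cong) (auto split: split_indicator)
    also have "\<dots> = (\<integral>\<^sup>+ z. ennreal (h z) * indicator {..a} z \<partial>lborel)
        + (\<integral>\<^sup>+ z. ennreal (h z) * indicator {a<..} z \<partial>lborel)"
      by (rule nn_integral_add) auto
    also have "(\<integral>\<^sup>+ z. ennreal (h z) * indicator {a<..} z \<partial>lborel)
      = (\<integral>\<^sup>+ z. ennreal (h (2 * a - z)) * indicator {a<..} (2 * a - z) \<partial>lborel)"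
      by (rule nn_integral_lborel_reflect[symmetric, of "\<lambda>z. ennreal (h z) * indicator {a<..} z"]) measurable
    also have "\<dots> = (\<integral>\<^sup>+ z. ennreal (h z) * indicator {..a} z \<partial>lborel)"
    proof (rule nn_integral_cong_AE)
      show "AE z in lborel. ennreal (h (2 * a - z)) * indicator {a<..} (2 * a - z) = ennreal (h z) * indicator {..a} z"
        using AE_lborel_singleton[of a]
        by eventually_elim (auto simp: h_refl split: split_indicator)
    qed
    finally show ?thesis by (simp add: mult_2)
  qed
  moreover have "ennreal (2 * refl_kernel a (s + u) x y) = 2 * ennreal (refl_kernel a (s + u) x y)"
    by (subst ennreal_mult') auto
  ultimately have "2 * (\<integral>\<^sup>+ z. ennreal (h z) * indicator {..a} z \<partial>lborel) = 2 * ennreal (refl_kernel a (s + u) x y)"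
    by simp
  then have "(\<integral>\<^sup>+ z. ennreal (h z) * indicator {..a} z \<partial>lborel) = ennreal (refl_kernel a (s + u) x y)"
    by (simp add: ennreal_mult_cancel_left)
  moreover have "ennreal (refl_kernel a s x z) * indicator {..a} z * ennreal (refl_kernel a u z y)
      = ennreal (h z) * indicator {..a} z" for z
    unfolding h_def using assms
    by (auto simp: ennreal_mult refl_kernel_nonneg split: split_indicator)
  ultimately show ?thesis by simp
qed

section \<open>The walk killed above a level\<close>

lemma killed_step_measurable [measurable]:
  assumes [measurable]: "f \<in> borel_measurable borel"
  shows "killed_step d a f \<in> borel_measurable borel"
  unfolding killed_step_def by measurable

lemma killed_kernel_0: "killed_kernel d a 0 x y = ennreal (gauss d (x - y))"
  by (simp add: killed_kernel_def)

lemma killed_kernel_Suc: "killed_kernel d a (Suc n) x y = killed_step d a (\<lambda>z. killed_kernel d a n z y) x"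
  by (simp add: killed_kernel_def[abs_def])

lemma killed_kernel_measurable2 [measurable]:
  "(\<lambda>(x, y). killed_kernel d a n x y) \<in> borel_measurable (borel \<Otimes>\<^sub>M borel)"
proof (induction n)
  case 0
  then show ?case by (simp add: killed_kernel_0)
next
  case (Suc n)
  note [measurable] = this
  have [measurable]: "(\<lambda>w. killed_kernel d a n (snd w) (snd (fst w)))
      \<in> borel_measurable ((borel \<Otimes>\<^sub>M borel) \<Otimes>\<^sub>M lborel)"
    by (rule measurable_compose[OF _ Suc, of "\<lambda>w. (snd w, snd (fst w))", simplified]) measurable
  show ?case
    unfolding killed_kernel_Suc killed_step_def case_prod_beta by measurable
qed

lemma killed_kernel_measurable [measurable]:
  "(\<lambda>x. killed_kernel d a n x y) \<in> borel_measurable borel"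
  "(\<lambda>y. killed_kernel d a n x y) \<in> borel_measurable borel"
  using measurable_compose[OF _ killed_kernel_measurable2, of "\<lambda>x. (x, y)" borel d a n]
    measurable_compose[OF _ killed_kernel_measurable2, of "\<lambda>y. (x, y)" borel d a n]
  by auto

text \<open>The reflected kernel lies below the Gaussian and satisfies the semigroup identity
  exactly, so replacing every Gaussian step by a reflected one only decreases the integral.
  Probabilistically, a walk watched at grid times survives at least as often as a path watched all
  the time.\<close>

lemma killed_kernel_ge:
  assumes "d > 0" "x \<le> a" "y \<le> a"
  shows "ennreal (refl_kernel a (real (Suc n) * d) x y) \<le> killed_kernel d a n x y"
  using assms(2)
proof (induction n arbitrary: x)
  case 0
  then show ?case by (simp add: killed_kernel_0 refl_kernel_le ennreal_leI)
next
  case (Suc n)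
  have "ennreal (refl_kernel a (real (Suc (Suc n)) * d) x y)
     = ennreal (refl_kernel a (d + real (Suc n) * d) x y)" by (simp add: algebra_simps)
  also have "\<dots> = (\<integral>\<^sup>+ z. ennreal (refl_kernel a d x z) * indicator {..a} z * ennreal (refl_kernel a (real (Suc n) * d) z y) \<partial>lborel)"
    using assms Suc by (subst refl_kernel_conv) (auto simp del: of_nat_Suc)
  also have "\<dots> \<le> killed_kernel d a (Suc n) x y"
    unfolding killed_kernel_Suc killed_step_def using Suc
    by (intro nn_integral_mono) (auto intro!: mult_mono ennreal_leI refl_kernel_le simp del: of_nat_Suc split: split_indicator)
  finally show ?case .
qed

text \<open>The bound depends on the elapsed time alone. It becomes the majorant, uniform in the
  number of steps, in the limits under the integral sign.\<close>

lemma killed_kernel_le_gauss: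
  assumes "d > 0"
  shows "killed_kernel d a n x y \<le> ennreal (gauss (real (Suc n) * d) (x - y))"
proof (induction n arbitrary: x)
  case 0
  then show ?case by (simp add: killed_kernel_0)
next
  case (Suc n)
  have "killed_kernel d a (Suc n) x y \<le>
      (\<integral>\<^sup>+ z. ennreal (gauss d (x - z)) * ennreal (gauss (real (Suc n) * d) (z - y)) \<partial>lborel)"
    unfolding killed_kernel_Suc killed_step_def using Suc
    by (intro nn_integral_mono) (auto intro!: mult_mono simp del: of_nat_Suc split: split_indicator)
  also have "\<dots> = ennreal (gauss (d + real (Suc n) * d) (x - y))"
    using assms gauss_conv[of d "real (Suc n) * d"] by (simp add: ennreal_mult)
  finally show ?case by (simp add: algebra_simps)
qed

text \<open>For \<open>x\<close> and \<open>z\<close> at or below \<open>a\<close>, the image of one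
  point at the barrier \<open>a + e\<close> is at distance at least \<open>2 * e\<close> from the
  other, so a Gaussian step exceeds the reflected one by at most \<open>gauss d (2 * e)\<close>. The
  kernels that multiply such an error have mass at most 1, so the errors of the \<open>n + 1\<close>
  steps just add up.\<close>

lemma killed_kernel_le:
  assumes "d > 0" "e > 0" "x \<le> a" "y \<le> a"
  shows "killed_kernel d a n x y \<le> ennreal (refl_kernel (a + e) (real (Suc n) * d) x y + real (Suc n) * gauss d (2 * e))"
  using assms(3)
proof (induction n arbitrary: x)
  case 0
  have "gauss d (2 * (a + e) - x - y) \<le> gauss d (2 * e)"
    using 0 assms by (intro gauss_mono) auto
  then show ?case by (auto simp: killed_kernel_0 refl_kernel_def intro!: ennreal_leI)
next
  case (Suc n)
  define u where "u = real (Suc n) * d"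
  define \<eta> where "\<eta> = gauss d (2 * e)"
  have u: "u > 0" "\<eta> \<ge> 0" using assms by (auto simp: u_def \<eta>_def)
  define r where "r s x y = ennreal (refl_kernel (a + e) s x y)" for s x y
  have [measurable]: "(\<lambda>z. r s x z) \<in> borel_measurable borel" "(\<lambda>z. r s z x) \<in> borel_measurable borel" for s x
    unfolding r_def by measurable
  have "killed_kernel d a (Suc n) x y \<le> (\<integral>\<^sup>+ z. (r d x z * indicator {..a + e} z * r u z y)
       + (ennreal \<eta> * ennreal (gauss u (z - y)) + ennreal (real (Suc n) * \<eta>) * ennreal (gauss d (x - z))) \<partial>lborel)"
    unfolding killed_kernel_Suc killed_step_def
  proof (rule nn_integral_mono)
    fix z
    show "ennreal (gauss d (x - z)) * indicator {..a} z * killed_kernel d a n z y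
      \<le> r d x z * indicator {..a + e} z * r u z y
       + (ennreal \<eta> * ennreal (gauss u (z - y)) + ennreal (real (Suc n) * \<eta>) * ennreal (gauss d (x - z)))"
    proof (cases "z \<le> a")
      case True
      let ?r = "refl_kernel (a + e) d x z" and ?q = "refl_kernel (a + e) u z y"
      have pos: "0 \<le> ?r" "0 \<le> ?q"
        using True assms Suc.prems u by (auto intro!: refl_kernel_nonneg)
      have "gauss d (2 * (a + e) - x - z) \<le> \<eta>"
        unfolding \<eta>_def using Suc.prems True assms by (intro gauss_mono) auto
      then have g: "gauss d (x - z) \<le> ?r + \<eta>" by (simp add: refl_kernel_def)
      have "gauss d (x - z) * (?q + real (Suc n) * \<eta>) = gauss d (x - z) * ?q + real (Suc n) * \<eta> * gauss d (x - z)"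
        by (simp add: algebra_simps)
      \<comment> \<open>The new error \<eta> meets \<open>?q\<close>, bounded by
        \<open>gauss u\<close>, while the error inherited from the induction hypothesis meets
        \<open>gauss d\<close>; both Gaussians integrate to 1.\<close>
      also have "gauss d (x - z) * ?q \<le> (?r + \<eta>) * ?q"
        using g pos by (intro mult_right_mono)
      also have "(?r + \<eta>) * ?q \<le> ?r * ?q + \<eta> * gauss u (z - y)"
        using u refl_kernel_le[of "a+e" u z y] by (simp add: algebra_simps mult_left_mono)
      finally have "gauss d (x - z) * (?q + real (Suc n) * \<eta>)
          \<le> ?r * ?q + (\<eta> * gauss u (z - y) + real (Suc n) * \<eta> * gauss d (x - z))" by simp
      then have "ennreal (gauss d (x - z)) * ennreal (?q + real (Suc n) * \<eta>)
          \<le> ennreal ?r * ennreal ?q + (ennreal \<eta> * ennreal (gauss u (z - y)) + ennreal (real (Suc n) * \<eta>) * ennreal (gauss d (x - z)))"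
        using pos u by (simp add: ennreal_mult[symmetric] ennreal_plus[symmetric] del: ennreal_plus of_nat_Suc)
      moreover have "killed_kernel d a n z y \<le> ennreal (?q + real (Suc n) * \<eta>)"
        using Suc.IH[OF True] unfolding u_def \<eta>_def .
      ultimately show ?thesis
        unfolding r_def using True assms
        by (auto intro: order_trans[OF mult_left_mono])
    qed simp
  qed
  also have "\<dots> = (\<integral>\<^sup>+ z. r d x z * indicator {..a + e} z * r u z y \<partial>lborel)
      + (ennreal \<eta> * (\<integral>\<^sup>+ z. ennreal (gauss u (z - y)) \<partial>lborel)
         + ennreal (real (Suc n) * \<eta>) * (\<integral>\<^sup>+ z. ennreal (gauss d (x - z)) \<partial>lborel))"
    by (simp add: nn_integral_add nn_integral_cmult del: of_nat_Suc)
  also have "\<dots> = ennreal (refl_kernel (a + e) (d + u) x y) + (ennreal \<eta> + ennreal (real (Suc n) * \<eta>))"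
    unfolding r_def using assms u Suc.prems
    by (simp add: nn_integral_gauss nn_integral_gauss' refl_kernel_conv del: of_nat_Suc)
  also have "\<dots> = ennreal (refl_kernel (a + e) (d + u) x y + (\<eta> + real (Suc n) * \<eta>))"
    using assms u Suc.prems refl_kernel_nonneg[of "d + u" x "a + e" y]
    by (simp add: ennreal_plus del: of_nat_Suc)
  finally show ?case unfolding u_def \<eta>_def by (simp add: algebra_simps)
qed

text \<open>The reflection principle: with \<open>n\<close> steps the barrier is raised by \<open>n powr (-1/4)\<close>, which
  exceeds the step size \<open>n powr (-1/2)\<close> by so much that the total error is exponentially small.\<close>

lemma killed_kernel_tendsto:
  assumes "s > 0" "x \<le> a" "y \<le> a"
  shows "(\<lambda>n. killed_kernel (s / real (Suc n)) a n x y) \<longlonglongrightarrow> ennreal (refl_kernel a s x y)"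
proof (rule tendsto_sandwich[OF _ _ tendsto_const])
  let ?e = "\<lambda>n. real (Suc n) powr (- 1 / 4)"
  show "\<forall>\<^sub>F n in sequentially. ennreal (refl_kernel a s x y) \<le> killed_kernel (s / real (Suc n)) a n x y"
    using killed_kernel_ge[of "s / real (Suc n)" x a y n for n] assms
    by (intro always_eventually allI) (auto simp del: of_nat_Suc)
  show "\<forall>\<^sub>F n in sequentially. killed_kernel (s / real (Suc n)) a n x y
     \<le> ennreal (refl_kernel (a + ?e n) s x y + real (Suc n) * gauss (s / real (Suc n)) (2 * ?e n))"
    using killed_kernel_le[of "s / real (Suc n)" "?e n" x a y n for n] assms
    by (intro always_eventually allI) (auto simp del: of_nat_Suc)
  have e: "?e \<longlonglongrightarrow> 0" by real_asymp
  have "(\<lambda>n. real (Suc n) * gauss (s / real (Suc n)) (2 * ?e n)) \<longlonglongrightarrow> 0"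
    unfolding gauss_def normal_density_def using assms(1) by simp real_asymp
  moreover have "(\<lambda>n. refl_kernel (a + ?e n) s x y) \<longlonglongrightarrow> refl_kernel (a + 0) s x y"
    unfolding refl_kernel_def gauss_def normal_density_def using assms(1) e
    by (intro tendsto_intros e) auto
  ultimately show "(\<lambda>n. ennreal (refl_kernel (a + ?e n) s x y + real (Suc n) * gauss (s / real (Suc n)) (2 * ?e n)))
      \<longlonglongrightarrow> ennreal (refl_kernel a s x y)"
    using tendsto_add[of "\<lambda>n. refl_kernel (a + ?e n) s x y" "refl_kernel a s x y" sequentially _ 0]
    by (intro tendsto_ennrealI) auto
qed

text \<open>There is one more iterate than the index of the kernel because the kernel leaves its
  endpoint \<open>y\<close> free; the indicator of \<open>{..a}\<close> at \<open>y\<close> supplies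
  the missing constraint.\<close>

lemma killed_step_funpow:
  assumes [measurable]: "f \<in> borel_measurable borel"
  shows "(killed_step d a ^^ Suc n) f x
     = (\<integral>\<^sup>+ y. killed_kernel d a n x y * indicator {..a} y * f y \<partial>lborel)"
proof (induction n arbitrary: x)
  case 0
  then show ?case by (simp add: killed_step_def killed_kernel_0)
next
  case (Suc n)
  have "(killed_step d a ^^ Suc (Suc n)) f x
     = (\<integral>\<^sup>+ z. \<integral>\<^sup>+ y. ennreal (gauss d (x - z)) * indicator {..a} z *
         (killed_kernel d a n z y * indicator {..a} y * f y) \<partial>lborel \<partial>lborel)"
    unfolding funpow.simps(2)[of "Suc n"] comp_def killed_step_def[of d a "(killed_step d a ^^ Suc n) f"] Suc
    by (simp add: nn_integral_cmult)
  also have "\<dots> = (\<integral>\<^sup>+ y. \<integral>\<^sup>+ z. ennreal (gauss d (x - z)) * indicator {..a} z *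
         (killed_kernel d a n z y * indicator {..a} y * f y) \<partial>lborel \<partial>lborel)"
    by (rule lborel_pair.Fubini') measurable
  also have "\<dots> = (\<integral>\<^sup>+ y. killed_kernel d a (Suc n) x y * indicator {..a} y * f y \<partial>lborel)"
  proof (rule nn_integral_cong)
    fix y
    have "(\<integral>\<^sup>+ z. ennreal (gauss d (x - z)) * indicator {..a} z * (killed_kernel d a n z y * indicator {..a} y * f y) \<partial>lborel)
      = (\<integral>\<^sup>+ z. (indicator {..a} y * f y) * (ennreal (gauss d (x - z)) * indicator {..a} z * killed_kernel d a n z y) \<partial>lborel)"
      by (simp only: ac_simps)
    also have "\<dots> = indicator {..a} y * f y * killed_kernel d a (Suc n) x y"
      unfolding killed_kernel_Suc killed_step_def by (rule nn_integral_cmult) measurable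
    finally show "(\<integral>\<^sup>+ z. ennreal (gauss d (x - z)) * indicator {..a} z * (killed_kernel d a n z y * indicator {..a} y * f y) \<partial>lborel)
      = killed_kernel d a (Suc n) x y * indicator {..a} y * f y" by (simp only: ac_simps)
  qed
  finally show ?case .
qed

section \<open>Finite-dimensional distributions\<close>

text \<open>Expectation of \<open>f\<close> at time \<open>t k\<close>, restricted to walks from 0
  that lie at or below \<open>c i\<close> at each grid time \<open>t i\<close>. The last step is
  absorbed into \<open>f\<close> first, the order in which product integrals lose their last
  coordinate.\<close>

fun grid_iter :: "(nat \<Rightarrow> real) \<Rightarrow> (nat \<Rightarrow> real) \<Rightarrow> nat \<Rightarrow> (real \<Rightarrow> ennreal) \<Rightarrow> ennreal" where
  "grid_iter t c 0 f = f 0"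
| "grid_iter t c (Suc k) f = grid_iter t c k (killed_step (t (Suc k) - t k) (c (Suc k)) f)"

lemma funpow_killed_step_measurable [measurable]:
  assumes [measurable]: "f \<in> borel_measurable borel"
  shows "(killed_step d a ^^ n) f \<in> borel_measurable borel"
  by (induction n) auto

lemma grid_iter_add:
  assumes "\<And>i. k \<le> i \<Longrightarrow> i < k + j \<Longrightarrow> t (Suc i) - t i = d"
    and "\<And>i. k < i \<Longrightarrow> i \<le> k + j \<Longrightarrow> c i = a"
  shows "grid_iter t c (k + j) f = grid_iter t c k ((killed_step d a ^^ j) f)"
  using assms
proof (induction j arbitrary: f)
  case (Suc j)
  have "grid_iter t c (k + Suc j) f = grid_iter t c (k + j) (killed_step d a f)"
    using Suc.prems by simp
  also have "\<dots> = grid_iter t c k ((killed_step d a ^^ j) (killed_step d a f))"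
    by (rule Suc.IH) (use Suc.prems in auto)
  finally show ?case by (simp add: funpow_swap1)
qed simp

text \<open>The coordinates are positions at the times \<open>1..k\<close>, and the update at 0
  inserts the starting point. Integrating out the last coordinate merges the last density factor and
  the last indicator into one \<open>killed_step\<close>.\<close>

lemma bridge_grid_integral:
  assumes [measurable]: "f \<in> borel_measurable borel"
  shows "(\<integral>\<^sup>+ x. ennreal (bm_density k t (x(0 := 0))) * (\<Prod>i\<in>{1..k}. indicator {..c i} (x i)) * f ((x(0 := 0)) k)
       \<partial>(\<Pi>\<^sub>M i\<in>{1..k}. lborel)) = grid_iter t c k f"
  using assms
proof (induction k arbitrary: f)
  case 0
  then show ?case by (simp add: bm_density_def PiM_empty nn_integral_count_space_finite)
next
  case (Suc k)
  note [measurable] = Suc.prems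
  interpret product_sigma_finite "\<lambda>_::nat. lborel :: real measure" ..
  have ins: "{1..Suc k} = insert (Suc k) {1..k}" by auto
  let ?F = "\<lambda>k f x. ennreal (bm_density k t (x(0 := 0))) * (\<Prod>i\<in>{1..k}. indicator {..c i} (x i)) * f ((x(0 := 0)) k)"
  have m0: "(\<lambda>x. (x(0 := 0)) j) \<in> borel_measurable (\<Pi>\<^sub>M i\<in>{1..k}. lborel)" if "j \<le> k" for j k :: nat
    using that by (cases "j = 0") auto
  have dm: "(\<lambda>x. bm_density k t (x(0 := 0))) \<in> borel_measurable (\<Pi>\<^sub>M i\<in>{1..k'}. lborel)" if "k \<le> k'" for k k'
    unfolding bm_density_def normal_density_eq_gauss
    by (intro borel_measurable_prod measurable_compose[OF _ gauss_measurable] borel_measurable_diff m0) (use that in auto)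
  have Fm: "?F (Suc k) f \<in> borel_measurable (\<Pi>\<^sub>M i\<in>{1..Suc k}. lborel)"
    by (intro borel_measurable_times_ennreal measurable_compose[OF dm measurable_ennreal]
        measurable_compose[OF m0 Suc.prems] borel_measurable_prod) auto
  have "(\<integral>\<^sup>+ x. ?F (Suc k) f x \<partial>(\<Pi>\<^sub>M i\<in>{1..Suc k}. lborel))
    = (\<integral>\<^sup>+ x. \<integral>\<^sup>+ y. ?F (Suc k) f (x(Suc k := y)) \<partial>lborel \<partial>(\<Pi>\<^sub>M i\<in>{1..k}. lborel))"
    unfolding ins by (rule product_nn_integral_insert[OF _ _ Fm[unfolded ins]]) auto
  also have "\<dots> = (\<integral>\<^sup>+ x. ?F k (killed_step (t (Suc k) - t k) (c (Suc k)) f) x \<partial>(\<Pi>\<^sub>M i\<in>{1..k}. lborel))"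
  proof (rule nn_integral_cong)
    fix x :: "nat \<Rightarrow> real"
    let ?x = "x(0 := 0)"
    let ?C = "ennreal (bm_density k t ?x) * (\<Prod>i\<in>{1..k}. indicator {..c i} (x i))"
    let ?d = "t (Suc k) - t k"
    have "?F (Suc k) f (x(Suc k := y)) = ?C * (ennreal (gauss ?d (?x k - y)) * indicator {..c (Suc k)} y * f y)" for y
    proof -
      have "bm_density (Suc k) t ((x(Suc k := y))(0 := 0)) = bm_density k t ?x * gauss ?d (?x k - y)"
        unfolding bm_density_def normal_density_eq_gauss
        by (simp add: lessThan_Suc mult.commute) (auto intro!: prod.cong)
      moreover have "(\<Prod>i\<in>{1..Suc k}. indicator {..c i} ((x(Suc k := y)) i) :: ennreal)
          = indicator {..c (Suc k)} y * (\<Prod>i\<in>{1..k}. indicator {..c i} (x i))"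
        unfolding ins by (subst prod.insert) (auto intro!: prod.cong)
      moreover have "0 \<le> bm_density k t ?x" unfolding bm_density_def by (intro prod_nonneg) auto
      ultimately show ?thesis
        by (simp add: ennreal_mult ac_simps)
    qed
    then show "(\<integral>\<^sup>+ y. ?F (Suc k) f (x(Suc k := y)) \<partial>lborel) = ?F k (killed_step ?d (c (Suc k)) f) x"
      unfolding killed_step_def by (simp add: nn_integral_cmult)
  qed
  also have "\<dots> = grid_iter t c (Suc k) f"
    by (subst Suc.IH) auto
  finally show ?case .
qed

text \<open>Brownian motion is specified by its increments, so here the coordinates are increments
  and the positions are partial sums. Translating the last increment by the current position
  produces the same \<open>killed_step\<close> as for densities of positions.\<close>

lemma increments_grid_integral:
  assumes d: "\<And>i. t i < t (Suc i)"
  assumes [measurable]: "f \<in> borel_measurable borel"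
  shows "(\<integral>\<^sup>+ x. (\<Prod>i<k. indicator {..c (Suc i)} (\<Sum>j\<le>i. x j)) * f (\<Sum>j<k. x j)
       \<partial>(\<Pi>\<^sub>M i\<in>{..<k}. density lborel (normal_density 0 (sqrt (t (Suc i) - t i))))) = grid_iter t c k f"
  using assms(2)
proof (induction k arbitrary: f)
  case 0
  then show ?case by (simp add: PiM_empty nn_integral_count_space_finite)
next
  case (Suc k)
  note [measurable] = Suc.prems
  let ?N = "\<lambda>i. density lborel (normal_density 0 (sqrt (t (Suc i) - t i)))"
  have "prob_space (?N i)" for i
    using d[of i] by (intro prob_space_normal_density) auto
  then interpret product_prob_space ?N
    by (simp add: product_prob_space_def product_prob_space_axioms_def product_sigma_finite_def prob_space_imp_sigma_finite)
  let ?F = "\<lambda>k f x. (\<Prod>i<k. indicator {..c (Suc i)} (\<Sum>j\<le>i. x j :: real)) * (f (\<Sum>j<k. x j) :: ennreal)"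
  have sm: "(\<lambda>x. \<Sum>j\<in>A. x j) \<in> borel_measurable (\<Pi>\<^sub>M i\<in>{..<k}. ?N i)" if "A \<subseteq> {..<k}" for A k
    using that
    by (intro borel_measurable_sum) (auto intro!: measurable_compose[OF measurable_component_singleton, of _ _ ?N])
  have Fm: "?F (Suc k) f \<in> borel_measurable (\<Pi>\<^sub>M i\<in>{..<Suc k}. ?N i)"
    by (intro borel_measurable_times_ennreal measurable_compose[OF sm Suc.prems] borel_measurable_prod
        measurable_compose[OF sm borel_measurable_indicator]) auto
  have "(\<integral>\<^sup>+ x. ?F (Suc k) f x \<partial>(\<Pi>\<^sub>M i\<in>{..<Suc k}. ?N i))
    = (\<integral>\<^sup>+ x. \<integral>\<^sup>+ y. ?F (Suc k) f (x(k := y)) \<partial>?N k \<partial>(\<Pi>\<^sub>M i\<in>{..<k}. ?N i))"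
    unfolding lessThan_Suc by (rule product_nn_integral_insert[OF _ _ Fm[unfolded lessThan_Suc]]) auto
  also have "\<dots> = (\<integral>\<^sup>+ x. ?F k (killed_step (t (Suc k) - t k) (c (Suc k)) f) x \<partial>(\<Pi>\<^sub>M i\<in>{..<k}. ?N i))"
  proof (rule nn_integral_cong)
    fix x :: "nat \<Rightarrow> real"
    let ?C = "\<Prod>i<k. indicator {..c (Suc i)} (\<Sum>j\<le>i. x j) :: ennreal"
    let ?d = "t (Suc k) - t k"
    let ?S = "\<Sum>j<k. x j"
    have s: "(\<Sum>j<k. (x(k := y)) j) = ?S" for y by (intro sum.cong) auto
    have "?F (Suc k) f (x(k := y)) = ?C * (indicator {..c (Suc k)} (?S + y) * f (?S + y))" for y
    proof -
      have "(\<Prod>i<k. indicator {..c (Suc i)} (\<Sum>j\<le>i. (x(k := y)) j) :: ennreal) = ?C"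
        by (intro prod.cong arg_cong[where f = "indicator _"] sum.cong) auto
      then show ?thesis
        by (simp add: lessThan_Suc_atMost[symmetric] s ac_simps)
    qed
    then have "(\<integral>\<^sup>+ y. ?F (Suc k) f (x(k := y)) \<partial>?N k)
      = ?C * (\<integral>\<^sup>+ y. ennreal (gauss ?d y) * (indicator {..c (Suc k)} (?S + y) * f (?S + y)) \<partial>lborel)"
      by (simp add: nn_integral_cmult nn_integral_density gauss_def)
    also have "(\<integral>\<^sup>+ y. ennreal (gauss ?d y) * (indicator {..c (Suc k)} (?S + y) * f (?S + y)) \<partial>lborel)
      = (\<integral>\<^sup>+ y. ennreal (gauss ?d (?S - (?S + y))) * indicator {..c (Suc k)} (?S + y) * f (?S + y) \<partial>lborel)"
      by (simp add: ac_simps)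
    also have "\<dots> = killed_step ?d (c (Suc k)) f ?S"
      unfolding killed_step_def
      by (rule nn_integral_lborel_shift[of "\<lambda>z. ennreal (gauss ?d (?S - z)) * indicator {..c (Suc k)} z * f z"]) measurable
    finally show "(\<integral>\<^sup>+ y. ?F (Suc k) f (x(k := y)) \<partial>?N k) = ?F k (killed_step ?d (c (Suc k)) f) x" .
  qed
  also have "\<dots> = grid_iter t c (Suc k) f"
    by (subst Suc.IH) auto
  finally show ?case .
qed

lemma brownian_motion_grid_prob:
  assumes M: "prob_space M" and W: "std_brownian_motion_on {0..1} M W"
    and t0: "t 0 = 0" and d: "\<And>i. t i < t (Suc i)" and t1: "t k \<le> 1" and k: "k > 0"
  shows "emeasure M {w \<in> space M. \<forall>i\<in>{1..k}. W (t i) w \<le> c i} = grid_iter t c k (\<lambda>_. 1)"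
proof -
  interpret prob_space M by fact
  have mono: "t i \<le> t j" if "i \<le> j" for i j
    by (rule lift_Suc_mono_le[of t, OF less_imp_le[OF d] that])
  have tI: "t i \<in> {0..1}" if "i \<le> k" for i
    using mono[of 0 i] mono[of i k] that t0 t1 by auto
  have Wm[measurable]: "W (t i) \<in> borel_measurable M" if "i \<le> k" for i
    using W tI[OF that] unfolding std_brownian_motion_on_def by blast
  define D where "D i w = W (t (Suc i)) w - W (t i) w" for i w
  have Dm: "D i \<in> borel_measurable M" if "i < k" for i
    unfolding D_def using that by (intro borel_measurable_diff Wm) auto
  have ind: "indep_vars (\<lambda>_. borel) D {..<k}"
    using W tI d less_imp_le unfolding std_brownian_motion_on_def D_def by blast
  have DD: "distr M borel (D i) = density lborel (normal_density 0 (sqrt (t (Suc i) - t i)))" if "i < k" for i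
  proof -
    have "distributed M lborel (D i) (normal_density 0 (sqrt (t (Suc i) - t i)))"
      using W tI[of i] tI[of "Suc i"] d[of i] that unfolding std_brownian_motion_on_def D_def by auto
    from distributed_distr_eq_density[OF this] show ?thesis
      by (simp cong: distr_cong)
  qed
  let ?N = "\<lambda>i. density lborel (normal_density 0 (sqrt (t (Suc i) - t i)))"
  have "distr M (\<Pi>\<^sub>M i\<in>{..<k}. borel) (\<lambda>x. \<lambda>i\<in>{..<k}. D i x) = (\<Pi>\<^sub>M i\<in>{..<k}. distr M borel (D i))"
    using ind k by (subst (asm) indep_vars_iff_distr_eq_PiM') (auto intro: Dm)
  also have "\<dots> = (\<Pi>\<^sub>M i\<in>{..<k}. ?N i)"
    by (intro PiM_cong DD) auto
  finally have law: "distr M (\<Pi>\<^sub>M i\<in>{..<k}. borel) (\<lambda>x. \<lambda>i\<in>{..<k}. D i x) = (\<Pi>\<^sub>M i\<in>{..<k}. ?N i)" .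
  let ?F = "\<lambda>x. (\<Prod>i<k. indicator {..c (Suc i)} (\<Sum>j\<le>i. x j :: real)) :: ennreal"
  have sm: "(\<lambda>x. \<Sum>j\<le>i. x j :: real) \<in> borel_measurable (\<Pi>\<^sub>M i\<in>{..<k}. borel)" if "i < k" for i
    using that by (intro borel_measurable_sum measurable_component_singleton) auto
  have Fm: "?F \<in> borel_measurable (\<Pi>\<^sub>M i\<in>{..<k}. borel)"
    by (intro borel_measurable_prod_ennreal measurable_compose[OF sm borel_measurable_indicator]) auto
  have rm: "(\<lambda>x. \<lambda>i\<in>{..<k}. D i x) \<in> measurable M (\<Pi>\<^sub>M i\<in>{..<k}. borel)"
    by (intro measurable_restrict Dm) auto
  have W0: "AE w in M. W 0 w = 0"
    using W unfolding std_brownian_motion_on_def by blast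
  have "emeasure M {w \<in> space M. \<forall>i\<in>{1..k}. W (t i) w \<le> c i}
     = (\<integral>\<^sup>+ w. indicator {w \<in> space M. \<forall>i\<in>{1..k}. W (t i) w \<le> c i} w \<partial>M)"
    by (subst nn_integral_indicator) (auto intro!: sets.sets_Collect_finite_All)
  also have "\<dots> = (\<integral>\<^sup>+ w. ?F (\<lambda>i\<in>{..<k}. D i w) \<partial>M)"
  proof (rule nn_integral_cong_AE)
    show "AE w in M. indicator {w \<in> space M. \<forall>i\<in>{1..k}. W (t i) w \<le> c i} w = ?F (\<lambda>i\<in>{..<k}. D i w)"
      using W0 AE_space
    proof eventually_elim
      case (elim w)
      have "(\<Sum>j<i. D j w) = W (t i) w" for i
        using sum_lessThan_telescope[of "\<lambda>i. W (t i) w" i] elim t0 by (simp add: D_def)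
      then have "(\<Sum>j\<le>i. (\<lambda>i\<in>{..<k}. D i w) j) = W (t (Suc i)) w" if "i < k" for i
        using that by (simp add: lessThan_Suc_atMost[symmetric])
      then have "?F (\<lambda>i\<in>{..<k}. D i w) = (\<Prod>i<k. indicator {..c (Suc i)} (W (t (Suc i)) w))"
        by (intro prod.cong) auto
      also have "\<dots> = (\<Prod>i\<in>{1..k}. indicator {..c i} (W (t i) w))"
        by (rule prod.reindex_bij_witness[of _ "\<lambda>i. i - 1" Suc]) auto
      also have "\<dots> = indicator {w \<in> space M. \<forall>i\<in>{1..k}. W (t i) w \<le> c i} w"
        using elim by (auto simp: indicator_def)
      finally show ?case by simp
    qed
  qed
  also have "\<dots> = (\<integral>\<^sup>+ x. ?F x \<partial>distr M (\<Pi>\<^sub>M i\<in>{..<k}. borel) (\<lambda>x. \<lambda>i\<in>{..<k}. D i x))"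
    by (rule nn_integral_distr[OF rm, symmetric]) (use Fm in simp)
  also have "\<dots> = grid_iter t c k (\<lambda>_. 1)"
    unfolding law using increments_grid_integral[of t "\<lambda>_. 1" k c, OF d] by simp
  finally show ?thesis .
qed

lemma grid_iter_cmult:
  assumes "f \<in> borel_measurable borel"
  shows "grid_iter t c k (\<lambda>x. C * f x) = C * grid_iter t c k f"
  using assms
proof (induction k arbitrary: f)
  case (Suc k)
  note [measurable] = Suc.prems
  have "killed_step d a (\<lambda>x. C * f x) = (\<lambda>x. C * killed_step d a f x)" for d a
    unfolding killed_step_def by (auto simp: fun_eq_iff nn_integral_cmult[symmetric] ac_simps)
  then show ?case by (simp add: Suc.IH)
qed simp

text \<open>\<open>sqrt (2 * pi)\<close> is the reciprocal of the conditioning density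
  \<open>std_normal_density 0\<close>. The density factor of the step that leads to 0 at time 1
  becomes the terminal function of the iteration.\<close>

lemma brownian_bridge_grid_prob:
  assumes M: "prob_space M" and B: "std_brownian_bridge M B"
    and t0: "t 0 = 0" and d: "\<And>i. i \<le> k \<Longrightarrow> t i < t (Suc i)" and t1: "t (Suc k) = 1"
  shows "emeasure M {w \<in> space M. \<forall>i\<in>{1..k}. B (t i) w \<le> c i}
     = ennreal (sqrt (2 * pi)) * grid_iter t c k (\<lambda>x. ennreal (gauss (t (Suc k) - t k) (x - 0)))"
proof -
  interpret prob_space M by fact
  let ?P = "\<Pi>\<^sub>M i\<in>{1..k}. lborel :: real measure"
  have tI: "t i \<in> {0..1}" if "i \<in> {1..k}" for i
  proof -
    have "t 0 \<le> t i" if "i \<le> Suc k" for i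
      using that
    proof (induction i)
      case (Suc i)
      then show ?case using d[of i] by simp
    qed simp
    moreover have "t (Suc k - j) \<le> t (Suc k)" if "j \<le> Suc k" for j
      using that
    proof (induction j)
      case (Suc j)
      then have "t (Suc k - Suc j) < t (Suc (Suc k - Suc j))" by (intro d) auto
      also have "Suc (Suc k - Suc j) = Suc k - j" using Suc by auto
      finally show ?case using Suc by simp
    qed simp
    from this[of "Suc k - i"] have "t i \<le> t (Suc k)" using that by auto
    ultimately show ?thesis using that t0 t1 by auto
  qed
  have Bm: "B (t i) \<in> borel_measurable M" if "i \<in> {1..k}" for i
    using B tI[OF that] unfolding std_brownian_bridge_def by blast
  let ?f = "\<lambda>x. ennreal (bm_density (Suc k) t (x(0 := 0, Suc k := 0)) / std_normal_density 0)"
  let ?X = "\<lambda>w. \<lambda>i\<in>{1..k}. B (t i) w"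
  have D: "distributed M ?P ?X ?f"
    using B t0 d t1 unfolding std_brownian_bridge_def by blast
  let ?G = "\<lambda>x. (\<Prod>i\<in>{1..k}. indicator {..c i} (x i :: real)) :: ennreal"
  have Gm: "?G \<in> borel_measurable ?P"
    by (intro borel_measurable_prod_ennreal measurable_compose[OF measurable_component_singleton borel_measurable_indicator]) auto
  have "emeasure M {w \<in> space M. \<forall>i\<in>{1..k}. B (t i) w \<le> c i}
     = (\<integral>\<^sup>+ w. indicator {w \<in> space M. \<forall>i\<in>{1..k}. B (t i) w \<le> c i} w \<partial>M)"
    using Bm by (subst nn_integral_indicator) (auto intro!: sets.sets_Collect_finite_All)
  also have "\<dots> = (\<integral>\<^sup>+ w. ?G (?X w) \<partial>M)"
    by (intro nn_integral_cong) (auto simp: indicator_def intro!: prod.neutral)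
  also have "\<dots> = (\<integral>\<^sup>+ x. ?f x * ?G x \<partial>?P)"
    by (rule distributed_nn_integral[OF D Gm, symmetric])
  also have "\<dots> = (\<integral>\<^sup>+ x. ennreal (bm_density k t (x(0 := 0))) * ?G x
      * (ennreal (sqrt (2 * pi)) * ennreal (gauss (t (Suc k) - t k) ((x(0 := 0)) k - 0))) \<partial>?P)"
  proof (rule nn_integral_cong)
    fix x :: "nat \<Rightarrow> real"
    have "bm_density (Suc k) t (x(0 := 0, Suc k := 0)) = bm_density k t (x(0 := 0)) * gauss (t (Suc k) - t k) ((x(0 := 0)) k - 0)"
      unfolding bm_density_def normal_density_eq_gauss
      by (auto simp: lessThan_Suc mult.commute intro!: prod.cong)
    moreover have "std_normal_density 0 = 1 / sqrt (2 * pi)" by (simp add: normal_density_def)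
    moreover have "0 \<le> bm_density k t (x(0 := 0))" unfolding bm_density_def by (intro prod_nonneg) auto
    ultimately have "?f x = ennreal (bm_density k t (x(0 := 0))) * (ennreal (sqrt (2 * pi)) * ennreal (gauss (t (Suc k) - t k) ((x(0 := 0)) k - 0)))"
      by (simp add: ennreal_mult[symmetric] ac_simps)
    then show "?f x * ?G x = ennreal (bm_density k t (x(0 := 0))) * ?G x
      * (ennreal (sqrt (2 * pi)) * ennreal (gauss (t (Suc k) - t k) ((x(0 := 0)) k - 0)))"
      by (simp only: ac_simps)
  qed
  also have "\<dots> = grid_iter t c k (\<lambda>x. ennreal (sqrt (2 * pi)) * ennreal (gauss (t (Suc k) - t k) (x - 0)))"
    by (subst bridge_grid_integral) simp_all
  also have "\<dots> = ennreal (sqrt (2 * pi)) * grid_iter t c k (\<lambda>x. ennreal (gauss (t (Suc k) - t k) (x - 0)))"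
    by (subst grid_iter_cmult) simp_all
  finally show ?thesis .
qed

section \<open>Maxima before and after a fixed time\<close>

definition two_grid :: "real \<Rightarrow> nat \<Rightarrow> nat \<Rightarrow> real" where
  "two_grid t N i = (if i \<le> N then t * (real i / real N) else t + (1 - t) * (real (i - N) / real N))"

text \<open>Time \<open>t\<close>, at index \<open>N\<close>, belongs to both intervals, so both
  levels apply there.\<close>

definition two_level :: "nat \<Rightarrow> real \<Rightarrow> real \<Rightarrow> nat \<Rightarrow> real" where
  "two_level N a b i = (if i < N then a else if i = N then min a b else b)"

lemma two_grid_diff:
  assumes "N > 0"
  shows "two_grid t N (Suc i) - two_grid t N i = (if i < N then t / N else (1 - t) / N)"
proof -
  consider "i < N" | "i = N" | "i > N" by linarith
  then show ?thesis
    using assms by cases (auto simp: two_grid_def field_simps of_nat_diff)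
qed

lemma two_grid_less:
  assumes "N > 0" "0 < t" "t < 1"
  shows "two_grid t N i < two_grid t N (Suc i)"
proof -
  have "two_grid t N (Suc i) - two_grid t N i > 0"
    using assms by (simp add: two_grid_diff)
  then show ?thesis by simp
qed

lemma two_grid_0: "two_grid t N 0 = 0"
  by (simp add: two_grid_def)

lemma two_grid_end: "N > 0 \<Longrightarrow> two_grid t N (N + N) = 1"
  by (simp add: two_grid_def)

text \<open>The Markov property at time \<open>t\<close>: the first half contributes a kernel from 0
  to the position \<open>y\<close>, the second half a function of \<open>y\<close>, and
  \<open>y\<close> obeys both levels.\<close>

lemma grid_iter_two_grid:
  fixes n :: nat
  assumes [measurable]: "f \<in> borel_measurable borel"
  defines "N \<equiv> Suc n"
  shows "grid_iter (two_grid t N) (two_level N a b) (N + j) f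
    = (\<integral>\<^sup>+ y. killed_kernel (t / N) a n 0 y * indicator {..a} y *
        (indicator {..b} y * (killed_step ((1 - t) / N) b ^^ j) f y) \<partial>lborel)"
proof -
  define F where "F = (killed_step ((1 - t) / N) b ^^ j) f"
  have [measurable]: "F \<in> borel_measurable borel" unfolding F_def by measurable
  have "grid_iter (two_grid t N) (two_level N a b) (N + j) f = grid_iter (two_grid t N) (two_level N a b) N F"
    unfolding F_def by (rule grid_iter_add) (auto simp: two_grid_diff two_level_def N_def)
  \<comment> \<open>The step onto time \<open>t\<close> is split off, since its level is
    \<open>min a b\<close> and not \<open>a\<close>.\<close>
  also have "\<dots> = grid_iter (two_grid t N) (two_level N a b) (0 + n) (killed_step (t / N) (min a b) F)"
    unfolding N_def grid_iter.simps by (simp add: two_grid_diff two_level_def)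
  also have "\<dots> = (killed_step (t / N) a ^^ n) (killed_step (t / N) (min a b) F) 0"
    by (subst grid_iter_add[where d = "t / N" and a = a]) (auto simp: two_grid_diff two_level_def N_def)
  \<comment> \<open>Level \<open>b\<close> is handed over to the integrand, after which all steps up
    to time \<open>t\<close> are alike.\<close>
  also have "killed_step (t / N) (min a b) F = killed_step (t / N) a (\<lambda>y. indicator {..b} y * F y)"
    unfolding killed_step_def by (intro ext nn_integral_cong) (auto split: split_indicator)
  also have "(killed_step (t / N) a ^^ n) (killed_step (t / N) a (\<lambda>y. indicator {..b} y * F y)) 0
     = (killed_step (t / N) a ^^ Suc n) (\<lambda>y. indicator {..b} y * F y) 0"
    by (simp add: funpow_swap1)
  also have "\<dots> = (\<integral>\<^sup>+ y. killed_kernel (t / N) a n 0 y * indicator {..a} y * (indicator {..b} y * F y) \<partial>lborel)"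
    by (rule killed_step_funpow) measurable
  finally show ?thesis unfolding F_def .
qed

text \<open>Limiting probability that a motion at \<open>y\<close> at time \<open>t\<close> stays at
  or below \<open>b\<close> until time 1; \<open>z\<close> is its free endpoint.\<close>

definition motion_tail :: "real \<Rightarrow> real \<Rightarrow> real \<Rightarrow> ennreal" where
  "motion_tail t b y = (\<integral>\<^sup>+ z. ennreal (refl_kernel b (1 - t) y z) * indicator {..b} z \<partial>lborel)"

text \<open>Here the endpoint is pinned at 0, and \<open>sqrt (2 * pi)\<close> divides by the
  standard normal density at 0.\<close>

definition bridge_tail :: "real \<Rightarrow> real \<Rightarrow> real \<Rightarrow> ennreal" where
  "bridge_tail t b y = ennreal (sqrt (2 * pi) * refl_kernel b (1 - t) y 0)"

text \<open>The joint distribution function of the maxima before and after \<open>t\<close>,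
  decomposed by the position \<open>y\<close> at time \<open>t\<close>.\<close>

definition sup_cdf :: "(real \<Rightarrow> real \<Rightarrow> real \<Rightarrow> ennreal) \<Rightarrow> real \<Rightarrow> real \<Rightarrow> real \<Rightarrow> ennreal" where
  "sup_cdf tail t a b =
     (\<integral>\<^sup>+ y. ennreal (refl_kernel a t 0 y) * indicator {..a} y * (indicator {..b} y * tail t b y) \<partial>lborel)"

lemma motion_tail_measurable [measurable]: "motion_tail t b \<in> borel_measurable borel"
  unfolding motion_tail_def[abs_def] refl_kernel_def by measurable

lemma bridge_tail_measurable [measurable]: "bridge_tail t b \<in> borel_measurable borel"
  unfolding bridge_tail_def[abs_def] by measurable

lemma killed_kernel_le_gauss':
  assumes "s > 0"
  shows "killed_kernel (s / real (Suc n)) a n x y \<le> ennreal (gauss s (x - y))"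
  using killed_kernel_le_gauss[of "s / real (Suc n)" a n x y] assms by (simp del: of_nat_Suc)

lemma killed_kernel_integral_tendsto:
  assumes t: "0 < t" and a: "0 \<le> a"
    and u [measurable]: "\<And>n. u n \<in> borel_measurable borel" "v \<in> borel_measurable borel"
    and lim: "\<And>y. y \<le> b \<Longrightarrow> (\<lambda>n. u n y) \<longlonglongrightarrow> v y" and bound: "\<And>n y. u n y \<le> ennreal c"
  shows "(\<lambda>n. \<integral>\<^sup>+ y. killed_kernel (t / real (Suc n)) a n 0 y * indicator {..a} y * (indicator {..b} y * u n y) \<partial>lborel)
    \<longlonglongrightarrow> (\<integral>\<^sup>+ y. ennreal (refl_kernel a t 0 y) * indicator {..a} y * (indicator {..b} y * v y) \<partial>lborel)"
proof (rule nn_integral_dominated_convergence)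
  let ?w = "\<lambda>y. ennreal (gauss t (0 - y)) * ennreal c"
  let ?k = "\<lambda>n. killed_kernel (t / real (Suc n)) a n 0"
  show "AE y in lborel. ?k n y * indicator {..a} y * (indicator {..b} y * u n y) \<le> ?w y" for n
  proof (rule AE_I2)
    fix y
    have "?k n y * indicator {..a} y * (indicator {..b} y * u n y) \<le> ennreal (gauss t (0 - y)) * 1 * (1 * ennreal c)"
      using t bound by (intro mult_mono killed_kernel_le_gauss') (auto split: split_indicator)
    then show "?k n y * indicator {..a} y * (indicator {..b} y * u n y) \<le> ?w y" by simp
  qed
  show "(\<integral>\<^sup>+ y. ?w y \<partial>lborel) < \<infinity>"
    using t by (simp add: nn_integral_multc nn_integral_gauss del: diff_0)
  show "AE y in lborel. (\<lambda>n. ?k n y * indicator {..a} y * (indicator {..b} y * u n y))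
     \<longlonglongrightarrow> ennreal (refl_kernel a t 0 y) * indicator {..a} y * (indicator {..b} y * v y)"
  proof (rule AE_I2)
    fix y
    show "(\<lambda>n. ?k n y * indicator {..a} y * (indicator {..b} y * u n y))
      \<longlonglongrightarrow> ennreal (refl_kernel a t 0 y) * indicator {..a} y * (indicator {..b} y * v y)"
    proof (cases "y \<le> a \<and> y \<le> b")
      case True
      \<comment> \<open>Finiteness of the limit matters: multiplication of extended nonnegative
        reals is discontinuous at 0 times infinity.\<close>
      have "v y \<le> ennreal c"
        using lim[of y] True bound by (intro LIMSEQ_le_const2) auto
      then have "v y \<noteq> \<top>" by (auto simp: top_unique)
      moreover have "(\<lambda>n. ?k n y) \<longlonglongrightarrow> ennreal (refl_kernel a t 0 y)"
        using t a True by (intro killed_kernel_tendsto) auto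
      ultimately show ?thesis
        using True lim[of y] tendsto_mult_ennreal[of _ "ennreal (refl_kernel a t 0 y)" sequentially _ "v y"] by auto
    qed auto
  qed
qed measurable

lemma motion_grid_tendsto:
  assumes t: "0 < t" "t < 1" and a: "0 \<le> a"
  shows "(\<lambda>n. grid_iter (two_grid t (Suc n)) (two_level (Suc n) a b) (Suc n + Suc n) (\<lambda>_. 1))
     \<longlonglongrightarrow> sup_cdf motion_tail t a b"
  unfolding sup_cdf_def
proof (subst grid_iter_two_grid, simp, rule killed_kernel_integral_tendsto[where c = 1])
  let ?u = "\<lambda>n. (killed_step ((1 - t) / real (Suc n)) b ^^ Suc n) (\<lambda>_. 1)"
  let ?k = "\<lambda>n. killed_kernel ((1 - t) / real (Suc n)) b n"
  have u: "?u n y = (\<integral>\<^sup>+ z. ?k n y z * indicator {..b} z \<partial>lborel)" for n y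
    by (subst killed_step_funpow) simp_all
  have k: "?k n y z * indicator {..b} z \<le> ennreal (gauss (1 - t) (y - z))" for n y z
    using t by (auto split: split_indicator intro!: killed_kernel_le_gauss' simp del: of_nat_Suc)
  have int: "(\<integral>\<^sup>+ z. ennreal (gauss (1 - t) (y - z)) \<partial>lborel) = 1" for y
    using t by (simp add: nn_integral_gauss)
  show "?u n y \<le> ennreal 1" for n y
  proof -
    have "?u n y \<le> (\<integral>\<^sup>+ z. ennreal (gauss (1 - t) (y - z)) \<partial>lborel)"
      unfolding u by (intro nn_integral_mono k)
    then show ?thesis by (simp only: int ennreal_1)
  qed
  show "(\<lambda>n. ?u n y) \<longlonglongrightarrow> motion_tail t b y" if "y \<le> b" for y
    unfolding u motion_tail_def
  proof (rule nn_integral_dominated_convergence[where w = "\<lambda>z. ennreal (gauss (1 - t) (y - z))"])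
    show "AE z in lborel. (\<lambda>n. ?k n y z * indicator {..b} z) \<longlonglongrightarrow> ennreal (refl_kernel b (1 - t) y z) * indicator {..b} z"
      using t that by (intro AE_I2) (auto split: split_indicator intro!: killed_kernel_tendsto simp del: of_nat_Suc)
  qed (use k in \<open>auto simp: int simp del: of_nat_Suc\<close>)
qed (use t a in auto)

text \<open>One constrained point fewer than for the motion: the step that reaches 0 at time 1 is
  the terminal Gaussian, so the second half is itself a \<open>killed_kernel\<close> with endpoint
  0. The condition on \<open>b\<close> puts this endpoint below the barrier.\<close>

lemma bridge_grid_tendsto:
  assumes t: "0 < t" "t < 1" and a: "0 \<le> a" and b: "0 \<le> b"
  shows "(\<lambda>n. ennreal (sqrt (2 * pi)) *
      grid_iter (two_grid t (Suc n)) (two_level (Suc n) a b) (Suc n + n) (\<lambda>x. ennreal (gauss ((1 - t) / real (Suc n)) (x - 0))))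
     \<longlonglongrightarrow> sup_cdf bridge_tail t a b"
proof -
  let ?I = "\<integral>\<^sup>+ y. ennreal (refl_kernel a t 0 y) * indicator {..a} y * (indicator {..b} y * ennreal (refl_kernel b (1 - t) y 0)) \<partial>lborel"
  have "(\<lambda>n. grid_iter (two_grid t (Suc n)) (two_level (Suc n) a b) (Suc n + n) (\<lambda>x. ennreal (gauss ((1 - t) / real (Suc n)) (x - 0))))
    \<longlonglongrightarrow> ?I"
  proof (subst grid_iter_two_grid, simp, fold killed_kernel_def, rule killed_kernel_integral_tendsto)
    show "killed_kernel ((1 - t) / real (Suc n)) b n y 0 \<le> ennreal (1 / sqrt (2 * pi * (1 - t)))" for n y
      using t by (intro order_trans[OF killed_kernel_le_gauss'] ennreal_leI gauss_le) auto
    show "(\<lambda>n. killed_kernel ((1 - t) / real (Suc n)) b n y 0) \<longlonglongrightarrow> ennreal (refl_kernel b (1 - t) y 0)" if "y \<le> b" for y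
      using t b that by (intro killed_kernel_tendsto) auto
  qed (use t a in auto)
  then have "(\<lambda>n. ennreal (sqrt (2 * pi)) *
      grid_iter (two_grid t (Suc n)) (two_level (Suc n) a b) (Suc n + n) (\<lambda>x. ennreal (gauss ((1 - t) / real (Suc n)) (x - 0))))
    \<longlonglongrightarrow> ennreal (sqrt (2 * pi)) * ?I"
    by (intro ennreal_tendsto_cmult) auto
  also have "ennreal (sqrt (2 * pi)) * ?I = sup_cdf bridge_tail t a b"
    unfolding sup_cdf_def bridge_tail_def
    by (subst nn_integral_cmult[symmetric]) (auto simp: ennreal_mult' ac_simps)
  finally show ?thesis .
qed

section \<open>Dyadic grids and the limit from grids to paths\<close>

definition dyadics_before :: "real \<Rightarrow> real set" where
  "dyadics_before t = (\<Union>j. \<Union>i\<in>{..2 ^ j}. {t * (real i / real (2 ^ j :: nat))})"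

definition dyadics_after :: "real \<Rightarrow> real set" where
  "dyadics_after t = (\<Union>j. \<Union>i\<in>{..2 ^ j}. {t + (1 - t) * (real i / real (2 ^ j :: nat))})"

lemma dense_dyadic:
  fixes u :: real
  assumes "0 \<le> u" "u \<le> 1" "e > 0"
  shows "\<exists>j i. i \<le> 2 ^ j \<and> \<bar>real i / real (2 ^ j :: nat) - u\<bar> < e"
proof -
  obtain j where j: "(1 / 2) ^ j < e"
    using real_arch_pow_inv[OF \<open>e > 0\<close>, of "1 / 2"] by auto
  define i where "i = nat \<lfloor>u * 2 ^ j\<rfloor>"
  have r: "real i = of_int \<lfloor>u * 2 ^ j\<rfloor>" using assms by (simp add: i_def)
  have up: "real i \<le> u * 2 ^ j" unfolding r by linarith
  have lo: "u * 2 ^ j < real i + 1" unfolding r by linarith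
  have "u * 2 ^ j \<le> 1 * 2 ^ j" using assms by (intro mult_right_mono) auto
  then have "real i \<le> 2 ^ j" using up by linarith
  then have "real i \<le> real (2 ^ j)" by (simp only: of_nat_power of_nat_numeral)
  then have "i \<le> 2 ^ j" by (simp only: of_nat_le_iff)
  moreover have "\<bar>real i / real (2 ^ j :: nat) - u\<bar> \<le> (1 / 2) ^ j"
  proof -
    have pos: "(0::real) < 2 ^ j" by simp
    have "real i / 2 ^ j \<le> u" using up pos by (simp only: pos_divide_le_eq)
    moreover have "u < real i / 2 ^ j + 1 / 2 ^ j"
      unfolding add_divide_distrib[symmetric] using lo pos by (simp only: pos_less_divide_eq)
    moreover have "(1 / 2) ^ j = 1 / (2 :: real) ^ j" by (simp add: power_one_over)
    ultimately have "\<bar>real i / 2 ^ j - u\<bar> \<le> (1 / 2) ^ j" unfolding abs_le_iff by linarith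
    then show ?thesis by simp
  qed
  ultimately show ?thesis using j by (intro exI[of _ j] exI[of _ i]) auto
qed

lemma closure_dyadics:
  fixes c d :: real
  assumes d: "0 < d"
  shows "closure (\<Union>j. \<Union>i\<in>{..2 ^ j}. {c + d * (real i / real (2 ^ j :: nat))}) = {c..c + d}" (is "closure ?D = _")
proof (rule antisym)
  have "?D \<subseteq> {c..c + d}"
  proof
    fix s assume "s \<in> ?D"
    then obtain i j where s: "s = c + d * (real i / real (2 ^ j :: nat))" "i \<le> 2 ^ j" by auto
    have "d * (real i / real (2 ^ j :: nat)) \<le> d * 1"
      using d s(2) by (intro mult_left_mono) (auto simp: divide_simps)
    then show "s \<in> {c..c + d}" using d s(1) by simp
  qed
  then show "closure ?D \<subseteq> {c..c + d}" by (intro closure_minimal) auto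
  show "{c..c + d} \<subseteq> closure ?D"
  proof
    fix s assume s: "s \<in> {c..c + d}"
    show "s \<in> closure ?D"
      unfolding closure_approachable
    proof (intro allI impI)
      fix e :: real assume e: "0 < e"
      obtain i j where ij: "i \<le> 2 ^ j" "\<bar>real i / real (2 ^ j :: nat) - (s - c) / d\<bar> < e / d"
        using dense_dyadic[of "(s - c) / d" "e / d"] s d e by (auto simp: field_simps)
      have sc: "d * ((s - c) / d) = s - c" using d by simp
      have "c + d * (real i / real (2 ^ j :: nat)) - s = d * (real i / real (2 ^ j :: nat) - (s - c) / d)"
        unfolding right_diff_distrib[of d _ "(s - c) / d"] sc by simp
      then have "dist (c + d * (real i / real (2 ^ j :: nat))) s = d * \<bar>real i / real (2 ^ j :: nat) - (s - c) / d\<bar>"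
        using d by (simp only: dist_real_def abs_mult)
      also have "\<dots> < d * (e / d)" using ij(2) d by (intro mult_strict_left_mono) auto
      finally have "dist (c + d * (real i / real (2 ^ j :: nat))) s < e" using d by simp
      then show "\<exists>y\<in>?D. dist y s < e" using ij(1) by blast
    qed
  qed
qed

lemma dyadics_before_closure: "0 < t \<Longrightarrow> closure (dyadics_before t) = {0..t}"
  using closure_dyadics[of t 0] by (simp only: dyadics_before_def add_0)

lemma dyadics_after_closure: "t < 1 \<Longrightarrow> closure (dyadics_after t) = {t..1}"
  using closure_dyadics[of "1 - t" t] by (simp only: dyadics_after_def diff_gt_0_iff_gt add_diff_cancel_left' add_diff_eq)

lemma dyadics_before_subset: "0 < t \<Longrightarrow> dyadics_before t \<subseteq> {0..t}"
  using closure_subset[of "dyadics_before t"] by (simp only: dyadics_before_closure)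

lemma dyadics_after_subset: "t < 1 \<Longrightarrow> dyadics_after t \<subseteq> {t..1}"
  using closure_subset[of "dyadics_after t"] by (simp only: dyadics_after_closure)

abbreviation dyadics_le :: "real \<Rightarrow> (real \<Rightarrow> real) \<Rightarrow> real \<Rightarrow> real \<Rightarrow> bool" where
  "dyadics_le t x a b \<equiv> (\<forall>s\<in>dyadics_before t. x s \<le> a) \<and> (\<forall>s\<in>dyadics_after t. x s \<le> b)"

lemma countable_dyadics: "countable (dyadics_before t)" "countable (dyadics_after t)"
  unfolding dyadics_before_def dyadics_after_def by (intro countable_UN; simp)+

text \<open>\<open>j\<close> is the number of constrained grid points after time \<open>t\<close>:
  \<open>N\<close> for the motion and \<open>N - 1\<close> for the bridge. On the right, index 0 of
  the second condition repeats time \<open>t\<close>, in accordance with the minimum in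
  \<open>two_level\<close>.\<close>

lemma two_grid_event:
  assumes "N > 0"
  shows "(\<forall>i\<in>{1..N + j}. x (two_grid t N i) \<le> two_level N a b i)
     \<longleftrightarrow> (\<forall>i\<in>{1..N}. x (t * (real i / real N)) \<le> a) \<and> (\<forall>i\<le>j. x (t + (1 - t) * (real i / real N)) \<le> (b::real))"
    (is "?L \<longleftrightarrow> ?R1 \<and> ?R2")
proof
  assume L: ?L
  have ?R1
  proof
    fix i assume "i \<in> {1..N}"
    then show "x (t * (real i / real N)) \<le> a"
      using L[rule_format, of i] by (auto simp: two_grid_def two_level_def split: if_splits)
  qed
  moreover have ?R2
  proof (intro allI impI)
    fix i assume "i \<le> j"
    then show "x (t + (1 - t) * (real i / real N)) \<le> b"
      using L[rule_format, of "N + i"] assms by (auto simp: two_grid_def two_level_def split: if_splits)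
  qed
  ultimately show "?R1 \<and> ?R2" ..
next
  assume R: "?R1 \<and> ?R2"
  show ?L
  proof
    fix i assume i: "i \<in> {1..N + j}"
    consider "i < N" | "i = N" | "i > N" by linarith
    then show "x (two_grid t N i) \<le> two_level N a b i"
    proof cases
      case 1 then show ?thesis using R i by (auto simp: two_grid_def two_level_def)
    next
      case 2 then show ?thesis using R i assms R[THEN conjunct2, rule_format, of 0] R[THEN conjunct1, rule_format, of N]
        by (auto simp: two_grid_def two_level_def)
    next
      case 3 then show ?thesis using R i assms R[THEN conjunct2, rule_format, of "i - N"]
        by (auto simp: two_grid_def two_level_def)
    qed
  qed
qed

text \<open>Halving the mesh keeps the old grid points, as index \<open>i\<close> becomes
  \<open>2 * i\<close>. The events therefore decrease, and continuity from above applies.\<close>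

lemma emeasure_dyadic_limit:
  assumes M: "prob_space M" and X: "\<And>s. s \<in> {0..1} \<Longrightarrow> X s \<in> borel_measurable M"
    and t: "0 < t" "t < 1"
  shows "(\<lambda>j. emeasure M {w \<in> space M. (\<forall>i\<le>2 ^ j. X (t * (real i / real (2 ^ j :: nat))) w \<le> a) \<and>
       (\<forall>i\<le>2 ^ j. X (t + (1 - t) * (real i / real (2 ^ j :: nat))) w \<le> b)})
    \<longlonglongrightarrow> emeasure M {w \<in> space M. dyadics_le t (\<lambda>s. X s w) a b}"
proof -
  interpret prob_space M by fact
  define E where "E j = {w \<in> space M. (\<forall>i\<le>2 ^ j. X (t * (real i / real (2 ^ j :: nat))) w \<le> a) \<and>
       (\<forall>i\<le>2 ^ j. X (t + (1 - t) * (real i / real (2 ^ j :: nat))) w \<le> b)}" for j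
  have sub1: "t * (real i / real (2 ^ j :: nat)) \<in> {0..1}" if "i \<le> 2 ^ j" for i j
  proof -
    have "t * (real i / real (2 ^ j :: nat)) \<in> dyadics_before t"
      unfolding dyadics_before_def using that by blast
    then have "t * (real i / real (2 ^ j :: nat)) \<in> {0..t}" using dyadics_before_subset[OF t(1)] by blast
    moreover have "{0..t} \<subseteq> {0..1}" using t by auto
    ultimately show ?thesis by blast
  qed
  have sub2: "t + (1 - t) * (real i / real (2 ^ j :: nat)) \<in> {0..1}" if "i \<le> 2 ^ j" for i j
  proof -
    have "t + (1 - t) * (real i / real (2 ^ j :: nat)) \<in> dyadics_after t"
      unfolding dyadics_after_def using that by blast
    then have "t + (1 - t) * (real i / real (2 ^ j :: nat)) \<in> {t..1}" using dyadics_after_subset[OF t(2)] by blast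
    moreover have "{t..1} \<subseteq> {0..1}" using t by auto
    ultimately show ?thesis by blast
  qed
  have "E j \<in> sets M" for j
  proof -
    have "E j = {w \<in> space M. \<forall>i\<in>{..2 ^ j}. X (t * (real i / real (2 ^ j :: nat))) w \<le> a} \<inter>
       {w \<in> space M. \<forall>i\<in>{..2 ^ j}. X (t + (1 - t) * (real i / real (2 ^ j :: nat))) w \<le> b}"
      unfolding E_def by auto
    also have "\<dots> \<in> sets M"
      using X[OF sub1] X[OF sub2] by (intro sets.Int sets.sets_Collect_finite_All) auto
    finally show ?thesis .
  qed
  moreover have "decseq E"
  proof (rule decseq_SucI)
    fix j show "E (Suc j) \<le> E j"
      unfolding E_def
    proof safe
      fix w and i :: nat assume *: "\<forall>i\<le>2 ^ Suc j. X (t * (real i / real (2 ^ Suc j :: nat))) w \<le> a" "i \<le> 2 ^ j"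
      from *(1)[rule_format, of "2 * i"] *(2) show "X (t * (real i / real (2 ^ j :: nat))) w \<le> a" by simp
    next
      fix w and i :: nat assume *: "\<forall>i\<le>2 ^ Suc j. X (t + (1 - t) * (real i / real (2 ^ Suc j :: nat))) w \<le> b" "i \<le> 2 ^ j"
      from *(1)[rule_format, of "2 * i"] *(2) show "X (t + (1 - t) * (real i / real (2 ^ j :: nat))) w \<le> b" by simp
    qed
  qed
  ultimately have "(\<lambda>j. emeasure M (E j)) \<longlonglongrightarrow> emeasure M (\<Inter>j. E j)"
    by (intro Lim_emeasure_decseq) auto
  also have "(\<Inter>j. E j) = {w \<in> space M. dyadics_le t (\<lambda>s. X s w) a b}"
    unfolding E_def dyadics_before_def dyadics_after_def by auto
  finally show ?thesis unfolding E_def .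
qed

text \<open>The kernel limits run over grids with \<open>Suc n\<close> steps;
  \<open>n = 2 ^ j - 1\<close> selects the dyadic ones.\<close>

lemma filterlim_two_power_minus_1: "filterlim (\<lambda>j. 2 ^ j - 1 :: nat) at_top sequentially"
  by (rule filterlim_subseq) (auto intro!: strict_monoI_Suc diff_less_mono simp del: One_nat_def)

text \<open>The two events differ at time 0, where the path is almost surely 0 and hence at most
  \<open>a\<close>, and at the grid times beyond index \<open>j\<close>, for which
  \<open>tail_le\<close> answers.\<close>

lemma emeasure_two_grid:
  assumes M: "prob_space M" and X: "\<And>s. s \<in> {0..1} \<Longrightarrow> X s \<in> borel_measurable M"
    and X0: "AE w in M. X 0 w = 0"
    and t: "0 < t" "t < 1" and a: "0 \<le> a" and N: "N > 0" "j \<le> N"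
    and tail_le: "\<And>i. AE w in M. j < i \<longrightarrow> i \<le> N \<longrightarrow> X (t + (1 - t) * (real i / real N)) w \<le> b"
  shows "emeasure M {w \<in> space M. (\<forall>i\<le>N. X (t * (real i / real N)) w \<le> a) \<and>
       (\<forall>i\<le>N. X (t + (1 - t) * (real i / real N)) w \<le> b)}
     = emeasure M {w \<in> space M. \<forall>i\<in>{1..N + j}. X (two_grid t N i) w \<le> two_level N a b i}"
    (is "emeasure M ?E = emeasure M ?F")
proof (rule emeasure_eq_AE)
  interpret prob_space M by fact
  have "AE w in M. \<forall>i\<in>{j<..N}. X (t + (1 - t) * (real i / real N)) w \<le> b"
    using tail_le by (subst AE_finite_all) (auto elim!: eventually_mono)
  then show "AE w in M. w \<in> ?E \<longleftrightarrow> w \<in> ?F"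
    using X0
  proof eventually_elim
    case (elim w)
    have "(\<forall>i\<le>N. X (t * (real i / real N)) w \<le> a) \<longleftrightarrow> (\<forall>i\<in>{1..N}. X (t * (real i / real N)) w \<le> a)"
    proof safe
      fix i assume "\<forall>i\<in>{1..N}. X (t * (real i / real N)) w \<le> a" "i \<le> N"
      then show "X (t * (real i / real N)) w \<le> a"
        using elim a by (cases "i = 0") auto
    qed auto
    moreover have "(\<forall>i\<le>N. X (t + (1 - t) * (real i / real N)) w \<le> b) \<longleftrightarrow> (\<forall>i\<le>j. X (t + (1 - t) * (real i / real N)) w \<le> b)"
      using elim N by (metis greaterThanAtMost_iff not_le_imp_less order.trans)
    ultimately show ?case
      using two_grid_event[of N j "\<lambda>s. X s w" t a b] N by auto
  qed
  have I: "two_grid t N i \<in> {0..1}" if "i \<le> N + N" for i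
  proof -
    have "two_grid t N i \<le> two_grid t N (Suc i)" for i
      using two_grid_less[of N t i] t N by simp
    then have "two_grid t N 0 \<le> two_grid t N i" "two_grid t N i \<le> two_grid t N (N + N)"
      using that lift_Suc_mono_le[of "two_grid t N"] by blast+
    then show ?thesis using N by (simp add: two_grid_0 two_grid_end)
  qed
  show "?F \<in> sets M"
    using X[OF I] N by (intro sets.sets_Collect_finite_All) auto
  have 0: "t * (real i / real N) \<in> {0..1}" if "i \<le> N" for i
    using that I[of i] by (auto simp: two_grid_def)
  have 1: "t + (1 - t) * (real i / real N) \<in> {0..1}" if "i \<le> N" for i
    using that I[of "N + i"] t by (cases "i = 0") (auto simp: two_grid_def)
  have "?E = {w \<in> space M. (\<forall>i\<in>{..N}. X (t * (real i / real N)) w \<le> a)} \<inter>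
    {w \<in> space M. (\<forall>i\<in>{..N}. X (t + (1 - t) * (real i / real N)) w \<le> b)}" by auto
  also have "\<dots> \<in> sets M"
    using X[OF 0] X[OF 1] by (intro sets.Int sets.sets_Collect_finite_All) auto
  finally show "?E \<in> sets M" .
qed

text \<open>Both sides are limits of the same dyadic grid probabilities, once by continuity of the
  measure and once by convergence of the killed kernels.\<close>

lemma brownian_motion_sup_law:
  assumes M: "prob_space M" and W: "std_brownian_motion_on {0..1} M W"
    and t: "0 < t" "t < 1" and a: "0 \<le> a"
  shows "emeasure M {w \<in> space M. dyadics_le t (\<lambda>s. W s w) a b}
     = sup_cdf motion_tail t a b"
proof (rule LIMSEQ_unique)
  have Wm: "W s \<in> borel_measurable M" if "s \<in> {0..1}" for s
    using W that unfolding std_brownian_motion_on_def by blast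
  have W0: "AE w in M. W 0 w = 0"
    using W unfolding std_brownian_motion_on_def by blast
  let ?E = "\<lambda>j. {w \<in> space M. (\<forall>i\<le>2 ^ j. W (t * (real i / real (2 ^ j :: nat))) w \<le> a) \<and>
       (\<forall>i\<le>2 ^ j. W (t + (1 - t) * (real i / real (2 ^ j :: nat))) w \<le> b)}"
  show "(\<lambda>j. emeasure M (?E j)) \<longlonglongrightarrow> emeasure M {w \<in> space M. dyadics_le t (\<lambda>s. W s w) a b}"
    by (rule emeasure_dyadic_limit[where X = W, OF M Wm t])
  have "emeasure M (?E j) = grid_iter (two_grid t (2 ^ j)) (two_level (2 ^ j) a b) (2 ^ j + 2 ^ j) (\<lambda>_. 1)" for j
  proof -
    let ?N = "2 ^ j :: nat"
    have "emeasure M (?E j) = emeasure M {w \<in> space M. \<forall>i\<in>{1..?N + ?N}. W (two_grid t ?N i) w \<le> two_level ?N a b i}"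
      by (rule emeasure_two_grid[where X = W, OF M Wm W0 t a]) auto
    also have "\<dots> = grid_iter (two_grid t ?N) (two_level ?N a b) (?N + ?N) (\<lambda>_. 1)"
      using two_grid_end[of ?N t] t
      by (intro brownian_motion_grid_prob[OF M W] two_grid_0 two_grid_less) auto
    finally show ?thesis .
  qed
  moreover have "(\<lambda>j. grid_iter (two_grid t (2 ^ j)) (two_level (2 ^ j) a b) (2 ^ j + 2 ^ j) (\<lambda>_. 1)) \<longlonglongrightarrow> sup_cdf motion_tail t a b"
    using filterlim_compose[OF motion_grid_tendsto[OF t a] filterlim_two_power_minus_1] by simp
  ultimately show "(\<lambda>j. emeasure M (?E j)) \<longlonglongrightarrow> sup_cdf motion_tail t a b" by simp
qed

lemma brownian_bridge_sup_law:
  assumes M: "prob_space M" and B: "std_brownian_bridge M B"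
    and t: "0 < t" "t < 1" and a: "0 \<le> a" and b: "0 \<le> b"
  shows "emeasure M {w \<in> space M. dyadics_le t (\<lambda>s. B s w) a b}
     = sup_cdf bridge_tail t a b"
proof (rule LIMSEQ_unique)
  have Bm: "B s \<in> borel_measurable M" if "s \<in> {0..1}" for s
    using B that unfolding std_brownian_bridge_def by blast
  have B0: "AE w in M. B 0 w = 0" and B1: "AE w in M. B 1 w = 0"
    using B unfolding std_brownian_bridge_def by blast+
  let ?E = "\<lambda>j. {w \<in> space M. (\<forall>i\<le>2 ^ j. B (t * (real i / real (2 ^ j :: nat))) w \<le> a) \<and>
       (\<forall>i\<le>2 ^ j. B (t + (1 - t) * (real i / real (2 ^ j :: nat))) w \<le> b)}"
  show "(\<lambda>j. emeasure M (?E j)) \<longlonglongrightarrow> emeasure M {w \<in> space M. dyadics_le t (\<lambda>s. B s w) a b}"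
    by (rule emeasure_dyadic_limit[where X = B, OF M Bm t])
  have "emeasure M (?E j) = ennreal (sqrt (2 * pi)) * grid_iter (two_grid t (2 ^ j)) (two_level (2 ^ j) a b) (2 ^ j + (2 ^ j - 1))
      (\<lambda>x. ennreal (gauss ((1 - t) / real (2 ^ j :: nat)) (x - 0)))" for j
  proof -
    define N where "N = (2 ^ j :: nat)"
    have N: "N > 0" "Suc (N + (N - 1)) = N + N" by (auto simp: N_def)
    have "emeasure M (?E j) = emeasure M {w \<in> space M. \<forall>i\<in>{1..N + (N - 1)}. B (two_grid t N i) w \<le> two_level N a b i}"
      unfolding N_def[symmetric]
    proof (rule emeasure_two_grid[where X = B, OF M Bm B0 t a])
      fix i
      \<comment> \<open>The only index in question is \<open>i = N\<close>, that is, time 1, where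
        the bridge is 0.\<close>
      show "AE w in M. N - 1 < i \<longrightarrow> i \<le> N \<longrightarrow> B (t + (1 - t) * (real i / real N)) w \<le> b"
      proof (cases "i = N")
        case True
        show ?thesis using B1 by eventually_elim (use True N b in auto)
      qed auto
    qed (use N in auto)
    also have "\<dots> = ennreal (sqrt (2 * pi)) * grid_iter (two_grid t N) (two_level N a b) (N + (N - 1))
        (\<lambda>x. ennreal (gauss (two_grid t N (Suc (N + (N - 1))) - two_grid t N (N + (N - 1))) (x - 0)))"
      using N t by (intro brownian_bridge_grid_prob[OF M B] two_grid_0 two_grid_less) (auto simp: two_grid_end)
    also have "two_grid t N (Suc (N + (N - 1))) - two_grid t N (N + (N - 1)) = (1 - t) / N"
      using N by (simp add: two_grid_diff del: add_diff_assoc)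
    finally show ?thesis unfolding N_def .
  qed
  moreover have "(\<lambda>j. ennreal (sqrt (2 * pi)) * grid_iter (two_grid t (2 ^ j)) (two_level (2 ^ j) a b) (2 ^ j + (2 ^ j - 1))
      (\<lambda>x. ennreal (gauss ((1 - t) / real (2 ^ j :: nat)) (x - 0)))) \<longlonglongrightarrow> sup_cdf bridge_tail t a b"
    using filterlim_compose[OF bridge_grid_tendsto[OF t a b] filterlim_two_power_minus_1] by simp
  ultimately show "(\<lambda>j. emeasure M (?E j)) \<longlonglongrightarrow> sup_cdf bridge_tail t a b" by simp
qed

section \<open>The joint density of the two maxima\<close>

lemma erf_has_real_derivative: "(erf has_real_derivative 2 / sqrt pi * exp (- z\<^sup>2)) (at z)"
proof -
  have "continuous_on A (\<lambda>u::real. exp (- u\<^sup>2))" for A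
    by (intro continuous_intros)
  then have "((\<lambda>u. LBINT y=0..u. exp (- y\<^sup>2)) has_vector_derivative exp (- z\<^sup>2)) (at z within {- \<bar>z\<bar> - 1..\<bar>z\<bar> + 1})"
    using interval_integral_FTC2[of "- \<bar>z\<bar> - 1" 0 "\<bar>z\<bar> + 1" "\<lambda>u. exp (- u\<^sup>2)" z]
    by (cases "z \<ge> 0") (auto simp: zero_ereal_def)
  moreover have "at z within {- \<bar>z\<bar> - 1..\<bar>z\<bar> + 1} = at z"
    by (rule at_within_interior) (auto simp: abs_if)
  ultimately have "((\<lambda>u. LBINT y=0..u. exp (- y\<^sup>2)) has_real_derivative exp (- z\<^sup>2)) (at z)"
    by (simp add: has_real_derivative_iff_has_vector_derivative)
  from DERIV_cmult[OF this, of "2 / sqrt pi"] show ?thesis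
    by (simp add: erf_def[abs_def])
qed

lemma erf_DERIV_chain [derivative_intros]:
  "(f has_real_derivative f') (at x within A) \<Longrightarrow>
    ((\<lambda>x. erf (f x)) has_real_derivative 2 / sqrt pi * exp (- (f x)\<^sup>2) * f') (at x within A)"
  using DERIV_chain2[OF erf_has_real_derivative] by simp

lemma isCont_erf: "isCont erf z"
  using erf_has_real_derivative DERIV_isCont by blast

lemma isCont_erf' [continuous_intros]: "isCont f x \<Longrightarrow> isCont (\<lambda>x. erf (f x)) x"
  using isCont_o2[OF _ isCont_erf] by blast

lemma tendsto_erf [tendsto_intros]: "(f \<longlongrightarrow> l) F \<Longrightarrow> ((\<lambda>x. erf (f x)) \<longlongrightarrow> erf l) F"
  using isCont_tendsto_compose[OF isCont_erf] by blast

lemma erf_measurable [measurable]: "erf \<in> borel_measurable borel"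
  using isCont_erf by (intro borel_measurable_continuous_onI) (auto simp: continuous_on_eq_continuous_at)

lemma erf_0 [simp]: "erf 0 = 0"
  by (simp add: erf_def zero_ereal_def[symmetric])

lemma erf_minus: "erf (- z) = - erf z"
proof -
  have "\<forall>x. ((\<lambda>x. erf x + erf (- x)) has_real_derivative 0) (at x)"
    by (auto intro!: derivative_eq_intros erf_has_real_derivative)
  from DERIV_isconst_all[OF this, of z 0] show ?thesis by simp
qed

lemma erf_mono: "x \<le> y \<Longrightarrow> erf x \<le> erf y"
  by (rule DERIV_nonneg_imp_nondecreasing) (use erf_has_real_derivative in \<open>auto intro!: exI\<close>)

lemma erf_tendsto_1: "(erf \<longlongrightarrow> 1) at_top"
proof -
  let ?f = "\<lambda>x::real. indicator {0..} x *\<^sub>R exp (- x\<^sup>2)"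
  have f: "has_bochner_integral lborel ?f (sqrt pi / 2)"
    by (rule gaussian_moment_0)
  have "((\<lambda>y. \<integral> x. indicator {..y} x *\<^sub>R ?f x \<partial>lborel) \<longlongrightarrow> (\<integral> x. ?f x \<partial>lborel)) at_top"
    by (rule tendsto_integral_at_top) (use f in \<open>auto simp: has_bochner_integral_iff\<close>)
  from tendsto_mult_left[OF this, of "2 / sqrt pi"]
  have "((\<lambda>y. 2 / sqrt pi * (\<integral> x. indicator {..y} x *\<^sub>R ?f x \<partial>lborel)) \<longlongrightarrow> 2 / sqrt pi * (sqrt pi / 2)) at_top"
    unfolding has_bochner_integral_integral_eq[OF f] .
  moreover have "\<forall>\<^sub>F y in at_top. 2 / sqrt pi * (\<integral> x. indicator {..y} x *\<^sub>R ?f x \<partial>lborel) = erf y"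
    using eventually_ge_at_top[of 0]
  proof eventually_elim
    case (elim y)
    have "(LBINT u=0..y. exp (- (u\<^sup>2))) = (LBINT u:{0..y}. exp (- (u\<^sup>2)))"
      using elim by (simp add: interval_integral_Icc zero_ereal_def)
    also have "\<dots> = (\<integral> x. indicator {..y} x *\<^sub>R ?f x \<partial>lborel)"
      unfolding set_lebesgue_integral_def by (intro Bochner_Integration.integral_cong) (auto split: split_indicator)
    finally show ?case by (simp add: erf_def)
  qed
  ultimately show ?thesis by (simp add: tendsto_cong)
qed

lemma erf_tendsto_minus_1: "(erf \<longlongrightarrow> - 1) at_bot"
  unfolding filterlim_at_bot_mirror
  using tendsto_minus[OF erf_tendsto_1] by (simp add: erf_minus)

lemma erf_le_1: "erf x \<le> 1"
  by (rule tendsto_lowerbound[OF erf_tendsto_1])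
    (auto intro!: eventually_mono[OF eventually_ge_at_top[of x]] erf_mono)

lemma erf_nonneg: "0 \<le> x \<Longrightarrow> 0 \<le> erf x"
  using erf_mono[of 0 x] by simp

text \<open>For \<open>x \<ge> 0\<close>, \<open>erf (x / sqrt (2 * s))\<close> is the probability
  that a centred normal variable of variance \<open>s\<close> has absolute value at most
  \<open>x\<close>; this explains the factor 2.\<close>

lemma DERIV_erf_gauss:
  assumes "s > 0" and "(f has_real_derivative f') (at x within A)"
  shows "((\<lambda>x. erf (f x / sqrt (2 * s))) has_real_derivative 2 * gauss s (f x) * f') (at x within A)"
proof -
  have *: "((\<lambda>x. f x / sqrt (2 * s)) has_real_derivative f' / sqrt (2 * s)) (at x within A)"
    using assms by (auto intro!: derivative_eq_intros simp: field_simps)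
  have "2 / sqrt pi * exp (- (f x / sqrt (2 * s))\<^sup>2) * (f' / sqrt (2 * s)) = 2 * gauss s (f x) * f'"
    using assms(1) by (simp add: gauss_eq power_divide real_sqrt_mult divide_simps)
  with erf_DERIV_chain[OF *] show ?thesis by simp
qed

lemma DERIV_gauss [derivative_intros]:
  assumes "s > 0" and "(f has_real_derivative f') (at x within A)"
  shows "((\<lambda>x. gauss s (f x)) has_real_derivative - (f x / s) * gauss s (f x) * f') (at x within A)"
  unfolding gauss_eq[OF assms(1)] using assms
  by (auto intro!: derivative_eq_intros simp: field_simps)

lemma gauss_tendsto_0: "s > 0 \<Longrightarrow> filterlim f at_top F \<Longrightarrow> ((\<lambda>x. gauss s (f x)) \<longlongrightarrow> 0) F"
proof -
  assume s: "s > 0" and f: "filterlim f at_top F"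
  have "(gauss s \<longlongrightarrow> 0) at_top"
    unfolding gauss_eq[OF s, abs_def] using s by real_asymp
  then show ?thesis using f by (rule filterlim_compose)
qed

text \<open>\<open>before_kernel t v y\<close> is the joint density of the maximum over \<open>[0, t]\<close> and the value at time
  \<open>t\<close>, started from \<open>0\<close>; the other two kernels are the densities of the maximum over \<open>[t, 1]\<close>
  given the value \<open>y\<close> at time \<open>t\<close>, for the bridge up to the factor that conditions on \<open>0\<close> at time \<open>1\<close>.\<close>

definition before_kernel :: "real \<Rightarrow> real \<Rightarrow> real \<Rightarrow> ennreal" where
  "before_kernel t v y = ennreal (2 * (2 * v - y) / t * gauss t (2 * v - y)) * indicator {max 0 y..} v"

definition motion_kernel :: "real \<Rightarrow> real \<Rightarrow> real \<Rightarrow> ennreal" where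
  "motion_kernel t u y = ennreal (2 * gauss (1 - t) (u - y)) * indicator {y..} u"

definition bridge_kernel :: "real \<Rightarrow> real \<Rightarrow> real \<Rightarrow> ennreal" where
  "bridge_kernel t u y = ennreal (sqrt (2 * pi)) * before_kernel (1 - t) u y"

lemma before_kernel_eq:
  "before_kernel t v y = ennreal (2 * (2 * v - y) / t * gauss t (2 * v - y)) * indicator {p. 0 \<le> fst p \<and> snd p \<le> fst p} (v, y)"
  unfolding before_kernel_def by (auto split: split_indicator)

lemma motion_kernel_eq:
  "motion_kernel t u y = ennreal (2 * gauss (1 - t) (u - y)) * indicator {p. snd p \<le> fst p} (u, y)"
  unfolding motion_kernel_def by (auto split: split_indicator)

lemma before_kernel_measurable2 [measurable]:
  "(\<lambda>p. before_kernel t (fst p) (snd p)) \<in> borel_measurable (borel \<Otimes>\<^sub>M borel)"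
  unfolding before_kernel_eq by measurable

lemma motion_kernel_measurable2 [measurable]:
  "(\<lambda>p. motion_kernel t (fst p) (snd p)) \<in> borel_measurable (borel \<Otimes>\<^sub>M borel)"
  unfolding motion_kernel_eq by measurable

lemma bridge_kernel_measurable2 [measurable]:
  "(\<lambda>p. bridge_kernel t (fst p) (snd p)) \<in> borel_measurable (borel \<Otimes>\<^sub>M borel)"
  unfolding bridge_kernel_def by measurable

text \<open>In \<open>v\<close>, the kernel is minus the derivative of
  \<open>gauss t (2 * v - y)\<close>, the image term of \<open>refl_kernel v t 0 y\<close>. At the
  lower end \<open>max 0 y\<close> the argument has absolute value \<open>\<bar>y\<bar>\<close>, so
  the primitive there gives the free term.\<close>

lemma before_kernel_integral:
  assumes t: "t > 0"
  shows "(\<integral>\<^sup>+ v. before_kernel t v y * indicator {..a} v \<partial>lborel)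
    = ennreal (refl_kernel a t 0 y) * indicator {..a} y * indicator {0..} a"
proof (cases "max 0 y \<le> a")
  case True
  have "(\<integral>\<^sup>+ v. before_kernel t v y * indicator {..a} v \<partial>lborel)
     = (\<integral>\<^sup>+ v. ennreal (2 * (2 * v - y) / t * gauss t (2 * v - y)) * indicator {max 0 y..a} v \<partial>lborel)"
    unfolding before_kernel_def by (intro nn_integral_cong) (auto split: split_indicator)
  also have "\<dots> = ennreal (- gauss t (2 * a - y) - (- gauss t (2 * max 0 y - y)))"
  proof (rule nn_integral_FTC_Icc[where F = "\<lambda>v. - gauss t (2 * v - y)"])
    fix v assume v: "v \<in> {max 0 y..a}"
    show "((\<lambda>v. - gauss t (2 * v - y)) has_real_derivative 2 * (2 * v - y) / t * gauss t (2 * v - y)) (at v)"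
      using t by (auto intro!: derivative_eq_intros)
    show "0 \<le> 2 * (2 * v - y) / t * gauss t (2 * v - y)"
      using v t by (intro mult_nonneg_nonneg) auto
  qed (use True in auto)
  also have "gauss t (2 * max 0 y - y) = gauss t y"
    by (simp add: max_def)
  finally show ?thesis
    using True by (simp add: refl_kernel_def)
next
  case False
  then have "before_kernel t v y * indicator {..a} v = 0" for v
    unfolding before_kernel_def by (auto split: split_indicator)
  then have "(\<integral>\<^sup>+ v. before_kernel t v y * indicator {..a} v \<partial>lborel) = 0"
    by (simp only: nn_integral_const mult_zero_left)
  then show ?thesis using False by (auto split: split_indicator)
qed

text \<open>Since the reflected kernel is symmetric, the stretch from \<open>y\<close> to 0 of
  duration \<open>1 - t\<close> can be read as one from 0 to \<open>y\<close>, and the integral of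
  \<open>before_kernel\<close> applies.\<close>

lemma bridge_kernel_integral:
  assumes t: "t < 1"
  shows "(\<integral>\<^sup>+ u. bridge_kernel t u y * indicator {..b} u \<partial>lborel)
    = bridge_tail t b y * indicator {..b} y * indicator {0..} b"
proof -
  have [measurable]: "(\<lambda>v. before_kernel (1 - t) v y) \<in> borel_measurable borel"
    unfolding before_kernel_def by measurable
  have "(\<integral>\<^sup>+ u. bridge_kernel t u y * indicator {..b} u \<partial>lborel)
     = ennreal (sqrt (2 * pi)) * (\<integral>\<^sup>+ u. before_kernel (1 - t) u y * indicator {..b} u \<partial>lborel)"
    unfolding bridge_kernel_def by (subst nn_integral_cmult[symmetric]) (auto simp: mult.assoc)
  then show ?thesis
    using t by (simp add: before_kernel_integral bridge_tail_def ennreal_mult' refl_kernel_sym[of b "1 - t" y 0] mult.assoc)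
qed

text \<open>In terms of the distance \<open>w = b - z\<close> below the barrier, the kernel is a
  difference of Gaussians centred at \<open>b - y\<close> and at \<open>-(b - y)\<close>. Its
  primitive is a difference of error functions that vanishes at infinity, so only the value at
  \<open>w = 0\<close> remains.\<close>

lemma motion_tail_eq:
  assumes t: "t < 1" and y: "y \<le> b"
  shows "motion_tail t b y = ennreal (erf ((b - y) / sqrt (2 * (1 - t))))"
proof -
  define s where "s = 1 - t"
  have s: "s > 0" using t by (simp add: s_def)
  have "motion_tail t b y = (\<integral>\<^sup>+ w. ennreal (refl_kernel b s y (b - w)) * indicator {..b} (b - w) \<partial>lborel)"
    unfolding motion_tail_def s_def
    by (rule nn_integral_lborel_reflect[symmetric, of "\<lambda>z. ennreal (refl_kernel b (1 - t) y z) * indicator {..b} z"]) measurable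
  also have "\<dots> = (\<integral>\<^sup>+ w. ennreal (gauss s (w - (b - y)) - gauss s (w + (b - y))) * indicator {0..} w \<partial>lborel)"
    unfolding refl_kernel_def
    by (intro nn_integral_cong) (auto split: split_indicator simp: algebra_simps)
  also have "\<dots> = ennreal (0 - (erf ((0 - (b - y)) / sqrt (2 * s)) / 2 - erf ((0 + (b - y)) / sqrt (2 * s)) / 2))"
  proof (rule nn_integral_FTC_atLeast[where F = "\<lambda>w. erf ((w - (b - y)) / sqrt (2 * s)) / 2 - erf ((w + (b - y)) / sqrt (2 * s)) / 2"])
    fix w :: real assume w: "0 \<le> w"
    have 1: "((\<lambda>w. w - (b - y)) has_real_derivative 1) (at w)" and 2: "((\<lambda>w. w + (b - y)) has_real_derivative 1) (at w)"
      by (auto intro!: derivative_eq_intros)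
    show "((\<lambda>w. erf ((w - (b - y)) / sqrt (2 * s)) / 2 - erf ((w + (b - y)) / sqrt (2 * s)) / 2)
      has_real_derivative gauss s (w - (b - y)) - gauss s (w + (b - y))) (at w)"
      using DERIV_diff[OF DERIV_cmult[OF DERIV_erf_gauss[OF s 1], of "1 / 2"] DERIV_cmult[OF DERIV_erf_gauss[OF s 2], of "1 / 2"]]
      by simp
    show "0 \<le> gauss s (w - (b - y)) - gauss s (w + (b - y))"
      using gauss_mono[OF s, of "w - (b - y)" "w + (b - y)"] w y by auto
  next
    have "filterlim (\<lambda>w. (w - (b - y)) / sqrt (2 * s)) at_top at_top" "filterlim (\<lambda>w. (w + (b - y)) / sqrt (2 * s)) at_top at_top"
      using s by real_asymp+
    from this[THEN filterlim_compose[OF erf_tendsto_1]]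
    have "((\<lambda>w. erf ((w - (b - y)) / sqrt (2 * s)) / 2 - erf ((w + (b - y)) / sqrt (2 * s)) / 2) \<longlongrightarrow> 1 / 2 - 1 / 2) at_top"
      by (intro tendsto_intros) auto
    then show "((\<lambda>w. erf ((w - (b - y)) / sqrt (2 * s)) / 2 - erf ((w + (b - y)) / sqrt (2 * s)) / 2) \<longlongrightarrow> 0) at_top"
      by simp
  qed measurable
  also have "erf ((0 - (b - y)) / sqrt (2 * s)) = - erf ((b - y) / sqrt (2 * s))"
    by (simp only: diff_0 minus_divide_left[symmetric] erf_minus)
  finally show ?thesis by (simp add: s_def)
qed

lemma motion_kernel_integral:
  assumes t: "t < 1"
  shows "(\<integral>\<^sup>+ u. motion_kernel t u y * indicator {..b} u \<partial>lborel) = motion_tail t b y * indicator {..b} y"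
proof (cases "y \<le> b")
  case True
  have "(\<integral>\<^sup>+ u. motion_kernel t u y * indicator {..b} u \<partial>lborel)
     = (\<integral>\<^sup>+ u. ennreal (2 * gauss (1 - t) (u - y)) * indicator {y..b} u \<partial>lborel)"
    unfolding motion_kernel_def by (intro nn_integral_cong) (auto split: split_indicator)
  also have "\<dots> = ennreal (erf ((b - y) / sqrt (2 * (1 - t))) - erf ((y - y) / sqrt (2 * (1 - t))))"
  proof (rule nn_integral_FTC_Icc[where F = "\<lambda>u. erf ((u - y) / sqrt (2 * (1 - t)))"])
    fix u
    have "((\<lambda>u. erf ((u - y) / sqrt (2 * (1 - t)))) has_real_derivative 2 * gauss (1 - t) (u - y) * 1) (at u)"
      using t by (intro DERIV_erf_gauss) (auto intro!: derivative_eq_intros)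
    then show "((\<lambda>u. erf ((u - y) / sqrt (2 * (1 - t)))) has_real_derivative 2 * gauss (1 - t) (u - y)) (at u)"
      by simp
  qed (use True in auto)
  finally show ?thesis using True t by (simp add: motion_tail_eq)
next
  case False
  then have "motion_kernel t u y * indicator {..b} u = 0" for u
    unfolding motion_kernel_def by (auto split: split_indicator)
  then have "(\<integral>\<^sup>+ u. motion_kernel t u y * indicator {..b} u \<partial>lborel) = 0"
    by (simp only: nn_integral_const mult_zero_left)
  then show ?thesis using False by simp
qed

text \<open>With equal levels the semigroup identity glues the two halves into the kernel over
  \<open>[0, 1]\<close>, and integrating out the endpoint is \<open>motion_tail_eq\<close> at time 0
  and position 0.\<close>

lemma sup_cdf_motion_diag:
  assumes t: "0 < t" "t < 1" and z: "0 \<le> z"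
  shows "sup_cdf motion_tail t z z = ennreal (erf (z / sqrt 2))"
proof -
  have [measurable]: "(\<lambda>p. refl_kernel z (1 - t) (fst p) (snd p)) \<in> borel_measurable (borel \<Otimes>\<^sub>M borel)"
    unfolding refl_kernel_def by measurable
  have "sup_cdf motion_tail t z z
     = (\<integral>\<^sup>+ y. \<integral>\<^sup>+ w. ennreal (refl_kernel z t 0 y) * indicator {..z} y * (ennreal (refl_kernel z (1 - t) y w) * indicator {..z} w) \<partial>lborel \<partial>lborel)"
    unfolding sup_cdf_def motion_tail_def
    by (intro nn_integral_cong) (auto simp: nn_integral_cmult split: split_indicator)
  also have "\<dots> = (\<integral>\<^sup>+ w. \<integral>\<^sup>+ y. ennreal (refl_kernel z t 0 y) * indicator {..z} y * (ennreal (refl_kernel z (1 - t) y w) * indicator {..z} w) \<partial>lborel \<partial>lborel)"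
    by (rule lborel_pair.Fubini') measurable
  also have "\<dots> = (\<integral>\<^sup>+ w. ennreal (refl_kernel z 1 0 w) * indicator {..z} w \<partial>lborel)"
  proof (rule nn_integral_cong)
    fix w :: real
    have "(\<integral>\<^sup>+ y. ennreal (refl_kernel z t 0 y) * indicator {..z} y * ennreal (refl_kernel z (1 - t) y w) * indicator {..z} w \<partial>lborel)
      = (\<integral>\<^sup>+ y. ennreal (refl_kernel z t 0 y) * indicator {..z} y * ennreal (refl_kernel z (1 - t) y w) \<partial>lborel) * indicator {..z} w"
      by (rule nn_integral_multc) measurable
    also have "\<dots> = ennreal (refl_kernel z 1 0 w) * indicator {..z} w"
      using refl_kernel_conv[of t "1 - t" 0 z w] t z by (auto split: split_indicator)
    finally show "(\<integral>\<^sup>+ y. ennreal (refl_kernel z t 0 y) * indicator {..z} y * (ennreal (refl_kernel z (1 - t) y w) * indicator {..z} w) \<partial>lborel)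
      = ennreal (refl_kernel z 1 0 w) * indicator {..z} w" by (simp only: mult.assoc)
  qed
  also have "\<dots> = ennreal (erf (z / sqrt 2))"
    using motion_tail_eq[of 0 0 z] z by (simp add: motion_tail_def)
  finally show ?thesis .
qed

text \<open>After the same gluing only \<open>refl_kernel z 1 0 0\<close> is left; its image source
  sits at distance \<open>2 * z\<close>, whence the exponential.\<close>

lemma sup_cdf_bridge_diag:
  assumes t: "0 < t" "t < 1" and z: "0 \<le> z"
  shows "sup_cdf bridge_tail t z z = ennreal (1 - exp (- 2 * z\<^sup>2))"
proof -
  have "sup_cdf bridge_tail t z z
     = (\<integral>\<^sup>+ y. ennreal (sqrt (2 * pi)) * (ennreal (refl_kernel z t 0 y) * indicator {..z} y * ennreal (refl_kernel z (1 - t) y 0)) \<partial>lborel)"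
    unfolding sup_cdf_def bridge_tail_def
    by (intro nn_integral_cong) (auto simp: ennreal_mult' ac_simps split: split_indicator)
  also have "\<dots> = ennreal (sqrt (2 * pi)) * ennreal (refl_kernel z 1 0 0)"
    using refl_kernel_conv[of t "1 - t" 0 z 0] t z by (subst nn_integral_cmult) auto
  also have "\<dots> = ennreal (sqrt (2 * pi) * refl_kernel z 1 0 0)"
    by (simp add: ennreal_mult')
  also have "sqrt (2 * pi) * refl_kernel z 1 0 0 = 1 - exp (- 2 * z\<^sup>2)"
    by (simp add: refl_kernel_def gauss_eq field_simps)
  finally show ?thesis .
qed

text \<open>The density at \<open>v\<close> of the maximum over \<open>[0, 1]\<close>, restricted to its being attained before \<open>t\<close>.\<close>

definition motion_argmax :: "real \<Rightarrow> real \<Rightarrow> real" where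
  "motion_argmax t v = sqrt (2 / pi) * exp (- v\<^sup>2 / 2) * (1 - erf (v * (1 - t) / sqrt (2 * (t * (1 - t)))))"

definition bridge_argmax :: "real \<Rightarrow> real \<Rightarrow> real" where
  "bridge_argmax t v = 2 * v * exp (- 2 * v\<^sup>2) * (1 - erf (v * (1 - 2 * t) / sqrt (2 * (t * (1 - t)))))"

text \<open>\<open>w = v - y\<close> is the depth of the path below its maximum at time
  \<open>t\<close>. For \<open>v > 0\<close> the constraint \<open>max 0 y \<le> v\<close> says just
  that \<open>w\<close> is nonnegative.\<close>

lemma argmax_kernel_shift:
  assumes t: "0 < t" and v: "0 < v" and [measurable]: "h \<in> borel_measurable borel"
  shows "(\<integral>\<^sup>+ y. before_kernel t v y * h y \<partial>lborel)
    = (\<integral>\<^sup>+ w. ennreal (2 * (v + w) / t * gauss t (v + w)) * indicator {0..} w * h (v - w) \<partial>lborel)"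
proof -
  have [measurable]: "(\<lambda>y. before_kernel t v y) \<in> borel_measurable borel"
    unfolding before_kernel_eq by measurable
  have "(\<integral>\<^sup>+ y. before_kernel t v y * h y \<partial>lborel) = (\<integral>\<^sup>+ w. before_kernel t v (v - w) * h (v - w) \<partial>lborel)"
    by (rule nn_integral_lborel_reflect[symmetric, of "\<lambda>y. before_kernel t v y * h y"]) measurable
  also have "\<dots> = (\<integral>\<^sup>+ w. ennreal (2 * (v + w) / t * gauss t (v + w)) * indicator {0..} w * h (v - w) \<partial>lborel)"
    unfolding before_kernel_def using v by (intro nn_integral_cong) (auto split: split_indicator simp: algebra_simps)
  finally show ?thesis .
qed

lemma motion_argmax_integral:
  assumes t: "0 < t" "t < 1" and v: "0 < v"
  shows "(\<integral>\<^sup>+ y. before_kernel t v y * (motion_tail t v y * indicator {..v} y) \<partial>lborel) = ennreal (motion_argmax t v)"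
proof -
  define s where "s = 1 - t"
  define \<tau> where "\<tau> = t * s"
  have s: "s > 0" and \<tau>: "\<tau> > 0" using t by (auto simp: s_def \<tau>_def)
  let ?c = "sqrt (2 / pi) * exp (- v\<^sup>2 / 2)"
  \<comment> \<open>Integration by parts: the first summand integrates the Gaussian derivative
    against \<open>erf\<close>, leaving \<open>4 * gauss t (v + w) * gauss s w\<close>. By
    completing the square this is a multiple of one Gaussian of variance \<tau> centred at
    \<open>- v * s\<close>, which the second summand integrates.\<close>
  let ?H = "\<lambda>w. - 2 * gauss t (v + w) * erf (w / sqrt (2 * s)) + ?c * erf ((w + v * s) / sqrt (2 * \<tau>))"
  have prod: "4 * gauss t (v + w) * gauss s w = ?c * (2 * gauss \<tau> (w + v * s))" for w
  proof -
    have e: "- (v + w)\<^sup>2 / (2 * t) + - w\<^sup>2 / (2 * s) = - v\<^sup>2 / 2 + - (w + v * s)\<^sup>2 / (2 * \<tau>)"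
      using t by (simp add: s_def \<tau>_def divide_simps) (simp add: algebra_simps power2_eq_square)
    have "4 * gauss t (v + w) * gauss s w = 4 / (sqrt (2 * pi * t) * sqrt (2 * pi * s)) * (exp (- (v + w)\<^sup>2 / (2 * t)) * exp (- w\<^sup>2 / (2 * s)))"
      using t s by (simp add: gauss_eq)
    also have "exp (- (v + w)\<^sup>2 / (2 * t)) * exp (- w\<^sup>2 / (2 * s)) = exp (- v\<^sup>2 / 2) * exp (- (w + v * s)\<^sup>2 / (2 * \<tau>))"
      unfolding exp_add[symmetric] e ..
    also have "4 / (sqrt (2 * pi * t) * sqrt (2 * pi * s)) = sqrt (2 / pi) * 2 / sqrt (2 * pi * \<tau>)"
      using t s by (simp add: \<tau>_def real_sqrt_mult real_sqrt_divide field_simps)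
    finally show ?thesis using \<tau> by (simp add: gauss_eq)
  qed
  have "(\<integral>\<^sup>+ y. before_kernel t v y * (motion_tail t v y * indicator {..v} y) \<partial>lborel)
    = (\<integral>\<^sup>+ w. ennreal (2 * (v + w) / t * gauss t (v + w)) * indicator {0..} w * (motion_tail t v (v - w) * indicator {..v} (v - w)) \<partial>lborel)"
    using t v by (intro argmax_kernel_shift) auto
  also have "\<dots> = (\<integral>\<^sup>+ w. ennreal (2 * (v + w) / t * gauss t (v + w) * erf (w / sqrt (2 * s))) * indicator {0..} w \<partial>lborel)"
    using t v by (intro nn_integral_cong)
      (auto split: split_indicator simp: motion_tail_eq s_def ennreal_mult'[symmetric])
  also have "\<dots> = ennreal (?c - ?H 0)"
  proof (rule nn_integral_FTC_atLeast[where F = "?H"])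
    fix w :: real assume w: "0 \<le> w"
    have "(?H has_real_derivative (- 2 * (- ((v + w) / t) * gauss t (v + w) * 1)) * erf (w / sqrt (2 * s))
        + (2 * gauss s w * 1) * (- 2 * gauss t (v + w)) + ?c * (2 * gauss \<tau> (w + v * s) * 1)) (at w)"
      using t by (intro DERIV_add DERIV_mult DERIV_cmult DERIV_erf_gauss[OF s] DERIV_erf_gauss[OF \<tau>] DERIV_gauss)
        (auto intro!: derivative_eq_intros)
    moreover have "(- 2 * (- ((v + w) / t) * gauss t (v + w) * 1)) * erf (w / sqrt (2 * s))
        + (2 * gauss s w * 1) * (- 2 * gauss t (v + w)) + ?c * (2 * gauss \<tau> (w + v * s) * 1)
        = 2 * (v + w) / t * gauss t (v + w) * erf (w / sqrt (2 * s))"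
    proof -
      have "?c * (2 * gauss \<tau> (w + v * s) * 1) = 4 * gauss t (v + w) * gauss s w" using prod[of w] by simp
      then show ?thesis using t by (simp only:) (simp add: field_simps)
    qed
    ultimately show "(?H has_real_derivative 2 * (v + w) / t * gauss t (v + w) * erf (w / sqrt (2 * s))) (at w)"
      by simp
    show "0 \<le> 2 * (v + w) / t * gauss t (v + w) * erf (w / sqrt (2 * s))"
      using t v w s by (intro mult_nonneg_nonneg erf_nonneg) auto
  next
    have "filterlim (\<lambda>w. w / sqrt (2 * s)) at_top at_top" "filterlim (\<lambda>w. (w + v * s) / sqrt (2 * \<tau>)) at_top at_top"
      using s \<tau> by real_asymp+
    from this[THEN filterlim_compose[OF erf_tendsto_1]]
    have "(?H \<longlongrightarrow> - 2 * 0 * 1 + ?c * 1) at_top"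
      using t by (intro tendsto_intros gauss_tendsto_0 filterlim_tendsto_add_at_top[OF tendsto_const filterlim_ident]) auto
    then show "(?H \<longlongrightarrow> ?c) at_top" by simp
  qed measurable
  also have "?c - ?H 0 = motion_argmax t v"
    by (simp add: motion_argmax_def s_def \<tau>_def algebra_simps)
  finally show ?thesis .
qed

lemma bridge_argmax_integral:
  assumes t: "0 < t" "t < 1" and v: "0 < v"
  shows "(\<integral>\<^sup>+ y. before_kernel t v y * (bridge_tail t v y * indicator {..v} y) \<partial>lborel) = ennreal (bridge_argmax t v)"
proof -
  define s where "s = 1 - t"
  define \<tau> where "\<tau> = t * s"
  have s: "s > 0" and \<tau>: "\<tau> > 0" using t by (auto simp: s_def \<tau>_def)
  let ?e = "exp (- 2 * v\<^sup>2)"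
  let ?u = "\<lambda>w. w + v * (1 - 2 * t)"
  \<comment> \<open>Since \<open>v + w = ?u w + 2 * v * t\<close>, the first Gaussian term of the
    integrand splits into an exact derivative and a multiple of \<open>gauss \<tau> (?u w)\<close>,
    which integrates to \<open>erf\<close>. The second Gaussian term is an exact derivative.\<close>
  let ?H = "\<lambda>w. ?e * (- (2 * s) * gauss \<tau> (?u w) + 2 * v * erf (?u w / sqrt (2 * \<tau>))) + 2 * s * gauss \<tau> (v + w)"
  have root: "sqrt (2 * pi) * (exp A / sqrt (2 * pi * t) * (exp B / sqrt (2 * pi * s))) = exp (A + B) / sqrt (2 * pi * \<tau>)" for A B
    using t s by (simp add: \<tau>_def real_sqrt_mult field_simps exp_add)
  have prod1: "sqrt (2 * pi) * (gauss t (v + w) * gauss s (v - w)) = ?e * gauss \<tau> (?u w)" for w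
  proof -
    have e: "- (v + w)\<^sup>2 / (2 * t) + - (v - w)\<^sup>2 / (2 * s) = - 2 * v\<^sup>2 + - (?u w)\<^sup>2 / (2 * \<tau>)"
      using t by (simp add: s_def \<tau>_def divide_simps) (simp add: algebra_simps power2_eq_square)
    show ?thesis unfolding gauss_eq[OF t(1)] gauss_eq[OF s] gauss_eq[OF \<tau>] root e exp_add by simp
  qed
  have prod2: "sqrt (2 * pi) * (gauss t (v + w) * gauss s (v + w)) = gauss \<tau> (v + w)" for w
  proof -
    have e: "- (v + w)\<^sup>2 / (2 * t) + - (v + w)\<^sup>2 / (2 * s) = - (v + w)\<^sup>2 / (2 * \<tau>)"
      using t by (simp add: s_def \<tau>_def divide_simps) (simp add: algebra_simps power2_eq_square)
    show ?thesis unfolding gauss_eq[OF t(1)] gauss_eq[OF s] gauss_eq[OF \<tau>] root e ..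
  qed
  let ?h = "\<lambda>w. 2 * (v + w) / t * (?e * gauss \<tau> (?u w) - gauss \<tau> (v + w))"
  have h: "2 * (v + w) / t * gauss t (v + w) * (sqrt (2 * pi) * refl_kernel v s (v - w) 0) = ?h w" for w
    unfolding prod1[symmetric] prod2[symmetric] refl_kernel_def using t by (simp add: field_simps)
  have "(\<integral>\<^sup>+ y. before_kernel t v y * (bridge_tail t v y * indicator {..v} y) \<partial>lborel)
    = (\<integral>\<^sup>+ w. ennreal (2 * (v + w) / t * gauss t (v + w)) * indicator {0..} w * (bridge_tail t v (v - w) * indicator {..v} (v - w)) \<partial>lborel)"
    using t v by (intro argmax_kernel_shift) auto
  also have "\<dots> = (\<integral>\<^sup>+ w. ennreal (?h w) * indicator {0..} w \<partial>lborel)"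
    unfolding h[symmetric] using t v by (intro nn_integral_cong)
      (auto split: split_indicator simp: bridge_tail_def s_def ennreal_mult'[symmetric])
  also have "\<dots> = ennreal (2 * v * ?e - ?H 0)"
  proof (rule nn_integral_FTC_atLeast[where F = "?H"])
    fix w :: real assume w: "0 \<le> w"
    have "(?H has_real_derivative ?e * (- (2 * s) * (- (?u w / \<tau>) * gauss \<tau> (?u w) * 1) + 2 * v * (2 * gauss \<tau> (?u w) * 1))
        + 2 * s * (- ((v + w) / \<tau>) * gauss \<tau> (v + w) * 1)) (at w)"
      by (intro DERIV_add DERIV_cmult DERIV_erf_gauss[OF \<tau>] DERIV_gauss[OF \<tau>]) (auto intro!: derivative_eq_intros)
    moreover have "?e * (- (2 * s) * (- (?u w / \<tau>) * gauss \<tau> (?u w) * 1) + 2 * v * (2 * gauss \<tau> (?u w) * 1))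
        + 2 * s * (- ((v + w) / \<tau>) * gauss \<tau> (v + w) * 1) = ?h w"
    proof -
      have 1: "- (2 * s) * (- (?u w / \<tau>) * gauss \<tau> (?u w) * 1) + 2 * v * (2 * gauss \<tau> (?u w) * 1)
         = 2 * (v + w) / t * gauss \<tau> (?u w)"
        using t s by (simp add: \<tau>_def field_simps)
      have 2: "2 * s * (- ((v + w) / \<tau>) * gauss \<tau> (v + w) * 1) = - (2 * (v + w) / t * gauss \<tau> (v + w))"
        using t s by (simp add: \<tau>_def field_simps)
      show ?thesis unfolding 1 2 by (simp add: algebra_simps)
    qed
    ultimately show "(?H has_real_derivative ?h w) (at w)" by simp
    show "0 \<le> ?h w"
      unfolding h[symmetric] using t v w s by (intro mult_nonneg_nonneg refl_kernel_nonneg) auto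
  next
    have u: "filterlim ?u at_top at_top" "filterlim (\<lambda>w. v + w) at_top at_top" by real_asymp+
    have "filterlim (\<lambda>w. ?u w / sqrt (2 * \<tau>)) at_top at_top"
      using \<tau> by real_asymp
    from this[THEN filterlim_compose[OF erf_tendsto_1]]
    have "(?H \<longlongrightarrow> ?e * (- (2 * s) * 0 + 2 * v * 1) + 2 * s * 0) at_top"
      by (intro tendsto_intros gauss_tendsto_0 u \<tau>)
    then show "(?H \<longlongrightarrow> 2 * v * ?e) at_top" by (simp add: mult.commute)
  qed measurable
  also have "2 * v * ?e - ?H 0 = bridge_argmax t v"
  proof -
    \<comment> \<open>At \<open>w = 0\<close> the position is on the barrier, where the reflected
      kernel vanishes, so the two Gaussian boundary terms cancel.\<close>
    have "?e * gauss \<tau> (?u 0) = gauss \<tau> v"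
      using prod1[of 0] prod2[of 0] by simp
    then have "?e * (2 * s) * gauss \<tau> (?u 0) = 2 * s * gauss \<tau> v" by (simp add: mult.commute mult.left_commute)
    then show ?thesis by (simp add: bridge_argmax_def s_def \<tau>_def algebra_simps)
  qed
  finally show ?thesis .
qed

section \<open>Time derivatives\<close>

text \<open>Only limits of the primitive are asked for at the ends, because the densities in time
  contain negative powers of \<open>s\<close> and \<open>1 - s\<close>.\<close>

lemma nn_integral_FTC_greaterThanLessThan:
  fixes f F :: "real \<Rightarrow> real"
  assumes "a < b"
    and F: "\<And>x. a < x \<Longrightarrow> x < b \<Longrightarrow> (F has_real_derivative f x) (at x)"
    and f: "\<And>x. a < x \<Longrightarrow> x < b \<Longrightarrow> isCont f x"
    and nonneg: "\<And>x. a < x \<Longrightarrow> x < b \<Longrightarrow> 0 \<le> f x"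
    and A: "(F \<longlongrightarrow> A) (at_right a)" and B: "(F \<longlongrightarrow> B) (at_left b)"
  shows "(\<integral>\<^sup>+ x. ennreal (f x) * indicator {a<..<b} x \<partial>lborel) = ennreal (B - A)"
proof -
  have ein: "einterval (ereal a) (ereal b) = {a<..<b}"
    by (auto simp: einterval_def)
  have lims: "((F \<circ> real_of_ereal) \<longlongrightarrow> A) (at_right (ereal a))" "((F \<circ> real_of_ereal) \<longlongrightarrow> B) (at_left (ereal b))"
    using A B by (simp_all add: ereal_tendsto_simps)
  have int: "set_integrable lborel {a<..<b} f" and val: "(LBINT x=ereal a..ereal b. f x) = B - A"
    using interval_integral_FTC_nonneg[of "ereal a" "ereal b" F f A B] assms lims unfolding ein by auto
  have "(\<integral>\<^sup>+ x. ennreal (f x) * indicator {a<..<b} x \<partial>lborel) = (\<integral>\<^sup>+ x. ennreal (indicator {a<..<b} x *\<^sub>R f x) \<partial>lborel)"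
    by (intro nn_integral_cong) (auto split: split_indicator)
  also have "\<dots> = ennreal (LBINT x:{a<..<b}. f x)"
    using int nonneg unfolding set_integrable_def set_lebesgue_integral_def
    by (intro nn_integral_eq_integral) (auto split: split_indicator)
  also have "(LBINT x:{a<..<b}. f x) = B - A"
    using val \<open>a < b\<close> unfolding interval_lebesgue_integral_def ein by simp
  finally show ?thesis .
qed

text \<open>The integrand of \<open>rho1\<close> without \<open>m\<close> and without the
  distribution functions of the competitors: the joint density of time \<open>s\<close> and value
  \<open>v\<close> of the maximum of a single motion. \<open>bridge_density\<close> plays the same
  part for \<open>rho2\<close>.\<close>

definition motion_density :: "real \<Rightarrow> real \<Rightarrow> real" where
  "motion_density s v = 1 / (pi * s powr (3/2) * sqrt (1 - s)) * (v * exp (- v\<^sup>2 / (2 * s)))"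

definition bridge_density :: "real \<Rightarrow> real \<Rightarrow> real" where
  "bridge_density s v = sqrt (2 / pi) * (1 / (s * (1 - s)) powr (3/2)) * (v\<^sup>2 * exp (- v\<^sup>2 / (2 * s * (1 - s))))"

lemma powr_3_2: "x > 0 \<Longrightarrow> x powr (3/2) = x * sqrt (x::real)"
  using powr_add[of x 1 "1/2"] by (simp add: powr_half_sqrt)

lemma motion_density_nonneg: "0 < s \<Longrightarrow> s < 1 \<Longrightarrow> 0 \<le> v \<Longrightarrow> 0 \<le> motion_density s v"
  unfolding motion_density_def by simp

lemma bridge_density_nonneg: "0 < s \<Longrightarrow> s < 1 \<Longrightarrow> 0 \<le> bridge_density s v"
  unfolding bridge_density_def by simp

text \<open>The primitive is \<open>motion_argmax\<close> with
  \<open>(1 - T) / sqrt (T * (1 - T))\<close> rewritten as \<open>sqrt (1 / T - 1)\<close>. In this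
  form it makes sense at \<open>T = 1\<close> too, where \<open>erf\<close> vanishes, so the total
  mass is included.\<close>

lemma motion_density_integral_aux:
  assumes v: "0 < v" and T: "0 < T" "T \<le> 1"
  shows "(\<integral>\<^sup>+ s. ennreal (motion_density s v) * indicator {0<..<T} s \<partial>lborel)
    = ennreal (sqrt (2 / pi) * exp (- v\<^sup>2 / 2) * (1 - erf (v * sqrt (1 / T - 1) / sqrt 2)))"
proof -
  let ?c = "sqrt (2 / pi) * exp (- v\<^sup>2 / 2)"
  let ?F = "\<lambda>s. ?c * (1 - erf (v * sqrt (1 / s - 1) / sqrt 2))"
  have "(\<integral>\<^sup>+ s. ennreal (motion_density s v) * indicator {0<..<T} s \<partial>lborel) = ennreal (?F T - ?c * (1 - 1))"
  proof (rule nn_integral_FTC_greaterThanLessThan[where F = ?F])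
    fix s :: real assume "0 < s" "s < T"
    then have s: "0 < s" "s < 1" using T by auto
    have pos: "1 / s - 1 > 0" using s by (simp add: field_simps)
    have root: "sqrt (1 / s - 1) = sqrt (1 - s) / sqrt s"
      using s by (simp add: real_sqrt_divide[symmetric] diff_divide_distrib)
    have "(?F has_real_derivative ?c * (0 - 2 / sqrt pi * exp (- (v * sqrt (1 / s - 1) / sqrt 2)\<^sup>2)
       * (v * ((- 1 / s\<^sup>2) * (inverse (sqrt (1 / s - 1)) / 2)) / sqrt 2))) (at s)"
    proof (intro DERIV_cmult DERIV_diff DERIV_const erf_DERIV_chain DERIV_cdivide)
      have "((\<lambda>s. 1 / s - 1) has_real_derivative - 1 / s\<^sup>2) (at s)"
        using s by (auto intro!: derivative_eq_intros simp: power2_eq_square)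
      from DERIV_chain2[OF DERIV_real_sqrt[OF pos] this]
      show "((\<lambda>s. sqrt (1 / s - 1)) has_real_derivative (- 1 / s\<^sup>2) * (inverse (sqrt (1 / s - 1)) / 2)) (at s)"
        by (simp add: mult.commute)
    qed
    moreover have "?c * (0 - 2 / sqrt pi * exp (- (v * sqrt (1 / s - 1) / sqrt 2)\<^sup>2)
       * (v * ((- 1 / s\<^sup>2) * (inverse (sqrt (1 / s - 1)) / 2)) / sqrt 2)) = motion_density s v"
    proof -
      have "(v * sqrt (1 / s - 1) / sqrt 2)\<^sup>2 = v\<^sup>2 / (2 * s) - v\<^sup>2 / 2"
        using pos by (simp add: power_divide power_mult_distrib) (simp add: field_simps)
      then have e: "exp (- (v * sqrt (1 / s - 1) / sqrt 2)\<^sup>2) = exp (- v\<^sup>2 / (2 * s)) / exp (- v\<^sup>2 / 2)"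
        by (simp add: exp_diff[symmetric])
      have r: "inverse (sqrt (1 / s - 1)) = sqrt s / sqrt (1 - s)" unfolding root by simp
      have ss: "s\<^sup>2 = s * sqrt s * sqrt s" using s by (simp add: power2_eq_square)
      have "sqrt (2 / pi) / sqrt pi / sqrt 2 = 1 / pi" by (simp add: real_sqrt_divide)
      then have "?c * (0 - 2 / sqrt pi * (exp (- v\<^sup>2 / (2 * s)) / exp (- v\<^sup>2 / 2))
       * (v * ((- 1 / (s * sqrt s * sqrt s)) * (sqrt s / sqrt (1 - s) / 2)) / sqrt 2))
        = (sqrt (2 / pi) / sqrt pi / sqrt 2) * (v * exp (- v\<^sup>2 / (2 * s)) / (s * sqrt s * sqrt (1 - s)))"
        using s by (simp add: field_simps)
      also have "\<dots> = motion_density s v"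
        unfolding motion_density_def powr_3_2[OF s(1)] \<open>sqrt (2 / pi) / sqrt pi / sqrt 2 = 1 / pi\<close> by simp
      finally show ?thesis unfolding e r ss .
    qed
    ultimately show "(?F has_real_derivative motion_density s v) (at s)" by simp
    show "isCont (\<lambda>s. motion_density s v) s"
      unfolding motion_density_def using s by (intro continuous_intros) auto
    show "0 \<le> motion_density s v" using s v by (intro motion_density_nonneg) auto
  next
    have "filterlim (\<lambda>s. v * sqrt (1 / s - 1) / sqrt 2) at_top (at_right 0)"
      using v by real_asymp
    from filterlim_compose[OF erf_tendsto_1 this]
    show "(?F \<longlongrightarrow> ?c * (1 - 1)) (at_right 0)" by (intro tendsto_intros)
    have "isCont ?F T"
      using T by (intro continuous_intros) auto
    then show "(?F \<longlongrightarrow> ?F T) (at_left T)"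
      unfolding isCont_def by (rule tendsto_within_subset) auto
  qed (use T in auto)
  then show ?thesis by simp
qed

lemma motion_argmax_eq:
  assumes "0 < t" "t < 1"
  shows "motion_argmax t v = sqrt (2 / pi) * exp (- v\<^sup>2 / 2) * (1 - erf (v * sqrt (1 / t - 1) / sqrt 2))"
proof -
  define r where "r = sqrt (1 - t)"
  have r: "r > 0" "r * r = 1 - t" using assms by (auto simp: r_def)
  have "sqrt (1 / t - 1) = r / sqrt t"
    using assms by (simp add: r_def real_sqrt_divide[symmetric] diff_divide_distrib)
  moreover have "sqrt (2 * (t * (1 - t))) = sqrt 2 * (sqrt t * r)"
    by (simp add: r_def real_sqrt_mult)
  moreover have "v * (r * r) / (sqrt 2 * (sqrt t * r)) = v * (r / sqrt t) / sqrt 2"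
    using r(1) by simp
  ultimately have "v * (1 - t) / sqrt (2 * (t * (1 - t))) = v * sqrt (1 / t - 1) / sqrt 2"
    by (simp only: r(2))
  then show ?thesis unfolding motion_argmax_def by simp
qed

lemma motion_density_integral:
  assumes "0 < v" "0 < t" "t < 1"
  shows "(\<integral>\<^sup>+ s. ennreal (motion_density s v) * indicator {0<..<t} s \<partial>lborel) = ennreal (motion_argmax t v)"
  using motion_density_integral_aux[of v t] assms by (simp add: motion_argmax_eq)

lemma motion_density_total:
  assumes "0 < v"
  shows "(\<integral>\<^sup>+ s. ennreal (motion_density s v) * indicator {0<..<1} s \<partial>lborel) = ennreal (sqrt (2 / pi) * exp (- v\<^sup>2 / 2))"
  using motion_density_integral_aux[of v 1] assms by simp

text \<open>The argument of \<open>erf\<close> decreases from plus infinity at time 0 to minus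
  infinity at time 1, so at \<open>T = 1\<close> the primitive has only a left limit. Hence the
  parameter \<open>L\<close>: the value at \<open>T\<close> if \<open>T < 1\<close>, and -1 if
  \<open>T = 1\<close>.\<close>

lemma bridge_density_integral_aux:
  assumes v: "0 < v" and T: "0 < T" "T \<le> 1"
    and L: "((\<lambda>s. erf (v * ((1 - 2 * s) / sqrt (s * (1 - s))) / sqrt 2)) \<longlongrightarrow> L) (at_left T)"
  shows "(\<integral>\<^sup>+ s. ennreal (bridge_density s v) * indicator {0<..<T} s \<partial>lborel)
    = ennreal (2 * v * exp (- 2 * v\<^sup>2) * (1 - L))"
proof -
  let ?c = "2 * v * exp (- 2 * v\<^sup>2)"
  let ?q = "\<lambda>s::real. (1 - 2 * s) / sqrt (s * (1 - s))"
  let ?F = "\<lambda>s. ?c * (1 - erf (v * ?q s / sqrt 2))"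
  have "(\<integral>\<^sup>+ s. ennreal (bridge_density s v) * indicator {0<..<T} s \<partial>lborel) = ennreal (?c * (1 - L) - ?c * (1 - 1))"
  proof (rule nn_integral_FTC_greaterThanLessThan[where F = ?F])
    fix s :: real assume "0 < s" "s < T"
    then have s: "0 < s" "s < 1" using T by auto
    define \<tau> where "\<tau> = s * (1 - s)"
    have \<tau>: "\<tau> > 0" using s by (simp add: \<tau>_def)
    have sq: "sqrt \<tau> * sqrt \<tau> = \<tau>" using \<tau> by simp
    have "(?q has_real_derivative ((- 2) * sqrt \<tau> - (1 - 2 * s) * ((1 - 2 * s) * (inverse (sqrt \<tau>) / 2))) / (sqrt \<tau> * sqrt \<tau>)) (at s)"
    proof -
      have "((\<lambda>s. s * (1 - s)) has_real_derivative 1 - 2 * s) (at s)"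
        by (auto intro!: derivative_eq_intros)
      from DERIV_chain2[OF DERIV_real_sqrt this] \<tau>
      have 1: "((\<lambda>s. sqrt (s * (1 - s))) has_real_derivative (1 - 2 * s) * (inverse (sqrt \<tau>) / 2)) (at s)"
        unfolding \<tau>_def by (simp only: mult.commute)
      have 2: "((\<lambda>s. 1 - 2 * s) has_real_derivative - 2) (at s)"
        by (auto intro!: derivative_eq_intros)
      show ?thesis
        using DERIV_divide[OF 2 1] \<tau> unfolding \<tau>_def[symmetric] by simp
    qed
    \<comment> \<open>The numerator collapses because \<open>4 * \<tau>\<close> and the square of
      \<open>1 - 2 * s\<close> add up to 1.\<close>
    moreover have "((- 2) * sqrt \<tau> - (1 - 2 * s) * ((1 - 2 * s) * (inverse (sqrt \<tau>) / 2))) / (sqrt \<tau> * sqrt \<tau>) = - 1 / (2 * (\<tau> * sqrt \<tau>))"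
    proof -
      have "(- 2) * sqrt \<tau> - (1 - 2 * s) * ((1 - 2 * s) * (inverse (sqrt \<tau>) / 2)) = ((- 4) * (sqrt \<tau> * sqrt \<tau>) - (1 - 2 * s) * (1 - 2 * s)) / (2 * sqrt \<tau>)"
        using \<tau> by (simp add: field_simps del: real_sqrt_mult_self)
      also have "(- 4) * (sqrt \<tau> * sqrt \<tau>) - (1 - 2 * s) * (1 - 2 * s) = - 1"
        unfolding sq by (simp add: \<tau>_def algebra_simps)
      finally show ?thesis unfolding sq by simp
    qed
    ultimately have q: "(?q has_real_derivative - 1 / (2 * (\<tau> * sqrt \<tau>))) (at s)" by simp
    have "(?F has_real_derivative ?c * (0 - 2 / sqrt pi * exp (- (v * ?q s / sqrt 2)\<^sup>2)
       * (v * (- 1 / (2 * (\<tau> * sqrt \<tau>))) / sqrt 2))) (at s)"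
      by (intro DERIV_cmult DERIV_diff DERIV_const erf_DERIV_chain DERIV_cdivide q)
    moreover have "?c * (0 - 2 / sqrt pi * exp (- (v * ?q s / sqrt 2)\<^sup>2)
       * (v * (- 1 / (2 * (\<tau> * sqrt \<tau>))) / sqrt 2)) = bridge_density s v"
    proof -
      have "(v * ?q s / sqrt 2)\<^sup>2 = v\<^sup>2 * (1 - 2 * s)\<^sup>2 / (2 * \<tau>)"
        using \<tau> unfolding \<tau>_def[symmetric] by (simp add: power_divide power_mult_distrib)
      also have "(1 - 2 * s)\<^sup>2 = 1 - 4 * \<tau>" by (simp add: \<tau>_def power2_eq_square algebra_simps)
      also have "v\<^sup>2 * (1 - 4 * \<tau>) / (2 * \<tau>) = v\<^sup>2 / (2 * \<tau>) - 2 * v\<^sup>2"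
        using \<tau> by (simp add: field_simps)
      finally have e: "exp (- (v * ?q s / sqrt 2)\<^sup>2) = exp (- v\<^sup>2 / (2 * \<tau>)) / exp (- 2 * v\<^sup>2)"
        by (simp add: exp_diff[symmetric])
      have k: "2 / (sqrt pi * sqrt 2) = sqrt (2 / pi)"
        by (simp add: real_sqrt_divide field_simps)
      have "?c * (0 - 2 / sqrt pi * (exp (- v\<^sup>2 / (2 * \<tau>)) / exp (- 2 * v\<^sup>2)) * (v * (- 1 / (2 * (\<tau> * sqrt \<tau>))) / sqrt 2))
         = 2 / (sqrt pi * sqrt 2) * (v\<^sup>2 * exp (- v\<^sup>2 / (2 * \<tau>)) / (\<tau> * sqrt \<tau>))"
        using \<tau> by (simp add: field_simps power2_eq_square)
      also have "\<dots> = bridge_density s v"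
        unfolding k bridge_density_def \<tau>_def[symmetric] powr_3_2[OF \<tau>] mult.assoc by simp
      finally show ?thesis unfolding e .
    qed
    ultimately show "(?F has_real_derivative bridge_density s v) (at s)" by simp
    show "isCont (\<lambda>s. bridge_density s v) s"
      unfolding bridge_density_def using s by (intro continuous_intros) auto
    show "0 \<le> bridge_density s v" using s by (rule bridge_density_nonneg)
  next
    have "filterlim (\<lambda>s. v * ?q s / sqrt 2) at_top (at_right 0)"
      using v by real_asymp
    from filterlim_compose[OF erf_tendsto_1 this]
    show "(?F \<longlongrightarrow> ?c * (1 - 1)) (at_right 0)" by (intro tendsto_intros)
    show "(?F \<longlongrightarrow> ?c * (1 - L)) (at_left T)" using L by (intro tendsto_intros)
  qed (use T in auto)
  then show ?thesis by simp
qed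

lemma bridge_density_integral:
  assumes "0 < v" "0 < t" "t < 1"
  shows "(\<integral>\<^sup>+ s. ennreal (bridge_density s v) * indicator {0<..<t} s \<partial>lborel) = ennreal (bridge_argmax t v)"
proof -
  let ?f = "\<lambda>s. erf (v * ((1 - 2 * s) / sqrt (s * (1 - s))) / sqrt 2)"
  have "isCont ?f t"
    using assms by (intro continuous_intros) auto
  then have "(?f \<longlongrightarrow> ?f t) (at_left t)"
    unfolding isCont_def by (rule tendsto_within_subset) auto
  moreover have "v * ((1 - 2 * t) / sqrt (t * (1 - t))) / sqrt 2 = v * (1 - 2 * t) / sqrt (2 * (t * (1 - t)))"
    by (simp add: real_sqrt_mult)
  ultimately show ?thesis
    using bridge_density_integral_aux[of v t "?f t"] assms by (simp only: bridge_argmax_def less_imp_le)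
qed

lemma bridge_density_total:
  assumes "0 < v"
  shows "(\<integral>\<^sup>+ s. ennreal (bridge_density s v) * indicator {0<..<1} s \<partial>lborel) = ennreal (4 * v * exp (- 2 * v\<^sup>2))"
proof -
  have "filterlim (\<lambda>s. v * ((1 - 2 * s) / sqrt (s * (1 - s))) / sqrt 2) at_bot (at_left 1)"
    using assms by real_asymp
  from filterlim_compose[OF erf_tendsto_minus_1 this]
  show ?thesis using bridge_density_integral_aux[of v 1 "- 1"] assms by simp
qed

section \<open>From kernels to laws of pairs of maxima\<close>

definition sup_density :: "(real \<Rightarrow> real \<Rightarrow> real \<Rightarrow> ennreal) \<Rightarrow> real \<Rightarrow> real \<times> real \<Rightarrow> ennreal" where
  "sup_density k t p = (\<integral>\<^sup>+ y. before_kernel t (fst p) y * k t (snd p) y \<partial>lborel)"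

lemma sup_density_measurable [measurable]:
  assumes [measurable]: "(\<lambda>p. k t (fst p) (snd p)) \<in> borel_measurable (borel \<Otimes>\<^sub>M borel)"
  shows "sup_density k t \<in> borel_measurable (borel \<Otimes>\<^sub>M borel)"
proof -
  have [measurable]: "(\<lambda>w. before_kernel t (fst (fst w)) (snd w)) \<in> borel_measurable ((borel \<Otimes>\<^sub>M borel) \<Otimes>\<^sub>M lborel)"
    "(\<lambda>w. k t (snd (fst w)) (snd w)) \<in> borel_measurable ((borel \<Otimes>\<^sub>M borel) \<Otimes>\<^sub>M lborel)"
    using measurable_compose[OF _ before_kernel_measurable2, of "\<lambda>w. (fst (fst w), snd w)" "(borel \<Otimes>\<^sub>M borel) \<Otimes>\<^sub>M lborel" t]
      measurable_compose[OF _ assms, of "\<lambda>w. (snd (fst w), snd w)" "(borel \<Otimes>\<^sub>M borel) \<Otimes>\<^sub>M lborel"] by auto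
  show ?thesis unfolding sup_density_def[abs_def] by measurable
qed

text \<open>With \<open>b = v\<close> this is the density at \<open>v\<close> of the maximum before
  \<open>t\<close>, restricted to the event that the maximum after \<open>t\<close> is no
  larger.\<close>

lemma sup_density_inner:
  assumes [measurable]: "(\<lambda>p. k t (fst p) (snd p)) \<in> borel_measurable (borel \<Otimes>\<^sub>M borel)"
    and k: "\<And>y. (\<integral>\<^sup>+ u. k t u y * indicator {..b} u \<partial>lborel) = C y"
  shows "(\<integral>\<^sup>+ u. sup_density k t (v, u) * indicator {..b} u \<partial>lborel) = (\<integral>\<^sup>+ y. before_kernel t v y * C y \<partial>lborel)"
proof -
  have [measurable]: "before_kernel t v \<in> borel_measurable borel"
    using measurable_compose[OF _ before_kernel_measurable2, of "\<lambda>y. (v, y)" borel t] by simp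
  have [measurable]: "(\<lambda>y. k t u y) \<in> borel_measurable borel" "(\<lambda>u. k t u y) \<in> borel_measurable borel" for u y
    using measurable_compose[OF _ assms(1), of "\<lambda>y. (u, y)" borel] measurable_compose[OF _ assms(1), of "\<lambda>u. (u, y)" borel] by simp_all
  have [measurable]: "(\<lambda>x. k t (snd x) (fst x)) \<in> borel_measurable (borel \<Otimes>\<^sub>M borel)"
    using measurable_compose[OF _ assms(1), of "\<lambda>x. (snd x, fst x)" "borel \<Otimes>\<^sub>M borel"] by simp
  have "(\<integral>\<^sup>+ u. sup_density k t (v, u) * indicator {..b} u \<partial>lborel)
     = (\<integral>\<^sup>+ u. \<integral>\<^sup>+ y. before_kernel t v y * (k t u y * indicator {..b} u) \<partial>lborel \<partial>lborel)"
    unfolding sup_density_def by (simp add: nn_integral_multc[symmetric] mult.assoc)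
  also have "\<dots> = (\<integral>\<^sup>+ y. \<integral>\<^sup>+ u. before_kernel t v y * (k t u y * indicator {..b} u) \<partial>lborel \<partial>lborel)"
    by (rule lborel_pair.Fubini') measurable
  also have "\<dots> = (\<integral>\<^sup>+ y. before_kernel t v y * C y \<partial>lborel)"
    by (simp add: nn_integral_cmult k)
  finally show ?thesis .
qed

text \<open>Given the position \<open>y\<close> at time \<open>t\<close>, the stretches before and
  after \<open>t\<close> are independent, so \<open>sup_density\<close> integrates a product of two
  kernels over \<open>y\<close>. Tonelli lets each kernel be integrated over its own level
  first.\<close>

lemma sup_density_cdf:
  assumes [measurable]: "(\<lambda>p. k t (fst p) (snd p)) \<in> borel_measurable (borel \<Otimes>\<^sub>M borel)"
    and k: "\<And>y. (\<integral>\<^sup>+ u. k t u y * indicator {..b} u \<partial>lborel) = C y"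
    and [measurable]: "C \<in> borel_measurable borel" and t: "0 < t"
  shows "(\<integral>\<^sup>+ p. sup_density k t p * indicator {..(a, b)} p \<partial>lborel)
    = (\<integral>\<^sup>+ y. ennreal (refl_kernel a t 0 y) * indicator {..a} y * indicator {0..} a * C y \<partial>lborel)"
proof -
  have [measurable]: "sup_density k t \<in> borel_measurable (borel \<Otimes>\<^sub>M borel)" by measurable
  have [measurable]: "(\<lambda>v. before_kernel t v y) \<in> borel_measurable borel" for y
    using measurable_compose[OF _ before_kernel_measurable2, of "\<lambda>v. (v, y)" borel t] by simp
  have [measurable]: "(\<lambda>x. before_kernel t (snd x) (fst x)) \<in> borel_measurable (borel \<Otimes>\<^sub>M borel)"
    using measurable_compose[OF _ before_kernel_measurable2, of "\<lambda>x. (snd x, fst x)" "borel \<Otimes>\<^sub>M borel" t] by simp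
  have inner: "(\<integral>\<^sup>+ u. sup_density k t (v, u) * indicator {..b} u \<partial>lborel) = (\<integral>\<^sup>+ y. before_kernel t v y * C y \<partial>lborel)" for v
    by (rule sup_density_inner[of k t, OF assms(1) k])
  have "(\<integral>\<^sup>+ p. sup_density k t p * indicator {..(a, b)} p \<partial>lborel)
    = (\<integral>\<^sup>+ p. sup_density k t p * indicator {..a} (fst p) * indicator {..b} (snd p) \<partial>(lborel \<Otimes>\<^sub>M lborel))"
    unfolding lborel_prod by (intro nn_integral_cong) (auto split: split_indicator)
  also have "\<dots> = (\<integral>\<^sup>+ v. \<integral>\<^sup>+ u. sup_density k t (v, u) * indicator {..a} v * indicator {..b} u \<partial>lborel \<partial>lborel)"
    by (subst lborel.nn_integral_fst[symmetric]) auto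
  also have "\<dots> = (\<integral>\<^sup>+ v. (\<integral>\<^sup>+ u. sup_density k t (v, u) * indicator {..b} u \<partial>lborel) * indicator {..a} v \<partial>lborel)"
    by (intro nn_integral_cong) (auto split: split_indicator)
  also have "\<dots> = (\<integral>\<^sup>+ v. \<integral>\<^sup>+ y. before_kernel t v y * indicator {..a} v * C y \<partial>lborel \<partial>lborel)"
    unfolding inner
    by (intro nn_integral_cong) (auto split: split_indicator)
  also have "\<dots> = (\<integral>\<^sup>+ y. \<integral>\<^sup>+ v. before_kernel t v y * indicator {..a} v * C y \<partial>lborel \<partial>lborel)"
    by (rule lborel_pair.Fubini') measurable
  also have "\<dots> = (\<integral>\<^sup>+ y. ennreal (refl_kernel a t 0 y) * indicator {..a} y * indicator {0..} a * C y \<partial>lborel)"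
    by (simp add: nn_integral_multc before_kernel_integral[OF t])
  finally show ?thesis .
qed

text \<open>The supremum is taken in \<open>ereal\<close>, so that over a countable set it is
  measurable on the whole product space, as the transfer of independence requires.
  \<open>real_of_ereal\<close> sends infinite suprema to 0; for nonempty \<open>D\<close> within
  \<open>[0, 1]\<close> continuous paths never meet this default.\<close>

definition path_sup :: "'b set \<Rightarrow> ('b \<Rightarrow> real) \<Rightarrow> real" where
  "path_sup D x = real_of_ereal (SUP s\<in>D. ereal (x s))"

lemma path_sup_measurable:
  assumes "countable D" "D \<subseteq> I"
  shows "path_sup D \<in> borel_measurable (\<Pi>\<^sub>M s\<in>I. borel)"
  unfolding path_sup_def[abs_def] using assms
  by (intro borel_measurable_real_of_ereal borel_measurable_SUP borel_measurable_ereal measurable_component_singleton) auto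

lemma path_sup_le_iff:
  assumes "D \<noteq> {}" "bdd_above (x ` D)"
  shows "path_sup D x \<le> a \<longleftrightarrow> (\<forall>s\<in>D. x s \<le> a)"
proof -
  obtain c where c: "\<And>s. s \<in> D \<Longrightarrow> x s \<le> c" using assms(2) by (auto simp: bdd_above_def)
  obtain d where d: "d \<in> D" using assms(1) by auto
  let ?S = "SUP s\<in>D. ereal (x s)"
  have "?S \<le> ereal c" using c by (auto intro!: SUP_least)
  moreover have "ereal (x d) \<le> ?S" using d by (rule SUP_upper)
  ultimately obtain r where r: "?S = ereal r" by (cases ?S) auto
  have "path_sup D x \<le> a \<longleftrightarrow> ?S \<le> ereal a" unfolding path_sup_def r by simp
  also have "\<dots> \<longleftrightarrow> (\<forall>s\<in>D. x s \<le> a)" by (simp add: SUP_le_iff)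
  finally show ?thesis .
qed

text \<open>Lower-left quadrants are stable under intersection and generate the Borel sets of the
  plane.\<close>

lemma distr_eq_density_prod:
  assumes M: "prob_space M" and X [measurable]: "X \<in> borel_measurable M" "Y \<in> borel_measurable M"
    and f [measurable]: "f \<in> borel_measurable (borel \<Otimes>\<^sub>M borel)"
    and eq: "\<And>a b. emeasure M {w \<in> space M. X w \<le> a \<and> Y w \<le> b} = (\<integral>\<^sup>+ p. f p * indicator {..(a, b)} p \<partial>lborel)"
  shows "distr M borel (\<lambda>w. (X w, Y w)) = density lborel (f :: real \<times> real \<Rightarrow> ennreal)"
proof -
  interpret prob_space M by fact
  have [measurable]: "f \<in> borel_measurable borel" using f by (simp add: borel_prod)
  have [measurable]: "(\<lambda>w. (X w, Y w)) \<in> borel_measurable M"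
    using X by (simp add: borel_prod[symmetric])
  have e: "emeasure (distr M borel (\<lambda>w. (X w, Y w))) {..p} = emeasure M {w \<in> space M. X w \<le> fst p \<and> Y w \<le> snd p}" for p
    by (subst emeasure_distr) (auto intro!: arg_cong[where f = "emeasure M"] simp: less_eq_prod_def)
  show ?thesis
  proof (rule measure_eqI_generator_eq[where E = "range (\<lambda>a::real \<times> real. {..a})" and \<Omega> = UNIV and A = "\<lambda>n::nat. {..(real n, real n)}"])
    show "Int_stable (range (\<lambda>a::real \<times> real. {..a}))"
    proof (rule Int_stableI, clarsimp)
      fix a b c d :: real
      show "{..(a, b)} \<inter> {..(c, d)} \<in> range atMost"
        by (rule image_eqI[of _ _ "(min a c, min b d)"]) auto
    qed
    show "sets (distr M borel (\<lambda>w. (X w, Y w))) = sigma_sets UNIV (range (\<lambda>a::real \<times> real. {..a}))"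
      "sets (density lborel f) = sigma_sets UNIV (range (\<lambda>a::real \<times> real. {..a}))"
      by (simp_all add: borel_eq_atMost)
    show "(\<Union>n. {..(real n, real n)}) = (UNIV :: (real \<times> real) set)"
    proof -
      have "\<exists>n. p \<le> (real n, real n)" for p :: "real \<times> real"
      proof -
        obtain n where "max (fst p) (snd p) \<le> real n" using real_arch_simple by blast
        then show ?thesis by (intro exI[of _ n]) (auto simp: less_eq_prod_def)
      qed
      then show ?thesis by auto
    qed
    show "range (\<lambda>n::nat. {..(real n, real n)}) \<subseteq> range (\<lambda>a. {..a})" by auto
    show "emeasure (distr M borel (\<lambda>w. (X w, Y w))) {..(real i, real i)} \<noteq> \<infinity>" for i
      by (simp add: e)
    fix S :: "(real \<times> real) set" assume "S \<in> range (\<lambda>a. {..a})"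
    then obtain a b where S: "S = {..(a, b)}" by auto
    show "emeasure (distr M borel (\<lambda>w. (X w, Y w))) S = emeasure (density lborel f) S"
      unfolding S e by (simp add: emeasure_density eq)
  qed auto
qed

section \<open>Independent competitors\<close>

lemma AE_lborel_prod_neq:
  fixes z :: real
  shows "AE p in lborel. fst p \<noteq> z \<and> snd p \<noteq> z"
proof -
  have "emeasure lborel ({z} \<times> (UNIV :: real set)) = 0" "emeasure lborel ((UNIV :: real set) \<times> {z}) = 0"
    by (simp_all add: lborel_prod[symmetric] lborel.emeasure_pair_measure_Times)
  then have "AE p in lborel. p \<notin> {z} \<times> (UNIV :: real set)" "AE p in lborel. p \<notin> (UNIV :: real set) \<times> {z}"
    by (auto intro!: AE_not_in null_setsI borel_closed closed_Times)
  then show ?thesis by eventually_elim auto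
qed

abbreviation weighted_integral :: "(real \<Rightarrow> real) \<Rightarrow> (real \<Rightarrow> real) \<Rightarrow> ennreal" where
  "weighted_integral L E \<equiv> \<integral>\<^sup>+ v. ennreal (L v) * ennreal (E v) * indicator {0<..} v \<partial>lborel"

lemma rel_quadrant_borel:
  fixes z :: real
  assumes "r = (<) \<or> r = (\<le>)"
  shows "{p. r (fst p) z \<and> r (snd p) z} \<in> sets borel"
proof -
  have "{p. fst p < z \<and> snd p < z} = {..<z} \<times> {..<z}" "{p. fst p \<le> z \<and> snd p \<le> z} = {..z} \<times> {..z}" by auto
  then have "{p. fst p < z \<and> snd p < z} \<in> sets borel" "{p. fst p \<le> z \<and> snd p \<le> z} \<in> sets borel"
    by (simp_all add: borel_open open_Times borel_closed closed_Times)
  with assms show ?thesis by auto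
qed

text \<open>Abstracts from motions and bridges: competitor \<open>k\<close> has maximum
  \<open>A k\<close> before the fixed time and \<open>C k\<close> after it, \<open>f k\<close> is
  their joint density, \<open>G k\<close> the distribution function of the overall maximum, and
  \<open>g k\<close> the density of that maximum when attained before the fixed time. The set left
  after removing any \<open>k\<close> is nonempty so that the maximum over the rivals makes
  sense.\<close>

locale competition = prob_space M for M :: "'a measure" +
  fixes K :: "'k set" and A C :: "'k \<Rightarrow> 'a \<Rightarrow> real"
    and f :: "'k \<Rightarrow> real \<times> real \<Rightarrow> ennreal" and g G :: "'k \<Rightarrow> real \<Rightarrow> real"
  assumes K: "finite K" "\<And>k. K - {k} \<noteq> {}"
    and indep: "indep_vars (\<lambda>_. borel) (\<lambda>k w. (A k w, C k w)) K"
    and law: "\<And>k. k \<in> K \<Longrightarrow> distr M borel (\<lambda>w. (A k w, C k w)) = density lborel (f k)"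
    and f_measurable: "\<And>k. f k \<in> borel_measurable (borel \<Otimes>\<^sub>M borel)"
    and cdf: "\<And>k z. k \<in> K \<Longrightarrow> 0 \<le> z \<Longrightarrow> emeasure M {w \<in> space M. A k w \<le> z \<and> C k w \<le> z} = ennreal (G k z)"
    and cdf_nonneg: "\<And>k z. k \<in> K \<Longrightarrow> 0 \<le> z \<Longrightarrow> 0 \<le> G k z"
    and inner: "\<And>k v. k \<in> K \<Longrightarrow> 0 < v \<Longrightarrow> (\<integral>\<^sup>+ u. f k (v, u) * indicator {..v} u \<partial>lborel) = ennreal (g k v)"
    and zero: "\<And>k v u. k \<in> K \<Longrightarrow> v < 0 \<Longrightarrow> f k (v, u) = 0"
begin

lemma f_measurable' [measurable]: "f k \<in> borel_measurable borel"
  using f_measurable[of k] by (simp add: borel_prod)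

lemma pair_measurable: "k \<in> K \<Longrightarrow> (\<lambda>w. (A k w, C k w)) \<in> borel_measurable M"
  using indep unfolding indep_vars_def by auto

lemma A_measurable: "k \<in> K \<Longrightarrow> A k \<in> borel_measurable M"
  using measurable_compose[OF pair_measurable[of k], of fst] borel_measurable_continuous_onI[of fst]
  by (simp add: continuous_on_fst continuous_on_id)

lemma C_measurable: "k \<in> K \<Longrightarrow> C k \<in> borel_measurable M"
  using measurable_compose[OF pair_measurable[of k], of snd] borel_measurable_continuous_onI[of snd]
  by (simp add: continuous_on_snd continuous_on_id)

text \<open>The pair has a density, so the lines bounding a quadrant are null. Treating
  \<open><\<close> and \<open>\<le>\<close> uniformly through \<open>r\<close> is what later shows
  that ties are null.\<close>

lemma cdf_rel:
  assumes k: "k \<in> K" and z: "0 \<le> z" and r: "r = (<) \<or> r = ((\<le>) :: real \<Rightarrow> real \<Rightarrow> bool)"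
  shows "emeasure M {w \<in> space M. r (A k w) z \<and> r (C k w) z} = ennreal (G k z)"
proof -
  have S: "{p. fst p < z \<and> snd p < z} \<in> sets (borel :: (real \<times> real) measure)" "{p. fst p \<le> z \<and> snd p \<le> z} \<in> sets (borel :: (real \<times> real) measure)"
    using rel_quadrant_borel[of "(<)" z] rel_quadrant_borel[of "(\<le>)" z] by simp_all
  have E: "emeasure M {w \<in> space M. (A k w, C k w) \<in> S} = (\<integral>\<^sup>+ p. f k p * indicator S p \<partial>lborel)" if "S \<in> sets borel" for S
  proof -
    have "emeasure M {w \<in> space M. (A k w, C k w) \<in> S} = emeasure (distr M borel (\<lambda>w. (A k w, C k w))) S"
      using that pair_measurable[OF k] by (subst emeasure_distr) (auto intro!: arg_cong[where f = "emeasure M"])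
    also have "\<dots> = (\<integral>\<^sup>+ p. f k p * indicator S p \<partial>lborel)"
      unfolding law[OF k] using that by (subst emeasure_density) auto
    finally show ?thesis .
  qed
  have "(\<integral>\<^sup>+ p. f k p * indicator {p. fst p < z \<and> snd p < z} p \<partial>lborel)
     = (\<integral>\<^sup>+ p. f k p * indicator {p. fst p \<le> z \<and> snd p \<le> z} p \<partial>lborel)"
  proof (rule nn_integral_cong_AE)
    show "AE p in lborel. f k p * indicator {p. fst p < z \<and> snd p < z} p = f k p * indicator {p. fst p \<le> z \<and> snd p \<le> z} p"
      using AE_lborel_prod_neq[of z] by eventually_elim (auto split: split_indicator)
  qed
  then have "emeasure M {w \<in> space M. A k w < z \<and> C k w < z} = emeasure M {w \<in> space M. A k w \<le> z \<and> C k w \<le> z}"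
    using E[OF S(1)] E[OF S(2)] by simp
  with r cdf[OF k z] show ?thesis by auto
qed

definition rest :: "'k \<Rightarrow> 'a \<Rightarrow> real" where
  "rest k w = Max ((\<lambda>j. max (A j w) (C j w)) ` (K - {k}))"

lemma rest_rel:
  assumes r: "r = (<) \<or> r = ((\<le>) :: real \<Rightarrow> real \<Rightarrow> bool)"
  shows "r (rest k w) z \<longleftrightarrow> (\<forall>j\<in>K - {k}. r (A j w) z \<and> r (C j w) z)"
  using r K unfolding rest_def by (auto simp: Max_less_iff Max_le_iff)

lemma rest_cdf:
  assumes z: "0 \<le> z" and r: "r = (<) \<or> r = ((\<le>) :: real \<Rightarrow> real \<Rightarrow> bool)"
  shows "emeasure M {w \<in> space M. r (rest k w) z} = ennreal (\<Prod>j\<in>K - {k}. G j z)"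
proof -
  let ?S = "{p. r (fst p) z \<and> r (snd p) z}"
  have S: "?S \<in> sets (borel :: (real \<times> real) measure)"
    using r by (rule rel_quadrant_borel)
  have "{w \<in> space M. r (rest k w) z} = (\<Inter>j\<in>K - {k}. (\<lambda>w. (A j w, C j w)) -` ?S \<inter> space M)"
    unfolding rest_rel[OF r] using K(2)[of k] by auto
  also have "prob \<dots> = (\<Prod>j\<in>K - {k}. prob ((\<lambda>w. (A j w, C j w)) -` ?S \<inter> space M))"
    using K S by (intro indep_varsD[OF indep]) auto
  also have "\<dots> = (\<Prod>j\<in>K - {k}. G j z)"
  proof (rule prod.cong)
    fix j assume j: "j \<in> K - {k}"
    have "(\<lambda>w. (A j w, C j w)) -` ?S \<inter> space M = {w \<in> space M. r (A j w) z \<and> r (C j w) z}" by auto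
    then show "prob ((\<lambda>w. (A j w, C j w)) -` ?S \<inter> space M) = G j z"
      using cdf_rel[OF _ z r, of j] cdf_nonneg[OF _ z, of j] j by (simp add: measure_def)
  qed simp
  finally show ?thesis by (simp add: emeasure_eq_measure)
qed

lemma rest_measurable: "rest k \<in> borel_measurable M"
  unfolding rest_def[abs_def] using K A_measurable C_measurable
  by (intro borel_measurable_Max borel_measurable_max) auto

text \<open>The second component \<open>0\<close> is a dummy: \<open>indep_var\<close> relates variables of the same type only.\<close>

lemma pair_rest_indep:
  assumes k: "k \<in> K"
  shows "indep_var borel (\<lambda>w. (A k w, C k w)) borel (\<lambda>w. (rest k w, 0))"
proof -
  let ?P = "\<lambda>k w. (A k w, C k w)"
  let ?max = "\<lambda>v. Max ((\<lambda>j. max (fst (v j)) (snd (v j))) ` (K - {k})) :: real"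
  let ?m = "\<lambda>v. (?max v, 0 :: real)"
  have "indep_var (PiM {k} (\<lambda>_. borel)) (\<lambda>w. restrict (\<lambda>i. ?P i w) {k}) (PiM (K - {k}) (\<lambda>_. borel)) (\<lambda>w. restrict (\<lambda>i. ?P i w) (K - {k}))"
    using k by (intro indep_var_restrict[OF indep]) auto
  moreover have "(\<lambda>v. v k) \<in> measurable (PiM {k} (\<lambda>_. borel)) borel" by simp
  moreover have "?max \<in> borel_measurable (PiM (K - {k}) (\<lambda>_. borel))"
  proof (intro borel_measurable_Max borel_measurable_max)
    fix j assume j: "j \<in> K - {k}"
    have "fst \<in> borel_measurable (borel :: (real \<times> real) measure)" "snd \<in> borel_measurable (borel :: (real \<times> real) measure)"
      by (simp_all add: borel_prod[symmetric])
    then show "(\<lambda>v. fst (v j)) \<in> borel_measurable (PiM (K - {k}) (\<lambda>_. borel :: (real \<times> real) measure))"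
      "(\<lambda>v. snd (v j)) \<in> borel_measurable (PiM (K - {k}) (\<lambda>_. borel :: (real \<times> real) measure))"
      using j by (auto intro: measurable_compose[OF measurable_component_singleton])
  qed (use K in auto)
  then have "?m \<in> borel_measurable (PiM (K - {k}) (\<lambda>_. borel))"
    unfolding borel_prod[symmetric] by measurable
  ultimately have "indep_var borel ((\<lambda>v. v k) \<circ> (\<lambda>w. restrict (\<lambda>i. ?P i w) {k})) borel (?m \<circ> (\<lambda>w. restrict (\<lambda>i. ?P i w) (K - {k})))"
    by (rule indep_var_compose)
  also have "(\<lambda>v. v k) \<circ> (\<lambda>w. restrict (\<lambda>i. ?P i w) {k}) = ?P k" by auto
  also have "?m \<circ> (\<lambda>w. restrict (\<lambda>i. ?P i w) (K - {k})) = (\<lambda>w. (rest k w, 0))"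
    unfolding rest_def comp_def by (auto intro!: ext arg_cong[where f = Max] image_cong)
  finally show ?thesis .
qed

text \<open>The two choices of \<open>r\<close> bracket the event of interest: an argmax before the
  fixed time forces a weak winner, and a strict winner forces every argmax to lie before it.\<close>

definition winner :: "(real \<Rightarrow> real \<Rightarrow> bool) \<Rightarrow> 'k \<Rightarrow> 'a \<Rightarrow> bool" where
  "winner r k w \<longleftrightarrow> r (C k w) (A k w) \<and> (\<forall>j\<in>K - {k}. r (A j w) (A k w) \<and> r (C j w) (A k w))"

lemma winner_measurable:
  assumes "k \<in> K" "r = (<) \<or> r = ((\<le>) :: real \<Rightarrow> real \<Rightarrow> bool)"
  shows "{w \<in> space M. winner r k w} \<in> sets M"
proof -
  note [measurable] = A_measurable[OF assms(1)] C_measurable[OF assms(1)] rest_measurable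
  show ?thesis
    using assms(2) unfolding winner_def rest_rel[OF assms(2), symmetric] by auto
qed

text \<open>The pair of competitor \<open>k\<close> is independent of the maximum of its rivals, so
  Fubini integrates the rivals' distribution function against the law of the pair. The value is the
  same for both relations.\<close>

lemma winner_prob:
  assumes k: "k \<in> K" and r: "r = (<) \<or> r = ((\<le>) :: real \<Rightarrow> real \<Rightarrow> bool)"
  shows "emeasure M {w \<in> space M. winner r k w}
    = weighted_integral (g k) (\<lambda>v. \<Prod>j\<in>K - {k}. G j v)"
proof -
  let ?P = "\<lambda>w. (A k w, C k w)"
  let ?DP = "distr M borel ?P" and ?DZ = "distr M borel (\<lambda>w. (rest k w, 0 :: real))"
  note [measurable] = pair_measurable[OF k] rest_measurable
  have [measurable]: "(\<lambda>w. (rest k w, 0 :: real)) \<in> borel_measurable M"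
    unfolding borel_prod[symmetric] by measurable
  interpret DZ: prob_space ?DZ by (rule prob_space_distr) measurable
  define S where "S = {q :: (real \<times> real) \<times> real \<times> real. r (snd (fst q)) (fst (fst q)) \<and> r (fst (snd q)) (fst (fst q))}"
  have fs: "fst \<in> borel_measurable (borel :: (real \<times> real) measure)" "snd \<in> borel_measurable (borel :: (real \<times> real) measure)"
    by (simp_all add: borel_prod[symmetric])
  have S: "S \<in> sets (borel \<Otimes>\<^sub>M borel)"
  proof -
    have [measurable]: "(\<lambda>q. fst (fst q)) \<in> borel_measurable ((borel :: (real \<times> real) measure) \<Otimes>\<^sub>M (borel :: (real \<times> real) measure))"
       "(\<lambda>q. snd (fst q)) \<in> borel_measurable ((borel :: (real \<times> real) measure) \<Otimes>\<^sub>M (borel :: (real \<times> real) measure))"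
       "(\<lambda>q. fst (snd q)) \<in> borel_measurable ((borel :: (real \<times> real) measure) \<Otimes>\<^sub>M (borel :: (real \<times> real) measure))"
      by (auto intro: measurable_compose[OF measurable_fst fs(1)] measurable_compose[OF measurable_fst fs(2)] measurable_compose[OF measurable_snd fs(1)])
    have "{q \<in> space ((borel :: (real \<times> real) measure) \<Otimes>\<^sub>M (borel :: (real \<times> real) measure)). r (snd (fst q)) (fst (fst q)) \<and> r (fst (snd q)) (fst (fst q))} \<in> sets (borel \<Otimes>\<^sub>M borel)"
      using r by (elim disjE) (simp_all only:, measurable)
    then show ?thesis unfolding S_def by (simp add: space_pair_measure)
  qed
  have dist: "?DP \<Otimes>\<^sub>M ?DZ = distr M (borel \<Otimes>\<^sub>M borel) (\<lambda>w. (?P w, (rest k w, 0)))"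
    using pair_rest_indep[OF k] by (simp add: indep_var_distribution_eq)
  have "emeasure M {w \<in> space M. winner r k w} = emeasure (?DP \<Otimes>\<^sub>M ?DZ) S"
    unfolding dist using S
    by (subst emeasure_distr)
      (auto intro!: arg_cong[where f = "emeasure M"] simp: S_def winner_def rest_rel[OF r])
  also have "\<dots> = (\<integral>\<^sup>+ p. emeasure ?DZ (Pair p -` S) \<partial>?DP)"
    using S by (intro DZ.emeasure_pair_measure_alt) (simp cong: sets_pair_measure_cong)
  also have "\<dots> = (\<integral>\<^sup>+ p. f k p * emeasure ?DZ (Pair p -` S) \<partial>lborel)"
  proof -
    have "S \<in> sets (borel \<Otimes>\<^sub>M ?DZ)" using S by (simp cong: sets_pair_measure_cong)
    from DZ.measurable_emeasure_Pair[OF this] show ?thesis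
      unfolding law[OF k] by (subst nn_integral_density) auto
  qed
  also have "\<dots> = (\<integral>\<^sup>+ v. \<integral>\<^sup>+ u. f k (v, u) * emeasure ?DZ (Pair (v, u) -` S) \<partial>lborel \<partial>lborel)"
  proof -
    have "S \<in> sets ((borel \<Otimes>\<^sub>M borel) \<Otimes>\<^sub>M ?DZ)" 
    proof -
      have "sets ((borel \<Otimes>\<^sub>M borel) \<Otimes>\<^sub>M ?DZ) = sets ((borel :: (real \<times> real) measure) \<Otimes>\<^sub>M borel)"
        by (rule sets_pair_measure_cong) (simp_all only: borel_prod sets_distr)
      then show ?thesis using S by simp
    qed
    from DZ.measurable_emeasure_Pair[OF this] have [measurable]: "(\<lambda>p. emeasure ?DZ (Pair p -` S)) \<in> borel_measurable (borel \<Otimes>\<^sub>M borel)" .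
    note [measurable] = f_measurable
    show ?thesis
      unfolding lborel_prod[symmetric] by (subst lborel.nn_integral_fst[symmetric]) measurable
  qed
  also have "\<dots> = weighted_integral (g k) (\<lambda>v. \<Prod>j\<in>K - {k}. G j v)"
  proof (rule nn_integral_cong_AE)
    show "AE v in lborel. (\<integral>\<^sup>+ u. f k (v, u) * emeasure ?DZ (Pair (v, u) -` S) \<partial>lborel)
       = ennreal (g k v) * ennreal (\<Prod>j\<in>K - {k}. G j v) * indicator {0<..} v"
      using AE_lborel_singleton[of 0]
    proof eventually_elim
      case (elim v)
      show ?case
      proof (cases "v > 0")
        case True
        have [measurable]: "(\<lambda>u. f k (v, u)) \<in> borel_measurable borel"
          using measurable_compose[OF _ f_measurable, of "\<lambda>u. (v, u)" borel] by simp
        have "(\<integral>\<^sup>+ u. f k (v, u) * emeasure ?DZ (Pair (v, u) -` S) \<partial>lborel)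
          = (\<integral>\<^sup>+ u. (f k (v, u) * indicator {..v} u) * ennreal (\<Prod>j\<in>K - {k}. G j v) \<partial>lborel)"
        proof (rule nn_integral_cong_AE)
          show "AE u in lborel. f k (v, u) * emeasure ?DZ (Pair (v, u) -` S) = (f k (v, u) * indicator {..v} u) * ennreal (\<Prod>j\<in>K - {k}. G j v)"
            \<comment> \<open>At \<open>u = v\<close> the strict and the weak relation disagree, so
              this null set is left out.\<close>
            using AE_lborel_singleton[of v]
          proof eventually_elim
            case (elim u)
            have "emeasure ?DZ (Pair (v, u) -` S) = emeasure M {w \<in> space M. r u v \<and> r (rest k w) v}"
            proof -
              have "Pair (v, u) -` S \<in> sets borel"
                using S by (rule sets_Pair1)
              then show ?thesis
                by (subst emeasure_distr) (auto intro!: arg_cong[where f = "emeasure M"] simp: S_def)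
            qed
            also have "\<dots> = indicator {..v} u * ennreal (\<Prod>j\<in>K - {k}. G j v)"
              using elim r rest_cdf[OF _ r, of v k] True by (cases "u \<le> v") auto
            finally show ?case by (simp add: mult.assoc)
          qed
        qed
        also have "\<dots> = ennreal (g k v) * ennreal (\<Prod>j\<in>K - {k}. G j v)"
          by (subst nn_integral_multc) (auto simp: inner[OF k True])
        finally show ?thesis using True by simp
      next
        case False
        then show ?thesis using elim zero[OF k, of v] by simp
      qed
    qed
  qed
  finally show ?thesis .
qed

text \<open>The strict event is contained in the weak one and has the same finite probability by
  \<open>winner_prob\<close>, so the difference is null. This excludes ties.\<close>

lemma AE_winner_strict: "AE w in M. \<forall>k\<in>K. winner (\<le>) k w \<longrightarrow> winner (<) k w"
proof (subst AE_finite_all[OF K(1)], rule ballI)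
  fix k assume k: "k \<in> K"
  let ?E = "\<lambda>r. {w \<in> space M. winner r k w}"
  have m: "?E (<) \<in> sets M" "?E (\<le>) \<in> sets M"
    using winner_measurable[OF k] by blast+
  have sub: "?E (<) \<subseteq> ?E (\<le>)" unfolding winner_def using less_imp_le by blast
  have eq: "emeasure M (?E (\<le>)) = emeasure M (?E (<))"
    using winner_prob[OF k, of "(<)"] winner_prob[OF k, of "(\<le>)"] by simp
  have "emeasure M (?E (\<le>) - ?E (<)) = emeasure M (?E (\<le>)) - emeasure M (?E (<))"
    using m sub by (intro emeasure_Diff) auto
  also have "\<dots> = 0" unfolding eq by (simp add: emeasure_eq_measure)
  finally have "AE w in M. w \<notin> ?E (\<le>) - ?E (<)"
    using m by (intro AE_not_in null_setsI) auto
  with AE_space show "AE w in M. winner (\<le>) k w \<longrightarrow> winner (<) k w"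
    by eventually_elim auto
qed

text \<open>The event is squeezed between strict and weak winning, which agree almost surely; strict
  winners are unique, so the probabilities add.\<close>

lemma prob_eq_sum_winner:
  assumes S: "S \<in> sets M"
    and lower: "AE w in M. (\<exists>k\<in>K. winner (<) k w) \<longrightarrow> w \<in> S"
    and upper: "AE w in M. w \<in> S \<longrightarrow> (\<exists>k\<in>K. winner (\<le>) k w)"
  shows "emeasure M S = (\<Sum>k\<in>K. weighted_integral (g k) (\<lambda>v. \<Prod>j\<in>K - {k}. G j v))"
proof -
  let ?E = "\<lambda>k. {w \<in> space M. winner (<) k w}"
  have m: "?E k \<in> sets M" if "k \<in> K" for k using winner_measurable[OF that] by blast
  have "emeasure M S = emeasure M (\<Union>k\<in>K. ?E k)"
  proof (rule emeasure_eq_AE)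
    show "AE w in M. w \<in> S \<longleftrightarrow> w \<in> (\<Union>k\<in>K. ?E k)"
      using lower upper AE_winner_strict AE_space by eventually_elim auto
    show "S \<in> sets M" by fact
    show "(\<Union>k\<in>K. ?E k) \<in> sets M" using m K by (intro sets.finite_UN) auto
  qed
  also have "\<dots> = (\<Sum>k\<in>K. emeasure M (?E k))"
  proof (rule sum_emeasure[symmetric])
    show "disjoint_family_on ?E K"
      unfolding disjoint_family_on_def
    proof (intro ballI impI)
      fix i j assume ij: "i \<in> K" "j \<in> K" "i \<noteq> j"
      show "?E i \<inter> ?E j = {}"
      proof safe
        fix w assume "winner (<) i w" "winner (<) j w"
        then have "A j w < A i w" "A i w < A j w" using ij by (auto simp: winner_def)
        then show "w \<in> {}" by simp
      qed
    qed
  qed (use m K in auto)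
  also have "\<dots> = (\<Sum>k\<in>K. weighted_integral (g k) (\<lambda>v. \<Prod>j\<in>K - {k}. G j v))"
    by (intro sum.cong winner_prob) auto
  finally show ?thesis .
qed

end

text \<open>By continuity a bound on a dense set extends to the interval, so the dyadic supremum is
  the true maximum.\<close>

lemma path_sup_closure_le_iff:
  fixes x :: "real \<Rightarrow> real"
  assumes c: "continuous_on {0..1} x" and D: "closure D = {a..b}" "0 \<le> a" "a \<le> b" "b \<le> 1"
  shows "path_sup D x \<le> z \<longleftrightarrow> (\<forall>s\<in>{a..b}. x s \<le> z)"
proof -
  have sub: "{a..b} \<subseteq> {0..1}" using D by simp
  have DI: "D \<subseteq> {a..b}" using closure_subset[of D] D by auto
  have ne: "D \<noteq> {}" using D by auto
  have "compact (x ` {a..b})"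
    using continuous_on_subset[OF c sub] by (intro compact_continuous_image) auto
  then have "bdd_above (x ` {a..b})" by (intro bounded_imp_bdd_above compact_imp_bounded)
  then have "bdd_above (x ` D)" using DI by (meson bdd_above_mono image_mono)
  then have "path_sup D x \<le> z \<longleftrightarrow> (\<forall>s\<in>D. x s \<le> z)" by (rule path_sup_le_iff[OF ne])
  also have "\<dots> \<longleftrightarrow> (\<forall>s\<in>{a..b}. x s \<le> z)"
    using DI continuous_le_on_closure[of D x _ z] continuous_on_subset[OF c sub] D by auto
  finally show ?thesis .
qed

section \<open>The density of the argmax\<close>

text \<open>For \<open>v \<ge> 0\<close> this is the distribution function of the maximum of
  \<open>m\<close> motions and \<open>n\<close> bridges, all independent.\<close>

definition sup_weight :: "nat \<Rightarrow> nat \<Rightarrow> real \<Rightarrow> real" where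
  "sup_weight m n v = erf (v / sqrt 2) ^ m * (1 - exp (- 2 * v\<^sup>2)) ^ n"

lemma sup_weight_measurable [measurable]: "sup_weight m n \<in> borel_measurable borel"
  unfolding sup_weight_def[abs_def] by measurable

lemma sup_weight_nonneg: "0 \<le> v \<Longrightarrow> 0 \<le> sup_weight m n v"
  unfolding sup_weight_def by (intro mult_nonneg_nonneg zero_le_power erf_nonneg) auto

lemma sup_weight_le_1: "0 \<le> v \<Longrightarrow> sup_weight m n v \<le> 1"
  unfolding sup_weight_def by (intro mult_le_one power_le_one zero_le_power erf_nonneg erf_le_1) auto

lemma set_integrable_gauss_moment:
  fixes s :: real
  assumes s: "0 < s" and [measurable]: "h \<in> borel_measurable borel" and h: "\<And>x. 0 \<le> x \<Longrightarrow> \<bar>h x\<bar> \<le> 1"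
  shows "set_integrable lborel {0..} (\<lambda>x. x ^ k * exp (- x\<^sup>2 / (2 * s)) * h x)"
  unfolding set_integrable_def
proof (rule Bochner_Integration.integrable_bound)
  show "integrable lborel (\<lambda>x. sqrt (2 * pi * s) * (normal_density 0 (sqrt s) x * \<bar>x - 0\<bar> ^ k))"
    using s by (intro integrable_mult_right integrable_normal_moment_abs) auto
  show "AE x in lborel. norm (indicator {0..} x *\<^sub>R (x ^ k * exp (- x\<^sup>2 / (2 * s)) * h x))
      \<le> norm (sqrt (2 * pi * s) * (normal_density 0 (sqrt s) x * \<bar>x - 0\<bar> ^ k))"
  proof (rule AE_I2)
    fix x :: real
    have "sqrt (2 * pi * s) * normal_density 0 (sqrt s) x = exp (- x\<^sup>2 / (2 * s))"
      using s by (simp add: normal_density_def)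
    then have e: "sqrt (2 * pi * s) * (normal_density 0 (sqrt s) x * \<bar>x - 0\<bar> ^ k) = \<bar>x\<bar> ^ k * exp (- x\<^sup>2 / (2 * s))"
      by (simp only: mult.assoc[symmetric] diff_0_right mult.commute[of "exp (- x\<^sup>2 / (2 * s))"])
    show "norm (indicator {0..} x *\<^sub>R (x ^ k * exp (- x\<^sup>2 / (2 * s)) * h x))
      \<le> norm (sqrt (2 * pi * s) * (normal_density 0 (sqrt s) x * \<bar>x - 0\<bar> ^ k))"
      unfolding e using h[of x] by (auto simp: abs_mult power_abs mult_left_le split: split_indicator)
  qed
qed measurable

lemma ennreal_set_integral_eq_nn_integral:
  assumes [measurable]: "f \<in> borel_measurable borel" and int: "set_integrable lborel {0..} f" and nonneg: "\<And>x. 0 \<le> x \<Longrightarrow> 0 \<le> f x"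
  shows "ennreal (LBINT x:{0::real..}. f x) = (\<integral>\<^sup>+ x. ennreal (f x) * indicator {0<..} x \<partial>lborel)"
proof -
  have "ennreal (LBINT x:{0..}. f x) = (\<integral>\<^sup>+ x. ennreal (indicator {0..} x *\<^sub>R f x) \<partial>lborel)"
    using int nonneg unfolding set_integrable_def set_lebesgue_integral_def
    by (intro nn_integral_eq_integral[symmetric]) (auto split: split_indicator)
  also have "\<dots> = (\<integral>\<^sup>+ x. ennreal (f x) * indicator {0<..} x \<partial>lborel)"
  proof (rule nn_integral_cong_AE)
    show "AE x in lborel. ennreal (indicator {0..} x *\<^sub>R f x) = ennreal (f x) * indicator {0<..} x"
      using AE_lborel_singleton[of 0] by eventually_elim (auto split: split_indicator)
  qed
  finally show ?thesis .
qed

lemma rho1_nonneg: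
  assumes "0 < s" "s < 1"
  shows "0 \<le> rho1 m n s"
  unfolding rho1_def set_lebesgue_integral_def
  using assms by (intro mult_nonneg_nonneg integral_nonneg) (auto simp: erf_nonneg split: split_indicator)

lemma rho2_nonneg:
  assumes "0 < s" "s < 1"
  shows "0 \<le> rho2 m n s"
  unfolding rho2_def set_lebesgue_integral_def
  using assms by (intro mult_nonneg_nonneg integral_nonneg) (auto simp: erf_nonneg split: split_indicator)

text \<open>The common shape of \<open>rho1\<close> and \<open>rho2\<close>: a constant times a
  Gaussian moment against a weight in \<open>[0, 1]\<close>. Integrability ensures that the
  \<open>LBINT\<close> is a genuine value and not the default 0, so it agrees with the nonnegative
  integral.\<close>

lemma weighted_integral_eq:
  fixes \<sigma> c :: real and N :: nat
  assumes \<sigma>: "0 < \<sigma>" and c: "0 \<le> c"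
    and d: "\<And>x. d x = c * (x ^ k * exp (- x\<^sup>2 / (2 * \<sigma>)))"
    and r: "r = real N * (c * (LBINT x:{0..}. x ^ k * exp (- x\<^sup>2 / (2 * \<sigma>)) * sup_weight i j x))"
  shows "ennreal r = of_nat N * weighted_integral d (sup_weight i j)"
proof -
  let ?f = "\<lambda>x. x ^ k * exp (- x\<^sup>2 / (2 * \<sigma>)) * sup_weight i j x"
  have "ennreal r = of_nat N * (ennreal c * ennreal (LBINT x:{0..}. ?f x))"
    unfolding r by (simp only: ennreal_mult'[OF of_nat_0_le_iff] ennreal_mult'[OF c] ennreal_of_nat_eq_real_of_nat)
  also have "ennreal (LBINT x:{0..}. ?f x) = (\<integral>\<^sup>+ x. ennreal (?f x) * indicator {0<..} x \<partial>lborel)"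
    using \<sigma> by (intro ennreal_set_integral_eq_nn_integral set_integrable_gauss_moment)
      (auto simp: sup_weight_nonneg sup_weight_le_1)
  also have "ennreal c * \<dots> = (\<integral>\<^sup>+ x. ennreal c * (ennreal (?f x) * indicator {0<..} x) \<partial>lborel)"
    by (rule nn_integral_cmult[symmetric]) measurable
  also have "\<dots> = weighted_integral d (sup_weight i j)"
  proof (rule nn_integral_cong)
    fix v :: real
    show "ennreal c * (ennreal (?f v) * indicator {0<..} v) = ennreal (d v) * ennreal (sup_weight i j v) * indicator {0<..} v"
    proof (cases "v > 0")
      case True
      then have "0 \<le> d v" using c by (simp add: d)
      have "ennreal c * ennreal (?f v) = ennreal (d v * sup_weight i j v)"
        unfolding d using c by (simp only: ennreal_mult' mult.assoc)
      also have "\<dots> = ennreal (d v) * ennreal (sup_weight i j v)"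
        using \<open>0 \<le> d v\<close> by (rule ennreal_mult')
      finally show ?thesis using True by simp
    qed simp
  qed
  finally show ?thesis .
qed

lemma rho1_eq_nn_integral:
  assumes s: "0 < s" "s < 1"
  shows "ennreal (rho1 m n s) = of_nat m *
    weighted_integral (motion_density s) (sup_weight (m - 1) n)"
  by (rule weighted_integral_eq[where \<sigma> = s and k = 1 and c = "1 / (pi * s powr (3/2) * sqrt (1 - s))"])
    (use s in \<open>auto simp: motion_density_def rho1_def sup_weight_def mult.assoc\<close>)

lemma rho2_eq_nn_integral:
  assumes s: "0 < s" "s < 1"
  shows "ennreal (rho2 m n s) = of_nat n *
    weighted_integral (bridge_density s) (sup_weight m (n - 1))"
  by (rule weighted_integral_eq[where \<sigma> = "s * (1 - s)" and k = 2 and c = "sqrt (2 / pi) * (1 / (s * (1 - s)) powr (3/2))"])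
    (use s in \<open>auto simp: bridge_density_def rho2_def sup_weight_def mult.assoc\<close>)

lemma time_integral_swap:
  fixes d :: "real \<Rightarrow> real \<Rightarrow> real" and E :: "real \<Rightarrow> real" and t :: real
  assumes [measurable]: "(\<lambda>p. d (fst p) (snd p)) \<in> borel_measurable (borel \<Otimes>\<^sub>M borel)" "E \<in> borel_measurable borel"
    and L: "\<And>v. 0 < v \<Longrightarrow> (\<integral>\<^sup>+ s. ennreal (d s v) * indicator {0<..<t} s \<partial>lborel) = ennreal (L v)"
  shows "weighted_integral L E
    = (\<integral>\<^sup>+ s. weighted_integral (d s) E * indicator {0<..<t} s \<partial>lborel)"
proof -
  have [measurable]: "(\<lambda>s. d s v) \<in> borel_measurable borel" "(\<lambda>v. d s v) \<in> borel_measurable borel" for s v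
    using measurable_compose[OF _ assms(1), of "\<lambda>s. (s, v)" borel] measurable_compose[OF _ assms(1), of "\<lambda>v. (s, v)" borel] by simp_all
  have [measurable]: "(\<lambda>p. d (snd p) (fst p)) \<in> borel_measurable (borel \<Otimes>\<^sub>M borel)"
    using measurable_compose[OF _ assms(1), of "\<lambda>p. (snd p, fst p)" "borel \<Otimes>\<^sub>M borel"] by simp
  have "weighted_integral L E
    = (\<integral>\<^sup>+ v. \<integral>\<^sup>+ s. ennreal (d s v) * indicator {0<..<t} s * (ennreal (E v) * indicator {0<..} v) \<partial>lborel \<partial>lborel)"
  proof (rule nn_integral_cong)
    fix v
    have "(\<integral>\<^sup>+ s. ennreal (d s v) * indicator {0<..<t} s * (ennreal (E v) * indicator {0<..} v) \<partial>lborel)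
      = (\<integral>\<^sup>+ s. ennreal (d s v) * indicator {0<..<t} s \<partial>lborel) * (ennreal (E v) * indicator {0<..} v)"
      by (rule nn_integral_multc) measurable
    then show "ennreal (L v) * ennreal (E v) * indicator {0<..} v
      = (\<integral>\<^sup>+ s. ennreal (d s v) * indicator {0<..<t} s * (ennreal (E v) * indicator {0<..} v) \<partial>lborel)"
      using L[of v] by (cases "v > 0") simp_all
  qed
  also have "\<dots> = (\<integral>\<^sup>+ s. \<integral>\<^sup>+ v. ennreal (d s v) * indicator {0<..<t} s * (ennreal (E v) * indicator {0<..} v) \<partial>lborel \<partial>lborel)"
    by (rule lborel_pair.Fubini') measurable
  also have "\<dots> = (\<integral>\<^sup>+ s. weighted_integral (d s) E * indicator {0<..<t} s \<partial>lborel)"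
    by (intro nn_integral_cong) (auto simp: mult.assoc split: split_indicator)
  finally show ?thesis .
qed

lemma motion_density_measurable [measurable]: "(\<lambda>p. motion_density (fst p) (snd p)) \<in> borel_measurable (borel \<Otimes>\<^sub>M borel)"
  unfolding motion_density_def by measurable

lemma bridge_density_measurable [measurable]: "(\<lambda>p. bridge_density (fst p) (snd p)) \<in> borel_measurable (borel \<Otimes>\<^sub>M borel)"
  unfolding bridge_density_def by measurable

lemma rho_measurable [measurable]: "rho1 m n \<in> borel_measurable borel" "rho2 m n \<in> borel_measurable borel"
  unfolding rho1_def[abs_def] rho2_def[abs_def] set_lebesgue_integral_def by measurable

text \<open>\<open>LW\<close> and \<open>LB\<close> are kept open so that one computation serves
  \<open>t < 1\<close>, where they are the argmax densities, and \<open>t = 1\<close>, where they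
  are the integrals over all times.\<close>

lemma rho_time_integral:
  assumes t: "t \<le> 1"
    and LW: "\<And>v. 0 < v \<Longrightarrow> (\<integral>\<^sup>+ s. ennreal (motion_density s v) * indicator {0<..<t} s \<partial>lborel) = ennreal (LW v)"
    and LB: "\<And>v. 0 < v \<Longrightarrow> (\<integral>\<^sup>+ s. ennreal (bridge_density s v) * indicator {0<..<t} s \<partial>lborel) = ennreal (LB v)"
  shows "(\<integral>\<^sup>+ s. ennreal (rho1 m n s + rho2 m n s) * indicator {0<..<t} s \<partial>lborel)
    = of_nat m * weighted_integral LW (sup_weight (m - 1) n)
    + of_nat n * weighted_integral LB (sup_weight m (n - 1))"
proof -
  let ?W = "\<lambda>s. weighted_integral (motion_density s) (sup_weight (m - 1) n)"
  let ?B = "\<lambda>s. weighted_integral (bridge_density s) (sup_weight m (n - 1))"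
  have [measurable]: "?W \<in> borel_measurable borel" "?B \<in> borel_measurable borel"
    unfolding motion_density_def bridge_density_def by measurable
  have "(\<integral>\<^sup>+ s. ennreal (rho1 m n s + rho2 m n s) * indicator {0<..<t} s \<partial>lborel)
    = (\<integral>\<^sup>+ s. of_nat m * (?W s * indicator {0<..<t} s) + of_nat n * (?B s * indicator {0<..<t} s) \<partial>lborel)"
  proof (rule nn_integral_cong)
    fix s :: real
    show "ennreal (rho1 m n s + rho2 m n s) * indicator {0<..<t} s
       = of_nat m * (?W s * indicator {0<..<t} s) + of_nat n * (?B s * indicator {0<..<t} s)"
      using t rho1_nonneg[of s m n] rho2_nonneg[of s m n] rho1_eq_nn_integral[of s m n] rho2_eq_nn_integral[of s m n]
      by (auto split: split_indicator simp: ennreal_plus)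
  qed
  also have "\<dots> = of_nat m * (\<integral>\<^sup>+ s. ?W s * indicator {0<..<t} s \<partial>lborel) + of_nat n * (\<integral>\<^sup>+ s. ?B s * indicator {0<..<t} s \<partial>lborel)"
    by (simp add: nn_integral_add nn_integral_cmult)
  also have "(\<integral>\<^sup>+ s. ?W s * indicator {0<..<t} s \<partial>lborel) = weighted_integral LW (sup_weight (m - 1) n)"
    by (rule time_integral_swap[symmetric]) (auto simp: LW)
  also have "(\<integral>\<^sup>+ s. ?B s * indicator {0<..<t} s \<partial>lborel) = weighted_integral LB (sup_weight m (n - 1))"
    by (rule time_integral_swap[symmetric]) (auto simp: LB)
  finally show ?thesis .
qed

text \<open>Once time is integrated out, the product rule shows that the integrand is the derivative
  of \<open>sup_weight m n\<close>, which rises from 0 to 1 on the half-line.\<close>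

lemma rho_total:
  assumes m: "m \<ge> 1" and n: "n \<ge> 1"
  shows "(\<integral>\<^sup>+ s. ennreal (rho1 m n s + rho2 m n s) * indicator {0<..<1} s \<partial>lborel) = 1"
proof -
  let ?u = "\<lambda>v::real. sqrt (2 / pi) * exp (- v\<^sup>2 / 2)" and ?v = "\<lambda>v::real. 4 * v * exp (- 2 * v\<^sup>2)"
  let ?h = "\<lambda>v. real m * (?u v * sup_weight (m - 1) n v) + real n * (?v v * sup_weight m (n - 1) v)"
  have "(\<integral>\<^sup>+ s. ennreal (rho1 m n s + rho2 m n s) * indicator {0<..<1} s \<partial>lborel)
    = of_nat m * weighted_integral ?u (sup_weight (m - 1) n)
    + of_nat n * weighted_integral ?v (sup_weight m (n - 1))"
    by (intro rho_time_integral motion_density_total bridge_density_total) auto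
  also have "\<dots> = (\<integral>\<^sup>+ v. of_nat m * (ennreal (?u v) * ennreal (sup_weight (m - 1) n v) * indicator {0<..} v)
     + of_nat n * (ennreal (?v v) * ennreal (sup_weight m (n - 1) v) * indicator {0<..} v) \<partial>lborel)"
    by (simp add: nn_integral_add nn_integral_cmult)
  also have "\<dots> = (\<integral>\<^sup>+ v. ennreal (?h v) * indicator {0..} v \<partial>lborel)"
  proof (rule nn_integral_cong_AE)
    show "AE v in lborel. of_nat m * (ennreal (?u v) * ennreal (sup_weight (m - 1) n v) * indicator {0<..} v)
     + of_nat n * (ennreal (?v v) * ennreal (sup_weight m (n - 1) v) * indicator {0<..} v) = ennreal (?h v) * indicator {0..} v"
      using AE_lborel_singleton[of 0]
    proof eventually_elim
      case (elim v)
      show ?case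
      proof (cases "v > 0")
        case True
        then have "0 \<le> sup_weight (m - 1) n v" "0 \<le> sup_weight m (n - 1) v" "0 \<le> ?u v" "0 \<le> ?v v"
          by (auto simp: sup_weight_nonneg)
        then show ?thesis using True
          by (simp only: ennreal_of_nat_eq_real_of_nat) (simp add: ennreal_mult[symmetric] ennreal_plus[symmetric] mult.assoc del: ennreal_plus)
      qed (use elim in auto)
    qed
  qed
  also have "\<dots> = ennreal (1 - sup_weight m n 0)"
  proof (rule nn_integral_FTC_atLeast)
    fix v :: real assume v: "0 \<le> v"
    show "0 \<le> ?h v"
      using v by (intro add_nonneg_nonneg mult_nonneg_nonneg sup_weight_nonneg) auto
    have p: "- (v / sqrt 2)\<^sup>2 = - v\<^sup>2 / 2" by (simp add: power_divide)
    have q: "2 / (sqrt pi * sqrt 2) = sqrt (2 / pi)"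
      by (simp add: real_sqrt_divide field_simps)
    have r: "x / a * y * (1 / b) = x / (a * b) * y" for x y a b :: real
      by simp
    have 1: "2 / sqrt pi * exp (- (v / sqrt 2)\<^sup>2) * (1 / sqrt 2) = ?u v"
      unfolding p r q ..
    have "((\<lambda>v. erf (v / sqrt 2)) has_real_derivative ?u v) (at v)"
      unfolding 1[symmetric] by (intro erf_DERIV_chain DERIV_cdivide DERIV_ident)
    moreover have "((\<lambda>v. 1 - exp (- 2 * v\<^sup>2)) has_real_derivative ?v v) (at v)"
      by (auto intro!: derivative_eq_intros)
    ultimately have "((\<lambda>v. erf (v / sqrt 2) ^ m * (1 - exp (- 2 * v\<^sup>2)) ^ n) has_real_derivative
       (of_nat m * (?u v * erf (v / sqrt 2) ^ (m - Suc 0))) * (1 - exp (- 2 * v\<^sup>2)) ^ n +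
       (of_nat n * (?v v * (1 - exp (- 2 * v\<^sup>2)) ^ (n - Suc 0))) * erf (v / sqrt 2) ^ m) (at v)"
      by (intro DERIV_mult DERIV_power)
    then show "(sup_weight m n has_real_derivative ?h v) (at v)"
      unfolding sup_weight_def[abs_def] by (simp add: ac_simps)
  next
    have "filterlim (\<lambda>v::real. v / sqrt 2) at_top at_top" by real_asymp
    from filterlim_compose[OF erf_tendsto_1 this]
    have "((\<lambda>v. erf (v / sqrt 2) ^ m) \<longlongrightarrow> 1 ^ m) at_top" by (rule tendsto_power)
    moreover have "((\<lambda>v::real. 1 - exp (- 2 * v\<^sup>2)) \<longlongrightarrow> 1) at_top" by real_asymp
    from tendsto_power[OF this, of n] have "((\<lambda>v::real. (1 - exp (- 2 * v\<^sup>2)) ^ n) \<longlongrightarrow> 1 ^ n) at_top" .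
    ultimately have "(sup_weight m n \<longlongrightarrow> 1 ^ m * 1 ^ n) at_top"
      unfolding sup_weight_def[abs_def] by (rule tendsto_mult)
    then show "(sup_weight m n \<longlongrightarrow> 1) at_top" by simp
  qed measurable
  also have "1 - sup_weight m n 0 = 1" using m by (simp add: sup_weight_def power_0_left)
  finally show ?thesis by simp
qed

section \<open>The pair of maxima of a single process\<close>

lemma path_sup_pair_law:
  fixes X :: "real \<Rightarrow> 'a \<Rightarrow> real"
  assumes M: "prob_space M" and X: "\<And>s. s \<in> {0..1} \<Longrightarrow> X s \<in> borel_measurable M"
    and X0: "AE w in M. X 0 w = 0" and cont: "AE w in M. continuous_on {0..1} (\<lambda>s. X s w)"
    and t: "0 < t" "t < 1"
    and k: "(\<lambda>p. k t (fst p) (snd p)) \<in> borel_measurable (borel \<Otimes>\<^sub>M borel)"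
    and C: "\<And>b. C b \<in> borel_measurable borel" "\<And>b y. (\<integral>\<^sup>+ u. k t u y * indicator {..b} u \<partial>lborel) = C b y"
    and law: "\<And>a b. 0 \<le> a \<Longrightarrow> emeasure M {w \<in> space M. dyadics_le t (\<lambda>s. X s w) a b}
       = (\<integral>\<^sup>+ y. ennreal (refl_kernel a t 0 y) * indicator {..a} y * C b y \<partial>lborel)"
  defines "A \<equiv> \<lambda>w. path_sup (dyadics_before t) (\<lambda>s. X s w)" and "B \<equiv> \<lambda>w. path_sup (dyadics_after t) (\<lambda>s. X s w)"
  shows "distr M borel (\<lambda>w. (A w, B w)) = density lborel (sup_density k t)" (is ?distr)
    and "0 \<le> a \<Longrightarrow> emeasure M {w \<in> space M. A w \<le> a \<and> B w \<le> b} = (\<integral>\<^sup>+ y. ennreal (refl_kernel a t 0 y) * indicator {..a} y * C b y \<partial>lborel)"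
proof -
  have sub: "dyadics_before t \<subseteq> {0..1}" "dyadics_after t \<subseteq> {0..1}"
    using dyadics_before_subset[OF t(1)] dyadics_after_subset[OF t(2)] t by force+
  have m: "(\<lambda>w. path_sup D (\<lambda>s. X s w)) \<in> borel_measurable M" if "countable D" "D \<subseteq> {0..1}" for D
    unfolding path_sup_def using that X
    by (intro borel_measurable_real_of_ereal borel_measurable_SUP borel_measurable_ereal) auto
  have AB [measurable]: "A \<in> borel_measurable M" "B \<in> borel_measurable M"
    unfolding A_def B_def by (intro m countable_dyadics sub)+
  have iff: "AE w in M. \<forall>a b. (A w \<le> a \<and> B w \<le> b) \<longleftrightarrow> dyadics_le t (\<lambda>s. X s w) a b"
    using cont
  proof eventually_elim
    case (elim w)
    have "compact ((\<lambda>s. X s w) ` {0..1})"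
      using elim by (intro compact_continuous_image) auto
    then have "bdd_above ((\<lambda>s. X s w) ` {0..1})" by (intro bounded_imp_bdd_above compact_imp_bounded)
    then have "bdd_above ((\<lambda>s. X s w) ` dyadics_before t)" "bdd_above ((\<lambda>s. X s w) ` dyadics_after t)"
      using sub by (meson bdd_above_mono image_mono)+
    moreover have "dyadics_before t \<noteq> {}" "dyadics_after t \<noteq> {}"
      using dyadics_before_closure[OF t(1)] dyadics_after_closure[OF t(2)] t by force+
    ultimately show ?case unfolding A_def B_def by (simp add: path_sup_le_iff)
  qed
  have ev: "emeasure M {w \<in> space M. A w \<le> a \<and> B w \<le> b} = (\<integral>\<^sup>+ y. ennreal (refl_kernel a t 0 y) * indicator {..a} y * C b y \<partial>lborel)"
    if a: "0 \<le> a" for a b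
    unfolding law[OF a, symmetric]
  proof (rule emeasure_eq_AE)
    show "AE w in M. w \<in> {w \<in> space M. A w \<le> a \<and> B w \<le> b}
       \<longleftrightarrow> w \<in> {w \<in> space M. dyadics_le t (\<lambda>s. X s w) a b}"
      using iff by eventually_elim auto
    show "{w \<in> space M. A w \<le> a \<and> B w \<le> b} \<in> sets M" by measurable
    have D: "{w \<in> space M. \<forall>s\<in>D. X s w \<le> c} \<in> sets M" if D: "countable D" "D \<subseteq> {0..1}" for D c
    proof (rule sets.sets_Collect_countable_All'[OF _ D(1)])
      fix s assume "s \<in> D"
      then have [measurable]: "X s \<in> borel_measurable M" using D X by auto
      show "{w \<in> space M. X s w \<le> c} \<in> sets M" by measurable
    qed
    show "{w \<in> space M. dyadics_le t (\<lambda>s. X s w) a b} \<in> sets M"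
      by (intro sets.sets_Collect_conj D countable_dyadics sub)
  qed
  then show "0 \<le> a \<Longrightarrow> emeasure M {w \<in> space M. A w \<le> a \<and> B w \<le> b} = (\<integral>\<^sup>+ y. ennreal (refl_kernel a t 0 y) * indicator {..a} y * C b y \<partial>lborel)" .
  show ?distr
  proof (rule distr_eq_density_prod[OF M AB])
    show "sup_density k t \<in> borel_measurable (borel \<Otimes>\<^sub>M borel)" using k by (rule sup_density_measurable)
    fix a b
    have r: "(\<integral>\<^sup>+ p. sup_density k t p * indicator {..(a, b)} p \<partial>lborel)
      = (\<integral>\<^sup>+ y. ennreal (refl_kernel a t 0 y) * indicator {..a} y * indicator {0..} a * C b y \<partial>lborel)"
      by (rule sup_density_cdf[of k t b "C b", OF k C(2) C(1) t(1)])
    show "emeasure M {w \<in> space M. A w \<le> a \<and> B w \<le> b} = (\<integral>\<^sup>+ p. sup_density k t p * indicator {..(a, b)} p \<partial>lborel)"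
    proof (cases "0 \<le> a")
      case True
      then show ?thesis unfolding r using ev[OF True] by simp
    next
      case False
      \<comment> \<open>The path starts at 0, so a negative bound on the maximum before
        \<open>t\<close> has probability zero.\<close>
      have 0: "0 \<in> dyadics_before t"
        unfolding dyadics_before_def by (auto intro!: exI[of _ 0] bexI[of _ 0])
      have "AE w in M. \<not> (A w \<le> a \<and> B w \<le> b)"
        using iff X0 by eventually_elim (use False 0 in force)
      then have "emeasure M {w \<in> space M. A w \<le> a \<and> B w \<le> b} = 0"
        by (subst emeasure_eq_0_AE) auto
      then show ?thesis unfolding r using False by simp
    qed
  qed
qed

lemma motion_pair_law:
  fixes W :: "real \<Rightarrow> 'a \<Rightarrow> real"
  assumes M: "prob_space M" and W: "std_brownian_motion_on {0..1} M W" and t: "0 < t" "t < 1"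
  defines "A \<equiv> \<lambda>w. path_sup (dyadics_before t) (\<lambda>s. W s w)" and "B \<equiv> \<lambda>w. path_sup (dyadics_after t) (\<lambda>s. W s w)"
  shows "distr M borel (\<lambda>w. (A w, B w)) = density lborel (sup_density motion_kernel t)"
    and "0 \<le> z \<Longrightarrow> emeasure M {w \<in> space M. A w \<le> z \<and> B w \<le> z} = ennreal (erf (z / sqrt 2))"
proof -
  let ?C = "\<lambda>b y. motion_tail t b y * indicator {..b} y"
  have law: "emeasure M {w \<in> space M. dyadics_le t (\<lambda>s. W s w) a b}
       = (\<integral>\<^sup>+ y. ennreal (refl_kernel a t 0 y) * indicator {..a} y * ?C b y \<partial>lborel)" if "0 \<le> a" for a b
    using brownian_motion_sup_law[OF M W t that] by (simp only: sup_cdf_def mult.commute[of "indicator {..b} _"])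
  have W': "s \<in> {0..1} \<Longrightarrow> W s \<in> borel_measurable M" "AE w in M. W 0 w = 0" "AE w in M. continuous_on {0..1} (\<lambda>s. W s w)" for s
    using W unfolding std_brownian_motion_on_def by blast+
  note * = path_sup_pair_law[where X = W and k = motion_kernel and C = ?C, OF M W' t motion_kernel_measurable2 _ motion_kernel_integral[OF t(2)] law]
  show "distr M borel (\<lambda>w. (A w, B w)) = density lborel (sup_density motion_kernel t)"
    unfolding A_def B_def by (rule *(1)) auto
  assume z: "0 \<le> z"
  have "emeasure M {w \<in> space M. A w \<le> z \<and> B w \<le> z} = sup_cdf motion_tail t z z"
    unfolding A_def B_def sup_cdf_def mult.commute[of "indicator {..z} _" "motion_tail t z _"] using z by (intro *(2)) auto
  then show "emeasure M {w \<in> space M. A w \<le> z \<and> B w \<le> z} = ennreal (erf (z / sqrt 2))"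
    by (simp add: sup_cdf_motion_diag[OF t z])
qed

lemma bridge_pair_law:
  fixes X :: "real \<Rightarrow> 'a \<Rightarrow> real"
  assumes M: "prob_space M" and X: "std_brownian_bridge M X" and t: "0 < t" "t < 1"
  defines "A \<equiv> \<lambda>w. path_sup (dyadics_before t) (\<lambda>s. X s w)" and "B \<equiv> \<lambda>w. path_sup (dyadics_after t) (\<lambda>s. X s w)"
  shows "distr M borel (\<lambda>w. (A w, B w)) = density lborel (sup_density bridge_kernel t)"
    and "0 \<le> z \<Longrightarrow> emeasure M {w \<in> space M. A w \<le> z \<and> B w \<le> z} = ennreal (1 - exp (- 2 * z\<^sup>2))"
proof -
  let ?C = "\<lambda>b y. bridge_tail t b y * indicator {..b} y * indicator {0..} b"
  have X': "s \<in> {0..1} \<Longrightarrow> X s \<in> borel_measurable M" "AE w in M. X 0 w = 0" "AE w in M. X 1 w = 0" "AE w in M. continuous_on {0..1} (\<lambda>s. X s w)" for s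
    using X unfolding std_brownian_bridge_def by blast+
  have law: "emeasure M {w \<in> space M. dyadics_le t (\<lambda>s. X s w) a b}
       = (\<integral>\<^sup>+ y. ennreal (refl_kernel a t 0 y) * indicator {..a} y * ?C b y \<partial>lborel)" if a: "0 \<le> a" for a b
  proof (cases "0 \<le> b")
    case True
    then show ?thesis
      using brownian_bridge_sup_law[OF M X t a True]
      by (simp only: sup_cdf_def mult.commute[of "indicator {..b} _"]) simp
  next
    case False
    \<comment> \<open>Time 1 is a dyadic point and the bridge is 0 there, so a negative bound
      \<open>b\<close> has probability zero; this is the source of the indicator on \<open>b\<close>
      in \<open>?C\<close>.\<close>
    have "t + (1 - t) * (real 1 / real (2 ^ 0 :: nat)) \<in> dyadics_after t"
      unfolding dyadics_after_def by (intro UN_I[of 0] UN_I[of 1]) auto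
    then have 1: "1 \<in> dyadics_after t" by simp
    have "AE w in M. \<not> (dyadics_le t (\<lambda>s. X s w) a b)"
      using X'(3) by eventually_elim (use False 1 in force)
    then have "emeasure M {w \<in> space M. dyadics_le t (\<lambda>s. X s w) a b} = 0"
      by (rule emeasure_eq_0_AE)
    then show ?thesis using False by simp
  qed
  note * = path_sup_pair_law[where X = X and k = bridge_kernel and C = ?C, OF M X'(1,2,4) t bridge_kernel_measurable2 _ bridge_kernel_integral[OF t(2)] law]
  show "distr M borel (\<lambda>w. (A w, B w)) = density lborel (sup_density bridge_kernel t)"
    unfolding A_def B_def by (rule *(1)) auto
  assume z: "0 \<le> z"
  have "emeasure M {w \<in> space M. A w \<le> z \<and> B w \<le> z}
     = (\<integral>\<^sup>+ y. ennreal (refl_kernel z t 0 y) * indicator {..z} y * ?C z y \<partial>lborel)"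
    unfolding A_def B_def using z by (intro *(2)) auto
  also have "\<dots> = sup_cdf bridge_tail t z z"
    unfolding sup_cdf_def using z by (simp add: mult.commute[of "indicator {..z} _" "bridge_tail t z _"])
  finally show "emeasure M {w \<in> space M. A w \<le> z \<and> B w \<le> z} = ennreal (1 - exp (- 2 * z\<^sup>2))"
    by (simp add: sup_cdf_bridge_diag[OF t z])
qed

text \<open>A statement about fixed paths. If \<open>c\<close> is attained up to time
  \<open>t\<close>, the process attaining it has \<open>a i = c\<close> and wins weakly. If
  \<open>k\<close> wins strictly and \<open>c\<close> were attained after \<open>t\<close>, then
  \<open>c \<le> b i < a k \<le> c\<close>.\<close>

lemma argmax_before_iff_winner:
  fixes x :: "'k \<Rightarrow> real \<Rightarrow> real"
  assumes cont: "\<And>k. k \<in> K \<Longrightarrow> continuous_on {0..1} (x k)"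
    and ub: "\<And>k s. k \<in> K \<Longrightarrow> s \<in> {0..1} \<Longrightarrow> x k s \<le> c"
    and t: "0 < t" "t < 1" and \<tau>: "\<tau> \<in> {0..1}" "i \<in> K" "x i \<tau> = c"
  defines "a \<equiv> \<lambda>k. path_sup (dyadics_before t) (x k)" and "b \<equiv> \<lambda>k. path_sup (dyadics_after t) (x k)"
  shows "\<tau> \<le> t \<Longrightarrow> \<exists>k\<in>K. b k \<le> a k \<and> (\<forall>j\<in>K - {k}. a j \<le> a k \<and> b j \<le> a k)"
    and "k \<in> K \<Longrightarrow> b k < a k \<Longrightarrow> \<forall>j\<in>K - {k}. a j < a k \<and> b j < a k \<Longrightarrow> \<tau> \<le> t"
proof -
  have a_iff: "a k \<le> z \<longleftrightarrow> (\<forall>s\<in>{0..t}. x k s \<le> z)" if "k \<in> K" for k z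
    unfolding a_def using t that by (intro path_sup_closure_le_iff cont dyadics_before_closure) auto
  have b_iff: "b k \<le> z \<longleftrightarrow> (\<forall>s\<in>{t..1}. x k s \<le> z)" if "k \<in> K" for k z
    unfolding b_def using t that by (intro path_sup_closure_le_iff cont dyadics_after_closure) auto
  have ac: "a k \<le> c" if "k \<in> K" for k
    unfolding a_iff[OF that] using ub[OF that] t by auto
  have bc: "b k \<le> c" if "k \<in> K" for k
    unfolding b_iff[OF that] using ub[OF that] t by auto
  show "\<exists>k\<in>K. b k \<le> a k \<and> (\<forall>j\<in>K - {k}. a j \<le> a k \<and> b j \<le> a k)" if "\<tau> \<le> t"
  proof -
    have "x i \<tau> \<le> a i" using a_iff[OF \<tau>(2), of "a i"] \<tau>(1) that by auto
    then have "a i = c" using ac[OF \<tau>(2)] \<tau>(3) by simp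
    then show ?thesis using ac bc \<tau>(2) by (intro bexI[of _ i]) auto
  qed
  show "\<tau> \<le> t" if k: "k \<in> K" "b k < a k" "\<forall>j\<in>K - {k}. a j < a k \<and> b j < a k"
  proof (rule ccontr)
    assume "\<not> \<tau> \<le> t"
    then have "c \<le> b i" using b_iff[OF \<tau>(2), of "b i"] \<tau> by auto
    moreover have "b i < a k" using k \<tau>(2) by (cases "i = k") auto
    ultimately show False using ac[OF k(1)] by simp
  qed
qed

lemma combined_max_upper:
  assumes "\<And>i. i \<in> {1..m} \<Longrightarrow> continuous_on {0..1} (\<lambda>s. W i s w)" "\<And>j. j \<in> {1..n} \<Longrightarrow> continuous_on {0..1} (\<lambda>s. B j s w)"
    and k: "k \<in> {1..m} <+> {1..n}" and s: "s \<in> {0..1}"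
  shows "case_sum W B k s w \<le> combined_max m n W B w"
proof -
  have bdd: "bdd_above (f ` {0..1})" if "continuous_on {0..1} f" for f :: "real \<Rightarrow> real"
    using that by (intro bounded_imp_bdd_above compact_imp_bounded compact_continuous_image) auto
  show ?thesis
    using k
  proof (elim PlusE)
    fix i assume i: "i \<in> {1..m}" "k = Inl i"
    have "W i s w \<le> (SUP s\<in>{0..1}. W i s w)"
      using s by (intro cSUP_upper bdd assms(1)[OF i(1)])
    also have "\<dots> \<le> (MAX i\<in>{1..m}. SUP s\<in>{0..1}. W i s w)"
      using i by (intro Max_ge) auto
    finally show ?thesis using i by (simp add: combined_max_def)
  next
    fix j assume j: "j \<in> {1..n}" "k = Inr j"
    have "B j s w \<le> (SUP s\<in>{0..1}. B j s w)"
      using s by (intro cSUP_upper bdd assms(2)[OF j(1)])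
    also have "\<dots> \<le> (MAX j\<in>{1..n}. SUP s\<in>{0..1}. B j s w)"
      using j by (intro Max_ge) auto
    finally show ?thesis using j by (simp add: combined_max_def)
  qed
qed

lemma attains_combined_max_iff:
  "attains_combined_max m n W B w \<tau> \<longleftrightarrow>
    \<tau> \<in> {0..1} \<and> (\<exists>k\<in>{1..m} <+> {1..n}. case_sum W B k \<tau> w = combined_max m n W B w)"
  by (simp add: attains_combined_max_def Plus_def bex_Un)

lemma path_sup_restrict: "D \<subseteq> I \<Longrightarrow> path_sup D (restrict x I) = path_sup D x"
  unfolding path_sup_def by (intro arg_cong[where f = real_of_ereal] SUP_cong) auto

text \<open>The second conclusion concerns arbitrary argmax times and not just \<open>T\<close>:
  almost surely no two of them are separated by \<open>t\<close>, because a weak winner is almost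
  surely strict and a strict winner binds all of them. Uniqueness rests on it.\<close>

lemma combined_argmax_law:
  fixes M :: "'a measure" and m n :: nat
    and W B :: "nat \<Rightarrow> real \<Rightarrow> 'a \<Rightarrow> real" and T :: "'a \<Rightarrow> real"
  assumes M: "prob_space M" and m: "m \<ge> 1" and n: "n \<ge> 1"
    and W: "\<And>i. i \<in> {1..m} \<Longrightarrow> std_brownian_motion_on {0..1} M (W i)"
    and B: "\<And>j. j \<in> {1..n} \<Longrightarrow> std_brownian_bridge M (B j)"
    and indep: "indep_processes M m n W B"
    and T: "T \<in> borel_measurable M" "AE w in M. attains_combined_max m n W B w (T w)"
    and t: "0 < t" "t < 1"
  shows "emeasure M {w \<in> space M. T w \<le> t} = (\<integral>\<^sup>+ s. ennreal (rho1 m n s + rho2 m n s) * indicator {0<..<t} s \<partial>lborel)"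
    and "AE w in M. \<forall>\<tau> \<tau>'. attains_combined_max m n W B w \<tau> \<longrightarrow> attains_combined_max m n W B w \<tau>' \<longrightarrow> \<tau> \<le> t \<longrightarrow> \<tau>' \<le> t"
proof -
  define K :: "(nat + nat) set" where "K = {1..m} <+> {1..n}"
  define X where "X = case_sum W B"
  define A where "A k w = path_sup (dyadics_before t) (\<lambda>s. X k s w)" for k w
  define C where "C k w = path_sup (dyadics_after t) (\<lambda>s. X k s w)" for k w
  define f :: "nat + nat \<Rightarrow> real \<times> real \<Rightarrow> ennreal" where
    "f = case_sum (\<lambda>_. sup_density motion_kernel t) (\<lambda>_. sup_density bridge_kernel t)"
  define g :: "nat + nat \<Rightarrow> real \<Rightarrow> real" where "g = case_sum (\<lambda>_. motion_argmax t) (\<lambda>_. bridge_argmax t)"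
  define G :: "nat + nat \<Rightarrow> real \<Rightarrow> real" where "G = case_sum (\<lambda>_ z. erf (z / sqrt 2)) (\<lambda>_ z. 1 - exp (- 2 * z\<^sup>2))"
  interpret prob_space M by fact
  have sub: "dyadics_before t \<subseteq> {0..1}" "dyadics_after t \<subseteq> {0..1}"
    using dyadics_before_subset[OF t(1)] dyadics_after_subset[OF t(2)] t by force+
  have indep_AC: "indep_vars (\<lambda>_. borel) (\<lambda>k w. (A k w, C k w)) K"
  proof -
    \<comment> \<open>Independence is assumed for whole paths in the product space; the pair of
      suprema is one measurable function of such a path and inherits it.\<close>
    let ?Y = "\<lambda>x. (path_sup (dyadics_before t) x, path_sup (dyadics_after t) x)"
    have "?Y \<in> (\<Pi>\<^sub>M s\<in>{0..1::real}. borel) \<rightarrow>\<^sub>M borel"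
      unfolding borel_prod[symmetric] by (intro measurable_Pair path_sup_measurable countable_dyadics sub)
    moreover have "indep_vars (\<lambda>_. \<Pi>\<^sub>M s\<in>{0..1::real}. borel) (\<lambda>k w. \<lambda>s\<in>{0..1}. X k s w) K"
      using indep unfolding indep_processes_def X_def K_def .
    ultimately have "indep_vars (\<lambda>_. borel) (\<lambda>k w. ?Y (\<lambda>s\<in>{0..1}. X k s w)) K"
      by (intro indep_vars_compose2[where Y = "\<lambda>_. ?Y"])
    then show ?thesis
      unfolding A_def C_def by (simp only: path_sup_restrict sub)
  qed
  interpret competition M K A C f g G
  proof
    show "finite K" by (simp add: K_def)
    show "K - {k} \<noteq> {}" for k
    proof -
      have "Inl 1 \<in> K" "Inr 1 \<in> K" using m n by (auto simp: K_def)
      then show ?thesis by (cases k) auto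
    qed
    show "indep_vars (\<lambda>_. borel) (\<lambda>k w. (A k w, C k w)) K" by (fact indep_AC)
    show "f k \<in> borel_measurable (borel \<Otimes>\<^sub>M borel)" for k
      by (cases k) (auto simp: f_def)
    show "distr M borel (\<lambda>w. (A k w, C k w)) = density lborel (f k)" if "k \<in> K" for k
      using that unfolding K_def A_def C_def f_def X_def
      by (elim PlusE) (simp_all add: motion_pair_law(1)[OF M W t] bridge_pair_law(1)[OF M B t])
    show "emeasure M {w \<in> space M. A k w \<le> z \<and> C k w \<le> z} = ennreal (G k z)" if "k \<in> K" "0 \<le> z" for k z
      using that unfolding K_def A_def C_def G_def X_def
      by (elim PlusE) (simp_all add: motion_pair_law(2)[OF M W t] bridge_pair_law(2)[OF M B t])
    show "0 \<le> G k z" if "k \<in> K" "0 \<le> z" for k z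
      using that by (cases k) (auto simp: G_def erf_nonneg)
    show "(\<integral>\<^sup>+ u. f k (v, u) * indicator {..v} u \<partial>lborel) = ennreal (g k v)" if "k \<in> K" "0 < v" for k v
    proof (cases k)
      case (Inl i)
      have "(\<integral>\<^sup>+ u. sup_density motion_kernel t (v, u) * indicator {..v} u \<partial>lborel)
         = (\<integral>\<^sup>+ y. before_kernel t v y * (motion_tail t v y * indicator {..v} y) \<partial>lborel)"
        by (rule sup_density_inner[of motion_kernel, OF motion_kernel_measurable2 motion_kernel_integral[OF t(2)]])
      then show ?thesis using motion_argmax_integral[OF t \<open>0 < v\<close>] Inl by (simp add: f_def g_def)
    next
      case (Inr j)
      have "(\<integral>\<^sup>+ u. sup_density bridge_kernel t (v, u) * indicator {..v} u \<partial>lborel)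
         = (\<integral>\<^sup>+ y. before_kernel t v y * (bridge_tail t v y * indicator {..v} y * indicator {0..} v) \<partial>lborel)"
        by (rule sup_density_inner[of bridge_kernel, OF bridge_kernel_measurable2 bridge_kernel_integral[OF t(2)]])
      then show ?thesis using bridge_argmax_integral[OF t \<open>0 < v\<close>] Inr \<open>0 < v\<close> by (simp add: f_def g_def)
    qed
    show "f k (v, u) = 0" if "k \<in> K" "v < 0" for k v u
    proof -
      have "before_kernel t v y = 0" for y using \<open>v < 0\<close> by (simp add: before_kernel_def)
      then show ?thesis by (cases k) (simp_all add: f_def sup_density_def)
    qed
  qed
  have cont: "AE w in M. \<forall>k\<in>K. continuous_on {0..1} (\<lambda>s. X k s w)"
  proof (subst AE_finite_all[OF K(1)], rule ballI)
    fix k assume "k \<in> K"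
    then show "AE w in M. continuous_on {0..1} (\<lambda>s. X k s w)"
      using W B unfolding K_def X_def std_brownian_motion_on_def std_brownian_bridge_def by (elim PlusE) auto
  qed
  define good where "good w \<longleftrightarrow> (\<forall>k\<in>K. continuous_on {0..1} (\<lambda>s. X k s w))" for w
  have ub: "X k s w \<le> combined_max m n W B w" if "good w" "k \<in> K" "s \<in> {0..1}" for w k s
  proof -
    have "continuous_on {0..1} (\<lambda>s. W i s w)" if "i \<in> {1..m}" for i
    proof -
      have "Inl i \<in> K" using that by (simp only: K_def InlI)
      then have "continuous_on {0..1} (\<lambda>s. X (Inl i) s w)" using \<open>good w\<close> unfolding good_def by blast
      then show ?thesis by (simp add: X_def)
    qed
    moreover have "continuous_on {0..1} (\<lambda>s. B j s w)" if "j \<in> {1..n}" for j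
    proof -
      have "Inr j \<in> K" using that by (simp only: K_def InrI)
      then have "continuous_on {0..1} (\<lambda>s. X (Inr j) s w)" using \<open>good w\<close> unfolding good_def by blast
      then show ?thesis by (simp add: X_def)
    qed
    ultimately show ?thesis using that unfolding X_def K_def by (intro combined_max_upper)
  qed
  have upper: "\<exists>k\<in>K. winner (\<le>) k w" if good: "good w" and att: "attains_combined_max m n W B w \<tau>" and le: "\<tau> \<le> t" for w \<tau>
  proof -
    obtain i where i: "\<tau> \<in> {0..1}" "i \<in> K" "X i \<tau> w = combined_max m n W B w"
      using att unfolding attains_combined_max_iff K_def X_def by blast
    show ?thesis
      using argmax_before_iff_winner(1)[of K "\<lambda>k s. X k s w", OF _ ub[OF good] t i le] good
      unfolding winner_def A_def C_def good_def by simp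
  qed
  have lower: "\<tau> \<le> t" if good: "good w" and att: "attains_combined_max m n W B w \<tau>" and k: "k \<in> K" and win: "winner (<) k w" for w \<tau> k
  proof -
    obtain i where i: "\<tau> \<in> {0..1}" "i \<in> K" "X i \<tau> w = combined_max m n W B w"
      using att unfolding attains_combined_max_iff K_def X_def by blast
    show ?thesis
      using argmax_before_iff_winner(2)[of K "\<lambda>k s. X k s w", OF _ ub[OF good] t i k] good win
      unfolding winner_def A_def C_def good_def by simp
  qed
  show "AE w in M. \<forall>\<tau> \<tau>'. attains_combined_max m n W B w \<tau> \<longrightarrow> attains_combined_max m n W B w \<tau>' \<longrightarrow> \<tau> \<le> t \<longrightarrow> \<tau>' \<le> t"
    using cont AE_winner_strict
  proof eventually_elim
    case (elim w)
    then have "good w" by (simp add: good_def)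
    with elim(2) show ?case using upper lower by blast
  qed
  have "emeasure M {w \<in> space M. T w \<le> t} = (\<Sum>k\<in>K. weighted_integral (g k) (\<lambda>v. \<Prod>j\<in>K - {k}. G j v))"
  proof (rule prob_eq_sum_winner)
    show "{w \<in> space M. T w \<le> t} \<in> sets M" using T(1) by measurable
    show "AE w in M. (\<exists>k\<in>K. winner (<) k w) \<longrightarrow> w \<in> {w \<in> space M. T w \<le> t}"
      using cont T(2) AE_space by eventually_elim (use lower in \<open>auto simp: good_def\<close>)
    show "AE w in M. w \<in> {w \<in> space M. T w \<le> t} \<longrightarrow> (\<exists>k\<in>K. winner (\<le>) k w)"
      using cont T(2) by eventually_elim (use upper in \<open>auto simp: good_def\<close>)
  qed
  also have "\<dots> = (\<Sum>i\<in>{1..m}. weighted_integral (motion_argmax t) (sup_weight (m - 1) n)) + (\<Sum>j\<in>{1..n}. weighted_integral (bridge_argmax t) (sup_weight m (n - 1)))"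
  proof -
    have PW: "(\<Prod>j\<in>K - {Inl i}. G j v) = sup_weight (m - 1) n v" if "i \<in> {1..m}" for i v
    proof -
      have "K - {Inl i} = ({1..m} - {i}) <+> {1..n}" unfolding K_def by auto
      then show ?thesis using that by (simp add: prod.Plus G_def sup_weight_def)
    qed
    have PB: "(\<Prod>j\<in>K - {Inr i}. G j v) = sup_weight m (n - 1) v" if "i \<in> {1..n}" for i v
    proof -
      have "K - {Inr i} = {1..m} <+> ({1..n} - {i})" unfolding K_def by auto
      then show ?thesis using that by (simp add: prod.Plus G_def sup_weight_def)
    qed
    have "(\<Sum>k\<in>K. weighted_integral (g k) (\<lambda>v. \<Prod>j\<in>K - {k}. G j v))
      = (\<Sum>i\<in>{1..m}. weighted_integral (g (Inl i)) (\<lambda>v. \<Prod>j\<in>K - {Inl i}. G j v)) + (\<Sum>i\<in>{1..n}. weighted_integral (g (Inr i)) (\<lambda>v. \<Prod>j\<in>K - {Inr i}. G j v))"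
      by (subst (1) K_def) (simp add: sum.Plus comp_def)
    then show ?thesis by (simp only: PW PB cong: sum.cong) (simp add: g_def)
  qed
  also have "\<dots> = of_nat m * weighted_integral (motion_argmax t) (sup_weight (m - 1) n) + of_nat n * weighted_integral (bridge_argmax t) (sup_weight m (n - 1))"
    by simp
  also have "\<dots> = (\<integral>\<^sup>+ s. ennreal (rho1 m n s + rho2 m n s) * indicator {0<..<t} s \<partial>lborel)"
    using t by (intro rho_time_integral[symmetric] motion_density_integral bridge_density_integral) auto
  finally show "emeasure M {w \<in> space M. T w \<le> t} = (\<integral>\<^sup>+ s. ennreal (rho1 m n s + rho2 m n s) * indicator {0<..<t} s \<partial>lborel)" .
qed

theorem mainTheorem5:
  fixes M :: "'a measure" and m n :: nat
    and W B :: "nat \<Rightarrow> real \<Rightarrow> 'a \<Rightarrow> real" and T :: "'a \<Rightarrow> real"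
  assumes "prob_space M"
    and "m \<ge> 1" and "n \<ge> 1"
    and "\<And>i. i \<in> {1..m} \<Longrightarrow> std_brownian_motion_on {0..1} M (W i)"
    and "\<And>j. j \<in> {1..n} \<Longrightarrow> std_brownian_bridge M (B j)"
    and "indep_processes M m n W B"
    and "T \<in> borel_measurable M"
    and "AE \<omega> in M. attains_combined_max m n W B \<omega> (T \<omega>)"
  shows "(AE \<omega> in M. \<exists>!t. attains_combined_max m n W B \<omega> t) \<and>
    distributed M lborel T
      (\<lambda>t. ennreal (indicator {0<..<1} t * (rho1 m n t + rho2 m n t)))"
proof
  interpret prob_space M by fact
  let ?at = "attains_combined_max m n W B"
  have law: "emeasure M {\<omega> \<in> space M. T \<omega> \<le> t} = (\<integral>\<^sup>+ s. ennreal (rho1 m n s + rho2 m n s) * indicator {0<..<t} s \<partial>lborel)"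
    if "0 < t" "t < 1" for t
    by (rule combined_argmax_law(1)[OF assms that])
  have order: "AE \<omega> in M. \<forall>\<tau> \<tau>'. ?at \<omega> \<tau> \<longrightarrow> ?at \<omega> \<tau>' \<longrightarrow> \<tau> \<le> t \<longrightarrow> \<tau>' \<le> t"
    if "0 < t" "t < 1" for t
    by (rule combined_argmax_law(2)[OF assms that])
  \<comment> \<open>Countably many \<open>q\<close> share one null set, and any two distinct argmax
    times are separated by a rational in \<open>(0, 1)\<close>.\<close>
  have "AE \<omega> in M. \<forall>q\<in>\<rat> \<inter> {0<..<1}. \<forall>\<tau> \<tau>'. ?at \<omega> \<tau> \<longrightarrow> ?at \<omega> \<tau>' \<longrightarrow> \<tau> \<le> q \<longrightarrow> \<tau>' \<le> q"
  proof (subst AE_ball_countable)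
    show "countable (\<rat> \<inter> {0<..<1::real})" by (simp add: countable_rat)
  qed (intro ballI order; simp)
  with assms(8) show "AE \<omega> in M. \<exists>!t. ?at \<omega> t"
  proof eventually_elim
    case (elim \<omega>)
    have le: "\<tau>' \<le> \<tau>" if "?at \<omega> \<tau>" "?at \<omega> \<tau>'" for \<tau> \<tau>'
    proof (rule ccontr)
      assume "\<not> \<tau>' \<le> \<tau>"
      then obtain q where q: "q \<in> \<rat>" "\<tau> < q" "q < \<tau>'" using Rats_dense_in_real[of \<tau> \<tau>'] by auto
      moreover have "0 \<le> \<tau>" "\<tau>' \<le> 1" using that by (auto simp: attains_combined_max_def)
      ultimately have "\<tau>' \<le> q" using elim(2) that by auto
      then show False using q by simp
    qed
    show ?case using elim(1) le by (intro ex1I[of _ "T \<omega>"]) (auto intro: antisym)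
  qed
  let ?f = "\<lambda>t. ennreal (indicator {0<..<1} t * (rho1 m n t + rho2 m n t))"
  have T [measurable]: "T \<in> borel_measurable M" by fact
  have fm [measurable]: "?f \<in> borel_measurable borel" by measurable
  \<comment> \<open>\<open>min t 1\<close> makes the formula valid for every real \<open>t\<close>:
    the interval is empty for \<open>t \<le> 0\<close>, and the density is 0 from time 1 on.\<close>
  have f_cdf: "emeasure (density lborel ?f) {..t} = (\<integral>\<^sup>+ s. ennreal (rho1 m n s + rho2 m n s) * indicator {0<..<min t 1} s \<partial>lborel)" for t
  proof -
    have "emeasure (density lborel ?f) {..t} = (\<integral>\<^sup>+ s. ?f s * indicator {..t} s \<partial>lborel)"
      by (subst emeasure_density) auto
    also have "\<dots> = (\<integral>\<^sup>+ s. ennreal (rho1 m n s + rho2 m n s) * indicator {0<..<min t 1} s \<partial>lborel)"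
    proof (rule nn_integral_cong_AE)
      show "AE s in lborel. ?f s * indicator {..t} s = ennreal (rho1 m n s + rho2 m n s) * indicator {0<..<min t 1} s"
        using AE_lborel_singleton[of t] by eventually_elim (auto split: split_indicator)
    qed
    finally show ?thesis .
  qed
  have "emeasure (density lborel ?f) (space (density lborel ?f)) = (\<integral>\<^sup>+ s. ennreal (rho1 m n s + rho2 m n s) * indicator {0<..<1} s \<partial>lborel)"
    by (subst emeasure_density) (auto intro!: nn_integral_cong split: split_indicator)
  then have total: "emeasure (density lborel ?f) (space (density lborel ?f)) = 1"
    using rho_total[OF assms(2,3)] by simp
  interpret D: real_distribution "density lborel ?f"
    by (intro real_distribution.intro prob_spaceI total) (simp add: real_distribution_axioms_def)
  interpret R: real_distribution "distr M borel T"
    by (intro real_distribution.intro prob_space_distr T) (simp add: real_distribution_axioms_def)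
  have T01: "AE \<omega> in M. 0 \<le> T \<omega> \<and> T \<omega> \<le> 1"
    using assms(8) by eventually_elim (auto simp: attains_combined_max_def)
  have R_cdf: "emeasure (distr M borel T) {..t} = emeasure M {\<omega> \<in> space M. T \<omega> \<le> t}" for t
    by (subst emeasure_distr) (auto intro!: arg_cong[where f = "emeasure M"])
  have inner: "cdf (distr M borel T) t = cdf (density lborel ?f) t" if "0 < t" "t < 1" for t
    using law[OF that] that unfolding cdf_def measure_def R_cdf f_cdf by simp
  have "cdf (distr M borel T) t = cdf (density lborel ?f) t" for t
  proof -
    consider "t < 0" | "t = 0" | "0 < t \<and> t < 1" | "1 \<le> t" by linarith
    then show ?thesis
    proof cases
      case 1
      have "emeasure M {\<omega> \<in> space M. T \<omega> \<le> t} = 0"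
        by (rule emeasure_eq_0_AE) (use T01 1 in \<open>auto elim!: eventually_mono\<close>)
      then show ?thesis unfolding cdf_def measure_def R_cdf f_cdf using 1 by simp
    next
      case 2
      \<comment> \<open>The law of \<open>T\<close> is known only at interior times; right
        continuity carries the equality to 0 and rules out an atom there.\<close>
      have "(cdf (distr M borel T) \<longlongrightarrow> cdf (distr M borel T) 0) (at_right 0)"
        using R.cdf_is_right_cont by (simp add: continuous_within)
      moreover have "\<forall>\<^sub>F t in at_right (0::real). cdf (distr M borel T) t = cdf (density lborel ?f) t"
        by (intro eventually_at_rightI[of 0 1] inner) auto
      ultimately have "(cdf (density lborel ?f) \<longlongrightarrow> cdf (distr M borel T) 0) (at_right 0)"
        by (subst (asm) tendsto_cong)
      moreover have "(cdf (density lborel ?f) \<longlongrightarrow> cdf (density lborel ?f) 0) (at_right 0)"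
        using D.cdf_is_right_cont by (simp add: continuous_within)
      ultimately show ?thesis using tendsto_unique[OF trivial_limit_at_right_real] by (simp only: 2)
    next
      case 3
      then show ?thesis using inner by simp
    next
      case 4
      \<comment> \<open>Both distribution functions equal 1 from time 1 on, one because
        \<open>T\<close> is at most 1 and the other by \<open>rho_total\<close>.\<close>
      have "emeasure M {\<omega> \<in> space M. T \<omega> \<le> t} = 1"
      proof (rule emeasure_eq_1_AE)
        show "{\<omega> \<in> space M. T \<omega> \<le> t} \<in> sets M" by measurable
        show "AE \<omega> in M. \<omega> \<in> {\<omega> \<in> space M. T \<omega> \<le> t}"
          using T01 AE_space by eventually_elim (use 4 in auto)
      qed
      then show ?thesis unfolding cdf_def measure_def R_cdf f_cdf using 4 rho_total[OF assms(2,3)] by simp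
    qed
  qed
  then have "distr M borel T = density lborel ?f"
    by (intro cdf_unique R.real_distribution_axioms D.real_distribution_axioms ext)
  moreover have "distr M lborel T = distr M borel T" by (rule distr_cong) auto
  ultimately show "distributed M lborel T ?f"
    unfolding distributed_def by simp
qed

end
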